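(* Let $m,n\geq 1$, $1\leq p\leq\infty$, let $T\in\mathcal{L}(^{m}\ell_{1};\ell_{p})$ be a continuous $m$-linear map $\ell_1\times\cdots\times\ell_1\to\ell_p$ and let $A_{k}\in\mathcal{L}(^{n}\ell_{\infty};\ell_{1})$ be continuous $n$-linear maps $\ell_\infty\times\cdots\times\ell_\infty\to\ell_1$ for $k=1,\dots,m$. Let $T(A_1,\dots,A_m)$ be the $mn$-linear map from $\ell_\infty\times\cdots\times\ell_\infty$ ($mn$ factors) to $\ell_p$ obtained by composition. (1) $T(A_{1},\dots,A_{m})$ is multiple $(r,1)$-summing for $$r=\begin{cases}\dfrac{2n}{n+2-\frac{2}{p}} & \text{ if }1\leq p\leq2,\\[2mm] \dfrac{2n}{n+\frac{2}{p}} & \text{ if }2\leq p\leq+\infty.\end{cases}$$ (2) Assume $n\geq 2$. Then $T(A_{1},\dots,A_{m})$ is absolutely $(r,2)$-summing for $$r=\begin{cases}\dfrac{2p}{mp+2p-2} & \text{ if }1\leq p\leq2,\\[2mm] \dfrac{2p}{mp+2} & \text{ if }2\leq p\leq+\infty\end{cases}$$ (for $p=\infty$, the last expression is read as its limit $2/m$).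
   Context: Scalars are $\mathbb K=\mathbb R$ or $\mathbb C$. The composition is $T(A_1,\dots,A_m)(x^{(1)}_1,\dots,x^{(1)}_n,\dots,x^{(m)}_1,\dots,x^{(m)}_n)=T\big(A_1(x^{(1)}_1,\dots,x^{(1)}_n),\dots,A_m(x^{(m)}_1,\dots,x^{(m)}_n)\big)$. For a sequence $x=(x_i)$ in a Banach space $X$, $\omega_s(x)=\sup_{\|x^*\|\leq 1}\big(\sum_i |x^*(x_i)|^s\big)^{1/s}$, the supremum being over the closed unit ball of $X^*$. For $r\in(0,\infty)$, $s\geq 1$, an $N$-linear map $S:X_1\times\cdots\times X_N\to Y$ is multiple $(r,s)$-summing if there is $C>0$ with $$\Big(\sum_{i_1,\dots,i_N\in\mathbb N}\|S(x_{i_1}(1),\dots,x_{i_N}(N))\|^r\Big)^{1/r}\leq C\,\omega_s(x(1))\cdots\omega_s(x(N))$$ for all sequences $x(j)=(x_i(j))_i\subset X_j$; it is absolutely $(r,s)$-summing if there is $C>0$ with $$\Big(\sum_{i\in\mathbb N}\|S(x_{i}(1),\dots,x_{i}(N))\|^r\Big)^{1/r}\leq C\,\omega_s(x(1))\cdots\omega_s(x(N))$$ for all such sequences. *)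

theory Defs
  imports "HOL-Analysis.Analysis"
begin

text \<open>
  The exponent of \<open>\<ell>\<^sub>p\<close> varies over \<open>[1, \<infinity>]\<close> inside a statement, so normed spaces are given
  by explicit carriers. The scalar type \<open>'k\<close> is meant to be instantiated by \<open>real\<close> and
  \<open>complex\<close>; linearity is always \<open>'k\<close>-linearity.
\<close>

record ('k, 'v) nspace =
  vcarrier :: "'v set"
  vadd :: "'v \<Rightarrow> 'v \<Rightarrow> 'v"
  vscale :: "'k \<Rightarrow> 'v \<Rightarrow> 'v"
  vnorm :: "'v \<Rightarrow> real"

definition vdist :: "('k::real_normed_field, 'v) nspace \<Rightarrow> 'v \<Rightarrow> 'v \<Rightarrow> real" where
  "vdist X u v = vnorm X (vadd X u (vscale X (- 1) v))"

definition lp_carrier :: "ereal \<Rightarrow> (nat \<Rightarrow> 'k::real_normed_field) set" where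
  "lp_carrier p =
    (if p = \<infinity> then {x. bounded (range x)}
     else {x. summable (\<lambda>i. norm (x i) powr real_of_ereal p)})"

definition lp_norm :: "ereal \<Rightarrow> (nat \<Rightarrow> 'k::real_normed_field) \<Rightarrow> real" where
  "lp_norm p x =
    (if p = \<infinity> then (SUP i. norm (x i))
     else (\<Sum>i. norm (x i) powr real_of_ereal p) powr (1 / real_of_ereal p))"

definition lp_space :: "ereal \<Rightarrow> ('k::real_normed_field, nat \<Rightarrow> 'k) nspace" where
  "lp_space p =
    \<lparr>vcarrier = lp_carrier p,
     vadd = (\<lambda>x y i. x i + y i),
     vscale = (\<lambda>c x i. c * x i),
     vnorm = lp_norm p\<rparr>"

text \<open>
  An argument tuple for an \<open>N\<close>-linear map on \<open>X\<^sub>0 \<times> \<dots> \<times> X\<^sub>N\<^sub>-\<^sub>1\<close> is an extensional function on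
  \<open>{..<N}\<close>. A map is only ever constrained on such tuples.
\<close>

definition tuples :: "nat \<Rightarrow> (nat \<Rightarrow> ('k, 'v) nspace) \<Rightarrow> (nat \<Rightarrow> 'v) set" where
  "tuples N X = (\<Pi>\<^sub>E j\<in>{..<N}. vcarrier (X j))"

definition multilinear_map ::
  "nat \<Rightarrow> (nat \<Rightarrow> ('k::real_normed_field, 'v) nspace) \<Rightarrow> ('k, 'w) nspace
    \<Rightarrow> ((nat \<Rightarrow> 'v) \<Rightarrow> 'w) \<Rightarrow> bool" where
  "multilinear_map N X Y S \<longleftrightarrow>
    (\<forall>x\<in>tuples N X. S x \<in> vcarrier Y) \<and>
    (\<forall>x\<in>tuples N X. \<forall>j<N. \<forall>u\<in>vcarrier (X j). \<forall>v\<in>vcarrier (X j).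
      S (x(j := vadd (X j) u v)) = vadd Y (S (x(j := u))) (S (x(j := v)))) \<and>
    (\<forall>x\<in>tuples N X. \<forall>j<N. \<forall>c. \<forall>u\<in>vcarrier (X j).
      S (x(j := vscale (X j) c u)) = vscale Y c (S (x(j := u))))"

definition continuous_multilinear_map ::
  "nat \<Rightarrow> (nat \<Rightarrow> ('k::real_normed_field, 'v) nspace) \<Rightarrow> ('k, 'w) nspace
    \<Rightarrow> ((nat \<Rightarrow> 'v) \<Rightarrow> 'w) \<Rightarrow> bool" where
  "continuous_multilinear_map N X Y S \<longleftrightarrow>
    multilinear_map N X Y S \<and>
    (\<forall>x\<in>tuples N X. \<forall>\<epsilon>>0. \<exists>\<delta>>0. \<forall>y\<in>tuples N X.
      (\<forall>j<N. vdist (X j) (y j) (x j) < \<delta>) \<longrightarrow> vdist Y (S y) (S x) < \<epsilon>)"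

text \<open>
  The argument \<open>x\<^sup>(\<^sup>k\<^sup>)\<^sub>i\<close> (\<open>k < m\<close>, \<open>i < n\<close>) of the composition \<open>T(A\<^sub>0, \<dots>, A\<^sub>m\<^sub>-\<^sub>1)\<close> has position
  \<open>k * n + i\<close> in its tuple of \<open>m * n\<close> arguments.
\<close>

definition multi_comp ::
  "nat \<Rightarrow> nat \<Rightarrow> ((nat \<Rightarrow> 'v) \<Rightarrow> 'w) \<Rightarrow> (nat \<Rightarrow> (nat \<Rightarrow> 'u) \<Rightarrow> 'v)
    \<Rightarrow> (nat \<Rightarrow> 'u) \<Rightarrow> 'w" where
  "multi_comp m n T A x = T (\<lambda>k\<in>{..<m}. A k (\<lambda>i\<in>{..<n}. x (k * n + i)))"

definition dual_unit_ball :: "('k::real_normed_field, 'v) nspace \<Rightarrow> ('v \<Rightarrow> 'k) set" where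
  "dual_unit_ball X =
    {\<phi>. (\<forall>u\<in>vcarrier X. \<forall>v\<in>vcarrier X. \<phi> (vadd X u v) = \<phi> u + \<phi> v) \<and>
        (\<forall>c. \<forall>u\<in>vcarrier X. \<phi> (vscale X c u) = c * \<phi> u) \<and>
        (\<forall>u\<in>vcarrier X. norm (\<phi> u) \<le> vnorm X u)}"

text \<open>Powers of extended nonnegative reals, used for positive exponents only.\<close>

definition epowr :: "ennreal \<Rightarrow> real \<Rightarrow> ennreal" where
  "epowr t a = (if t = \<infinity> then \<infinity> else ennreal (enn2real t powr a))"

definition weak_norm :: "real \<Rightarrow> ('k::real_normed_field, 'v) nspace \<Rightarrow> (nat \<Rightarrow> 'v) \<Rightarrow> ennreal" where
  "weak_norm s X x =
    (SUP \<phi>\<in>dual_unit_ball X. epowr (\<Sum>i. ennreal (norm (\<phi> (x i)) powr s)) (1 / s))"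

text \<open>
  Both sides of the summing inequalities live in \<open>[0, \<infinity>]\<close>, with \<open>0 * \<infinity> = 0\<close>; this convention
  is harmless because \<open>weak_norm s X x = 0\<close> forces \<open>x\<close> to vanish. In \<open>x j i\<close> the index \<open>j\<close> is
  the factor and \<open>i\<close> the position in the sequence.
\<close>

definition multiple_summing ::
  "nat \<Rightarrow> (nat \<Rightarrow> ('k::real_normed_field, 'v) nspace) \<Rightarrow> ('k, 'w) nspace
    \<Rightarrow> real \<Rightarrow> real \<Rightarrow> ((nat \<Rightarrow> 'v) \<Rightarrow> 'w) \<Rightarrow> bool" where
  "multiple_summing N X Y r s S \<longleftrightarrow>
    (\<exists>C>0. \<forall>x. (\<forall>j<N. \<forall>i. x j i \<in> vcarrier (X j)) \<longrightarrow>
      epowr (\<Sum>\<^sub>\<infinity>\<iota>\<in>({..<N} \<rightarrow>\<^sub>E (UNIV :: nat set)).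
               ennreal (vnorm Y (S (\<lambda>j\<in>{..<N}. x j (\<iota> j))) powr r)) (1 / r)
        \<le> ennreal C * (\<Prod>j<N. weak_norm s (X j) (x j)))"

definition absolutely_summing ::
  "nat \<Rightarrow> (nat \<Rightarrow> ('k::real_normed_field, 'v) nspace) \<Rightarrow> ('k, 'w) nspace
    \<Rightarrow> real \<Rightarrow> real \<Rightarrow> ((nat \<Rightarrow> 'v) \<Rightarrow> 'w) \<Rightarrow> bool" where
  "absolutely_summing N X Y r s S \<longleftrightarrow>
    (\<exists>C>0. \<forall>x. (\<forall>j<N. \<forall>i. x j i \<in> vcarrier (X j)) \<longrightarrow>
      epowr (\<Sum>i. ennreal (vnorm Y (S (\<lambda>j\<in>{..<N}. x j i)) powr r)) (1 / r)
        \<le> ennreal C * (\<Prod>j<N. weak_norm s (X j) (x j)))"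

end

theory Submission
  imports Defs "HOL-Complex_Analysis.Complex_Analysis"
begin

text \<open>
  The coefficients of \<open>A\<^sub>k\<close> along the given sequences form a tensor with entries in \<open>\<ell>\<^sub>1\<close>. For
  \<open>p = 1\<close> and \<open>p = \<infinity>\<close> the composition is bounded by the product of the \<open>\<ell>\<^sub>1\<close> norms of these
  entries, which are square summable by cotype 2. For \<open>p = 2\<close> Grothendieck's inequality says
  that a bounded matrix, applied to bounded families of Hilbert space vectors, has summable rows;
  Khinchin's inequality and Blei's interpolation turn this into the exponent \<open>2n/(n+1)\<close> for
  \<open>n\<close>-tensors. To pass from one \<open>A\<^sub>k\<close> to \<open>m\<close> of them, a near-extremal family of vectors yields
  Maurey weights for the rows, and such weights multiply under tensor products. For the remaining
  \<open>p\<close> one interpolates by the three lines theorem, letting the coefficients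
  \<open>T(e\<^sub>j, \<dots>)\<close>, which are arbitrary vectors in a ball of \<open>\<ell>\<^sub>p\<close>, depend analytically on the
  parameter.

  In (2), the multilinear Grothendieck inequality makes \<open>A\<^sub>k(x\<^sub>i, \<dots>)\<close> weakly 1-summable in
  \<open>\<ell>\<^sub>1\<close>; its Maurey weights \<open>\<lambda>\<^sub>k\<close> are summable and dividing by \<open>sqrt \<lambda>\<^sub>k\<close> leaves a problem in
  which the exponents \<open>\<infinity>\<close> and \<open>2\<close> are interpolated. Hoelder's inequality restores the factors
  \<open>sqrt \<lambda>\<^sub>k\<close> and contributes \<open>m/2\<close> to \<open>1/r\<close>.
\<close>

subsection \<open>Rademacher averages\<close>

text \<open>Vectors in an arbitrary finite-dimensional Hilbert space are carried along throughout,
  because the tensor product step feeds the images under one matrix, regarded as vectors in a larger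
  Hilbert space, into the next matrix. Reciprocals of exponents interpolate linearly. Writing
  \<open>1/p = (1 - \<theta>) a0 + \<theta>/2\<close> with \<open>a0 = 1\<close> for
  \<open>p \<le> 2\<close> and \<open>a0 = 0\<close> for \<open>p \<ge> 2\<close> gives
  \<open>\<theta> = 2 - 2/p\<close> and \<open>\<theta> = 2/p\<close>. In (1) the trivial end has
  reciprocal exponent \<open>1/2\<close> and the Hilbert space end \<open>(n + 1)/(2n)\<close>, so
  \<open>1/r = 1/2 + \<theta>/(2n)\<close>. In (2), after division by the weights, the ends are
  \<open>0\<close> and \<open>1/2\<close>, so \<open>1/r = m/2 + \<theta>/2\<close>. For
  \<open>p = 1\<close> and \<open>p = \<infinity>\<close> one has \<open>\<theta> = 0\<close>, and
  the direct estimate takes the place of interpolation. Everything is first proved for finite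
  matrices with constants independent of their size. In (2) this meets an obstacle: norm
  approximation by finite truncations fails for bounded sequences, so they are replaced by finitely
  valued ones.\<close>

definition words :: "'a set \<Rightarrow> nat \<Rightarrow> 'a list set" where
  "words S n = {xs. set xs \<subseteq> S \<and> length xs = n}"

lemma finite_words: "finite S \<Longrightarrow> finite (words S n)"
  unfolding words_def by (rule finite_lists_length_eq)

lemma words_0 [simp]: "words S 0 = {[]}"
  by (auto simp: words_def)

lemma words_nth: "xs \<in> words S n \<Longrightarrow> k < n \<Longrightarrow> xs ! k \<in> S"
  by (auto simp: words_def)

lemma words_Suc: "words S (Suc n) = (\<lambda>(a, xs). a # xs) ` (S \<times> words S n)"
  by (auto simp: words_def image_iff length_Suc_conv)

lemma sum_words_Suc: "(\<Sum>xs\<in>words S (Suc n). f xs) = (\<Sum>a\<in>S. \<Sum>xs\<in>words S n. f (a # xs))"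
proof -
  have "inj_on (\<lambda>(a, xs). a # xs) (S \<times> words S n)"
    by (auto simp: inj_on_def)
  then show ?thesis
    by (simp add: words_Suc sum.reindex sum.cartesian_product case_prod_unfold)
qed

lemma words_Suc_snoc: "words S (Suc n) = (\<lambda>(xs, a). xs @ [a]) ` (words S n \<times> S)"
proof
  show "words S (Suc n) \<subseteq> (\<lambda>(xs, a). xs @ [a]) ` (words S n \<times> S)"
  proof
    fix xs assume "xs \<in> words S (Suc n)"
    then have "xs \<noteq> []" "set xs \<subseteq> S" "length xs = Suc n" by (auto simp: words_def)
    then have "xs = butlast xs @ [last xs]" "set (butlast xs) \<subseteq> S" "last xs \<in> S" "length (butlast xs) = n"
      by (auto dest: in_set_butlastD)
    then show "xs \<in> (\<lambda>(xs, a). xs @ [a]) ` (words S n \<times> S)"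
      unfolding words_def by (intro image_eqI[where x = "(butlast xs, last xs)"]) auto
  qed
qed (auto simp: words_def)

lemma sum_words_snoc: "(\<Sum>xs\<in>words S (Suc n). f xs) = (\<Sum>xs\<in>words S n. \<Sum>a\<in>S. f (xs @ [a]))"
proof -
  have "inj_on (\<lambda>(xs, a). xs @ [a]) (words S n \<times> S)"
    by (auto simp: inj_on_def)
  then show ?thesis
    by (simp add: words_Suc_snoc sum.reindex sum.cartesian_product case_prod_unfold)
qed

text \<open>The distributive law over multi-indices. It factors sums over all rows of a product
  matrix, such as sums of squares or absolute row sums, into one factor per block.\<close>

lemma sum_prod_words:
  fixes f :: "nat \<Rightarrow> 'a \<Rightarrow> 'b::comm_semiring_1"
  shows "(\<Sum>xs\<in>words S n. \<Prod>k<n. f k (xs ! k)) = (\<Prod>k<n. \<Sum>a\<in>S. f k a)"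
proof (induction n arbitrary: f)
  case (Suc n)
  have "(\<Sum>xs\<in>words S (Suc n). \<Prod>k<Suc n. f k (xs ! k))
      = (\<Sum>a\<in>S. \<Sum>xs\<in>words S n. f 0 a * (\<Prod>k<n. f (Suc k) (xs ! k)))"
    by (simp only: sum_words_Suc prod.lessThan_Suc_shift nth_Cons_0 nth_Cons_Suc)
  also have "\<dots> = (\<Sum>a\<in>S. f 0 a) * (\<Prod>k<n. \<Sum>a\<in>S. f (Suc k) a)"
    by (simp add: sum_distrib_left[symmetric] Suc.IH[of "\<lambda>k. f (Suc k)"] sum_distrib_right[symmetric])
  finally show ?case
    by (simp only: prod.lessThan_Suc_shift)
qed simp

abbreviation signs :: "nat \<Rightarrow> real list set" where
  "signs N \<equiv> words {-1, 1} N"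

text \<open>The expectation over independent random signs, as a finite average over all sign
  vectors.\<close>

definition rad :: "nat \<Rightarrow> (real list \<Rightarrow> 'a::real_normed_field) \<Rightarrow> 'a" where
  "rad N f = (\<Sum>e\<in>signs N. f e) / 2 ^ N"

definition rsum :: "nat \<Rightarrow> (nat \<Rightarrow> 'a::real_normed_field) \<Rightarrow> real list \<Rightarrow> 'a" where
  "rsum N x e = (\<Sum>k<N. of_real (e ! k) * x k)"

lemma finite_signs [simp]: "finite (signs N)"
  by (rule finite_words) simp

lemma rad_0 [simp]: "rad 0 f = f []"
  by (simp add: rad_def)

lemma rad_Suc: "rad (Suc N) f = rad N (\<lambda>e. (f (1 # e) + f (-1 # e)) / 2)"
proof -
  have "(\<Sum>e\<in>signs (Suc N). f e) = (\<Sum>e\<in>signs N. f (1 # e) + f (-1 # e))"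
    unfolding sum_words_Suc by (simp add: sum.distrib)
  then show ?thesis
    by (simp add: rad_def sum_divide_distrib field_simps)
qed

lemma rad_add: "rad N (\<lambda>e. f e + g e) = rad N f + rad N g"
  by (simp add: rad_def sum.distrib add_divide_distrib)

lemma rad_diff: "rad N (\<lambda>e. f e - g e) = rad N f - rad N g"
  by (simp add: rad_def sum_subtractf diff_divide_distrib)

lemma rad_cmult: "rad N (\<lambda>e. c * f e) = c * rad N f"
  by (simp add: rad_def sum_distrib_left)

lemma rad_cdiv: "rad N (\<lambda>e. f e / c) = rad N f / c"
  by (simp add: rad_def sum_divide_distrib divide_divide_eq_left mult.commute)

lemma rad_sum: "rad N (\<lambda>e. \<Sum>i\<in>I. f i e) = (\<Sum>i\<in>I. rad N (f i))"
  by (simp add: rad_def sum_divide_distrib sum.swap[of _ I])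

lemma rad_const [simp]: "rad N (\<lambda>_. c) = c"
  by (induction N) (simp_all add: rad_Suc)

lemma rad_mono:
  fixes f :: "real list \<Rightarrow> real"
  shows "(\<And>e. e \<in> signs N \<Longrightarrow> f e \<le> g e) \<Longrightarrow> rad N f \<le> rad N g"
  by (simp add: rad_def divide_right_mono sum_mono)

lemma rad_cong:
  shows "(\<And>e. e \<in> signs N \<Longrightarrow> f e = g e) \<Longrightarrow> rad N f = rad N g"
  by (simp add: rad_def)

lemma rad_le:
  fixes f :: "real list \<Rightarrow> real"
  shows "(\<And>e. e \<in> signs N \<Longrightarrow> f e \<le> c) \<Longrightarrow> rad N f \<le> c"
  using rad_mono[of N f "\<lambda>_. c"] by simp

lemma norm_rad_le: "norm (rad N f) \<le> rad N (\<lambda>e. norm (f e))"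
  by (simp add: rad_def norm_divide norm_power divide_right_mono norm_sum)

lemma rsum_Cons: "rsum (Suc N) x (a # e) = of_real a * x 0 + rsum N (\<lambda>k. x (Suc k)) e"
  unfolding rsum_def by (simp only: sum.lessThan_Suc_shift nth_Cons_0 nth_Cons_Suc)

lemma rsum_Nil [simp]: "rsum 0 x e = 0"
  by (simp add: rsum_def)

lemma signs_nth: "e \<in> signs N \<Longrightarrow> k < N \<Longrightarrow> \<bar>e ! k\<bar> = 1"
  by (auto simp: words_def dest!: nth_mem)

text \<open>The coordinates of a sign vector are orthonormal. No conjugate occurs, so bilinear
  pairings of coefficient vectors become averages as they stand; this is the door through which
  truncation enters Grothendieck's inequality.\<close>

lemma rad_rsum_rsum: "rad N (\<lambda>e. rsum N x e * rsum N y e) = (\<Sum>k<N. x k * y k)"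
proof (induction N arbitrary: x y)
  case (Suc N)
  have "rad (Suc N) (\<lambda>e. rsum (Suc N) x e * rsum (Suc N) y e)
    = rad N (\<lambda>e. x 0 * y 0 + rsum N (\<lambda>k. x (Suc k)) e * rsum N (\<lambda>k. y (Suc k)) e)"
    unfolding rad_Suc rsum_Cons by (rule rad_cong) (simp add: field_simps)
  then show ?case
    by (simp add: rad_add Suc.IH sum.lessThan_Suc_shift del: sum.lessThan_Suc)
qed simp

lemma rad_nth_rsum:
  assumes "k < N" shows "rad N (\<lambda>e. of_real (e ! k) * rsum N x e) = x k"
proof -
  have "rsum N (\<lambda>l. if l = k then 1 else 0) = (\<lambda>e. of_real (e ! k) :: 'a)"
    using assms by (auto simp: rsum_def if_distrib cong: if_cong)
  with rad_rsum_rsum[of N "\<lambda>l. if l = k then 1 else 0" x] show ?thesis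
    using assms by (simp add: if_distrib if_distribR cong: if_cong)
qed

text \<open>The coordinate set is explicit because the proofs pass to disjoint sums, products and
  sets of sign vectors as new coordinate sets.\<close>

definition l2 :: "'d set \<Rightarrow> ('d \<Rightarrow> complex) \<Rightarrow> real" where
  "l2 D f = sqrt (\<Sum>d\<in>D. (norm (f d))\<^sup>2)"

lemma l2_sq: "(l2 D f)\<^sup>2 = (\<Sum>d\<in>D. (norm (f d))\<^sup>2)"
  by (simp add: l2_def sum_nonneg)

lemma l2_nonneg [simp]: "0 \<le> l2 D f"
  by (simp add: l2_def sum_nonneg)

lemma l2_eq_L2_set: "l2 D f = L2_set (\<lambda>d. norm (f d)) D"
  by (simp add: l2_def L2_set_def)

lemma l2_le_1_iff: "l2 D f \<le> 1 \<longleftrightarrow> (\<Sum>d\<in>D. (norm (f d))\<^sup>2) \<le> 1"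
  by (simp add: l2_def)

lemma l2_cmult: "l2 D (\<lambda>d. c * f d) = norm c * l2 D f"
  by (simp add: l2_def norm_mult power_mult_distrib sum_distrib_left[symmetric] real_sqrt_mult)

lemma l2_CS: "norm (\<Sum>d\<in>D. f d * g d) \<le> l2 D f * l2 D g"
proof -
  have "norm (\<Sum>d\<in>D. f d * g d) \<le> (\<Sum>d\<in>D. \<bar>norm (f d)\<bar> * \<bar>norm (g d)\<bar>)"
    by (rule order_trans[OF norm_sum]) (simp add: norm_mult)
  then show ?thesis
    unfolding l2_eq_L2_set by (rule order_trans[OF _ L2_set_mult_ineq])
qed

lemma norm_plus_minus_sq:
  "(norm (a + b))\<^sup>2 + (norm (a - b))\<^sup>2 = 2 * (norm (a::complex))\<^sup>2 + 2 * (norm b)\<^sup>2"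
  unfolding cmod_power2 by (simp add: power2_eq_square algebra_simps)

text \<open>Splitting off the first sign, the parallelogram law removes the cross terms.\<close>

lemma rad_l2_sq:
  fixes x :: "nat \<Rightarrow> 'd \<Rightarrow> complex"
  shows "rad N (\<lambda>e. \<Sum>d\<in>D. (norm (rsum N (\<lambda>k. x k d) e))\<^sup>2) = (\<Sum>k<N. \<Sum>d\<in>D. (norm (x k d))\<^sup>2)"
proof (induction N arbitrary: x)
  case (Suc N)
  have "rad (Suc N) (\<lambda>e. \<Sum>d\<in>D. (norm (rsum (Suc N) (\<lambda>k. x k d) e))\<^sup>2)
    = rad N (\<lambda>e. (\<Sum>d\<in>D. (norm (x 0 d))\<^sup>2) + (\<Sum>d\<in>D. (norm (rsum N (\<lambda>k. x (Suc k) d) e))\<^sup>2))"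
  proof (unfold rad_Suc rsum_Cons, rule rad_cong)
    fix e assume "e \<in> signs N"
    have "((norm (of_real 1 * x 0 d + rsum N (\<lambda>k. x (Suc k) d) e))\<^sup>2 +
        (norm (of_real (-1) * x 0 d + rsum N (\<lambda>k. x (Suc k) d) e))\<^sup>2)
        = 2 * ((norm (x 0 d))\<^sup>2 + (norm (rsum N (\<lambda>k. x (Suc k) d) e))\<^sup>2)" for d
      using norm_plus_minus_sq[of "x 0 d" "rsum N (\<lambda>k. x (Suc k) d) e"]
      by (simp add: norm_minus_commute)
    then show "((\<Sum>d\<in>D. (norm (of_real 1 * x 0 d + rsum N (\<lambda>k. x (Suc k) d) e))\<^sup>2) +
        (\<Sum>d\<in>D. (norm (of_real (-1) * x 0 d + rsum N (\<lambda>k. x (Suc k) d) e))\<^sup>2)) / 2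
        = (\<Sum>d\<in>D. (norm (x 0 d))\<^sup>2) + (\<Sum>d\<in>D. (norm (rsum N (\<lambda>k. x (Suc k) d) e))\<^sup>2)"
      by (simp only: sum.distrib[symmetric] sum_distrib_left[symmetric])
  qed
  then show ?case
    by (simp add: rad_add Suc.IH sum.lessThan_Suc_shift del: sum.lessThan_Suc)
qed simp

text \<open>With the first sign split off, the two values are \<open>B + A \<plusminus> 2P\<close>,
  where \<open>P\<close> is the real part of an inner product and hence
  \<open>P^2 \<le> A B\<close>. The average of their squares is at most
  \<open>A^2 + 6AB + B^2\<close>, and the factor 3 is just large enough for
  \<open>3Q^2 + 6BQ + B^2 \<le> 3(B + Q)^2\<close>.\<close>

lemma rad_l2_4th:
  fixes x :: "nat \<Rightarrow> 'd \<Rightarrow> complex"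
  shows
  "rad N (\<lambda>e. (\<Sum>d\<in>D. (norm (rsum N (\<lambda>k. x k d) e))\<^sup>2)\<^sup>2) \<le> 3 * (\<Sum>k<N. \<Sum>d\<in>D. (norm (x k d))\<^sup>2)\<^sup>2"
proof (induction N arbitrary: x)
  case (Suc N)
  define B where "B = (\<Sum>d\<in>D. (norm (x 0 d))\<^sup>2)"
  define A where "A = (\<lambda>e. \<Sum>d\<in>D. (norm (rsum N (\<lambda>k. x (Suc k) d) e))\<^sup>2)"
  define Q where "Q = (\<Sum>k<N. \<Sum>d\<in>D. (norm (x (Suc k) d))\<^sup>2)"
  have B0: "0 \<le> B" by (simp add: B_def sum_nonneg)
  have Q0: "0 \<le> Q" by (simp add: Q_def sum_nonneg)
  have EA: "rad N A = Q" unfolding A_def Q_def by (rule rad_l2_sq)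
  have EA2: "rad N (\<lambda>e. (A e)\<^sup>2) \<le> 3 * Q\<^sup>2" unfolding A_def Q_def by (rule Suc.IH)
  have "rad (Suc N) (\<lambda>e. (\<Sum>d\<in>D. (norm (rsum (Suc N) (\<lambda>k. x k d) e))\<^sup>2)\<^sup>2)
     \<le> rad N (\<lambda>e. (A e)\<^sup>2 + 6 * B * A e + B\<^sup>2)"
  proof (unfold rad_Suc rsum_Cons, rule rad_mono)
    fix e assume "e \<in> signs N"
    define s where "s = (\<lambda>d. rsum N (\<lambda>k. x (Suc k) d) e)"
    define P where "P = (\<Sum>d\<in>D. Re (x 0 d) * Re (s d) + Im (x 0 d) * Im (s d))"
    have sq: "(norm (u + v))\<^sup>2 = (norm u)\<^sup>2 + (norm v)\<^sup>2 + 2 * (Re u * Re v + Im u * Im v)" for u v :: complex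
      unfolding cmod_power2 by (simp add: power2_eq_square algebra_simps)
    have p: "(\<Sum>d\<in>D. (norm (of_real 1 * x 0 d + s d))\<^sup>2) = B + A e + 2 * P"
      by (simp add: sq sum.distrib A_def B_def P_def s_def sum_distrib_left)
    have m: "(\<Sum>d\<in>D. (norm (of_real (-1) * x 0 d + s d))\<^sup>2) = B + A e - 2 * P"
    proof -
      have "(norm (of_real (-1) * x 0 d + s d))\<^sup>2 = (norm (x 0 d))\<^sup>2 + (norm (s d))\<^sup>2
          - 2 * (Re (x 0 d) * Re (s d) + Im (x 0 d) * Im (s d))" for d
        using sq[of "- x 0 d" "s d"] by simp
      then show ?thesis
        by (simp add: sum.distrib sum_subtractf A_def B_def P_def s_def sum_distrib_left)
    qed
    have "P\<^sup>2 \<le> B * A e"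
    proof -
      have "\<bar>P\<bar> \<le> (\<Sum>d\<in>D. \<bar>norm (x 0 d)\<bar> * \<bar>norm (s d)\<bar>)"
        unfolding P_def
      proof (rule order_trans[OF sum_abs], rule sum_mono)
        fix d
        have "Re (x 0 d) * Re (s d) + Im (x 0 d) * Im (s d) = Re (x 0 d * cnj (s d))" by simp
        then show "\<bar>Re (x 0 d) * Re (s d) + Im (x 0 d) * Im (s d)\<bar> \<le> \<bar>norm (x 0 d)\<bar> * \<bar>norm (s d)\<bar>"
          by (metis abs_Re_le_cmod norm_mult complex_mod_cnj abs_norm_cancel)
      qed
      also have "\<dots> \<le> l2 D (x 0) * l2 D s" unfolding l2_eq_L2_set by (rule L2_set_mult_ineq)
      finally have "\<bar>P\<bar>\<^sup>2 \<le> (l2 D (x 0) * l2 D s)\<^sup>2" by (intro power_mono) auto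
      then show ?thesis by (simp add: power_mult_distrib l2_sq A_def B_def s_def)
    qed
    then have "((B + A e + 2 * P)\<^sup>2 + (B + A e - 2 * P)\<^sup>2) / 2 \<le> (A e)\<^sup>2 + 6 * B * A e + B\<^sup>2"
      by (simp add: power2_eq_square algebra_simps)
    then show "((\<Sum>d\<in>D. (norm (of_real 1 * x 0 d + rsum N (\<lambda>k. x (Suc k) d) e))\<^sup>2)\<^sup>2 +
        (\<Sum>d\<in>D. (norm (of_real (-1) * x 0 d + rsum N (\<lambda>k. x (Suc k) d) e))\<^sup>2)\<^sup>2) / 2
        \<le> (A e)\<^sup>2 + 6 * B * A e + B\<^sup>2"
      using p m unfolding s_def by simp
  qed
  also have "\<dots> = rad N (\<lambda>e. (A e)\<^sup>2) + 6 * B * Q + B\<^sup>2"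
    by (simp add: rad_add rad_cmult EA)
  also have "\<dots> \<le> 3 * (B + Q)\<^sup>2"
    using EA2 B0 Q0 by (simp add: power2_eq_square algebra_simps) (smt (verit) mult_nonneg_nonneg)
  finally show ?case
    by (simp add: sum.lessThan_Suc_shift B_def Q_def del: sum.lessThan_Suc)
qed simp

text \<open>The pointwise bound \<open>u \<ge> 3/4 (u\<^sup>2 - u\<^sup>4/12)\<close> replaces an interpolation of moments between
  the first, second and fourth moments.\<close>

lemma khinchin:
  "sqrt (\<Sum>k<N. \<Sum>d\<in>D. (norm (x k d))\<^sup>2) \<le> 2 * rad N (\<lambda>e. l2 D (\<lambda>d. rsum N (\<lambda>k. x k d) e))"
proof -
  define Q where "Q = (\<Sum>k<N. \<Sum>d\<in>D. (norm (x k d))\<^sup>2)"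
  define q where "q = sqrt Q"
  define Z where "Z = (\<lambda>e. l2 D (\<lambda>d. rsum N (\<lambda>k. x k d) e))"
  have Q0: "0 \<le> Q" by (simp add: Q_def sum_nonneg)
  have Zsq: "(Z e)\<^sup>2 = (\<Sum>d\<in>D. (norm (rsum N (\<lambda>k. x k d) e))\<^sup>2)" for e
    by (simp add: Z_def l2_sq)
  have E2: "rad N (\<lambda>e. (Z e)\<^sup>2) = Q" unfolding Zsq Q_def by (rule rad_l2_sq)
  have E4: "rad N (\<lambda>e. ((Z e)\<^sup>2)\<^sup>2) \<le> 3 * Q\<^sup>2" unfolding Zsq Q_def by (rule rad_l2_4th)
  show ?thesis
  proof (cases "Q = 0")
    case True
    have "0 \<le> rad N Z" using rad_mono[of N "\<lambda>_. 0" Z] by (simp add: Z_def)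
    then show ?thesis using True unfolding Q_def Z_def by simp
  next
    case False
    then have q: "q > 0" and qQ: "q\<^sup>2 = Q" using Q0 by (auto simp: q_def)
    have pt: "3/4 * ((Z e)\<^sup>2 / q - ((Z e)\<^sup>2)\<^sup>2 / (12 * q^3)) \<le> Z e" for e
    proof -
      define u where "u = Z e / q"
      have u0: "u \<ge> 0" using q by (simp add: u_def Z_def)
      \<comment> \<open>On \<open>u \<ge> 0\<close> the function \<open>u - u^3/12\<close> has its
        maximum \<open>4/3\<close> at \<open>u = 2\<close>; this product is 12 times the gap to the
        maximum.\<close>
      have "0 \<le> (u - 2)\<^sup>2 * (u + 4)" using u0 by simp
      then have "u^3 - 12 * u + 16 \<ge> 0" by (simp add: power2_eq_square power3_eq_cube algebra_simps)
      then have "u * (u - u^3/12) \<le> u * (4/3)" using u0 by (intro mult_left_mono) auto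
      then have "q * (3/4 * (u\<^sup>2 - u^4/12)) \<le> q * u"
        using q by (intro mult_left_mono) (auto simp: power2_eq_square power3_eq_cube power4_eq_xxxx algebra_simps)
      moreover have "Z e = q * u" using q by (simp add: u_def)
      moreover have "(q * u)\<^sup>2 / q = q * u\<^sup>2" "((q * u)\<^sup>2)\<^sup>2 / (12 * q^3) = q * u^4 / 12"
        using q by (simp_all add: field_simps power2_eq_square power3_eq_cube power4_eq_xxxx)
      ultimately show ?thesis by (simp add: algebra_simps)
    qed
    \<comment> \<open>Inserting the moments \<open>Q\<close> and \<open>3 Q^2\<close> leaves
      \<open>3/4 * (1 - 1/4) = 9/16\<close>, which is at least \<open>1/2\<close>; hence the
      constant 2.\<close>
    have "9/16 * q \<le> 3/4 * (Q / q - 3 * Q\<^sup>2 / (12 * q^3))"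
      unfolding qQ[symmetric] using q by (simp add: field_simps power2_eq_square power3_eq_cube)
    also have "\<dots> \<le> 3/4 * (rad N (\<lambda>e. (Z e)\<^sup>2) / q - rad N (\<lambda>e. ((Z e)\<^sup>2)\<^sup>2) / (12 * q^3))"
      using q E4 by (simp add: E2 divide_right_mono)
    also have "\<dots> = rad N (\<lambda>e. 3/4 * ((Z e)\<^sup>2 / q - ((Z e)\<^sup>2)\<^sup>2 / (12 * q^3)))"
      by (simp only: rad_cmult rad_diff rad_cdiv)
    also have "\<dots> \<le> rad N Z" using pt by (rule rad_mono)
    finally have "q \<le> 2 * rad N Z" using q by simp
    then show ?thesis by (simp add: q_def Q_def Z_def)
  qed
qed

lemma rad_sq_le: "rad N (\<lambda>e. (norm (rsum N x e))\<^sup>2) = (\<Sum>k<N. (norm (x k))\<^sup>2)" for x :: "nat \<Rightarrow> complex"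
  using rad_l2_sq[where D = "{()}" and x = "\<lambda>k _. x k"] by simp

lemma rad_4th_le: "rad N (\<lambda>e. (norm (rsum N x e))^4) \<le> 3 * (\<Sum>k<N. (norm (x k))\<^sup>2)\<^sup>2" for x :: "nat \<Rightarrow> complex"
  using rad_l2_4th[where D = "{()}" and x = "\<lambda>k _. x k"] by simp

text \<open>The threshold \<open>8\<close> is large enough for the part cut off from a normalised Rademacher sum to be
  absorbed in the proof of Grothendieck's inequality.\<close>

definition trunc :: "complex \<Rightarrow> complex" where
  "trunc z = (if norm z \<le> 8 then z else 0)"

lemma norm_trunc: "norm (trunc z) \<le> 8" "norm (trunc z) \<le> norm z"
  by (auto simp: trunc_def)

text \<open>Where the truncation acts, the modulus exceeds 8, so its square is at most
  \<open>1/64\<close> of its fourth power. The fourth moment is at most 3, and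
  \<open>3/64 \<le> 1/16\<close>.\<close>

lemma rad_trunc_rest:
  fixes x :: "nat \<Rightarrow> complex"
  assumes "(\<Sum>k<N. (norm (x k))\<^sup>2) \<le> 1"
  shows "rad N (\<lambda>e. (norm (rsum N x e - trunc (rsum N x e)))\<^sup>2) \<le> 1/16"
proof -
  have pt: "(norm (z - trunc z))\<^sup>2 \<le> 1/64 * (norm z)^4" for z
  proof (cases "norm z \<le> 8")
    case False
    then have "8\<^sup>2 * (norm z)\<^sup>2 \<le> (norm z)\<^sup>2 * (norm z)\<^sup>2"
      by (intro mult_right_mono power_mono) auto
    then show ?thesis using False by (simp add: trunc_def power4_eq_xxxx power2_eq_square)
  qed (simp add: trunc_def)
  have "rad N (\<lambda>e. (norm (rsum N x e - trunc (rsum N x e)))\<^sup>2) \<le> rad N (\<lambda>e. 1/64 * (norm (rsum N x e))^4)"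
    by (rule rad_mono) (rule pt)
  also have "\<dots> \<le> 1/64 * (3 * (\<Sum>k<N. (norm (x k))\<^sup>2)\<^sup>2)"
    unfolding rad_cmult using rad_4th_le[of N x] by simp
  also have "\<dots> \<le> 1/64 * (3 * 1)"
    using assms by (intro mult_left_mono) (auto intro!: power_le_one sum_nonneg)
  finally show ?thesis by simp
qed

subsection \<open>Grothendieck's inequality\<close>

text \<open>Only real test vectors are used, so that one hypothesis serves both scalar fields.\<close>

definition real_bounded :: "'i set \<Rightarrow> 'j set \<Rightarrow> ('i \<Rightarrow> 'j \<Rightarrow> complex) \<Rightarrow> bool" where
  "real_bounded I J v \<longleftrightarrow> (\<forall>s t. (\<forall>i\<in>I. \<bar>s i\<bar> \<le> 1) \<longrightarrow> (\<forall>j\<in>J. \<bar>t j\<bar> \<le> 1) \<longrightarrow>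
     norm (\<Sum>i\<in>I. \<Sum>j\<in>J. v i j * (of_real (s i) * of_real (t j))) \<le> 1)"

text \<open>Splitting both test vectors into real and imaginary parts gives four real tests, each
  scaled by \<open>c\<close>.\<close>

lemma real_bounded_complex:
  assumes v: "real_bounded I J v"
    and s: "\<And>i. i \<in> I \<Longrightarrow> norm (s i) \<le> c" and t: "\<And>j. j \<in> J \<Longrightarrow> norm (t j) \<le> c" and c: "c > 0"
  shows "norm (\<Sum>i\<in>I. \<Sum>j\<in>J. v i j * (s i * t j)) \<le> 4 * c\<^sup>2"
proof -
  define F where "F = (\<lambda>f g. \<Sum>i\<in>I. \<Sum>j\<in>J. v i j * (of_real (f (s i) / c) * of_real (g (t j) / c)))"
  have F: "norm (F f g) \<le> 1" if "f = Re \<or> f = Im" "g = Re \<or> g = Im" for f g :: "complex \<Rightarrow> real"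
  proof -
    have "\<bar>f z\<bar> \<le> norm z" "\<bar>g z\<bar> \<le> norm z" for z using that by (auto simp: abs_Re_le_cmod abs_Im_le_cmod)
    then have "\<forall>i\<in>I. \<bar>f (s i) / c\<bar> \<le> 1" "\<forall>j\<in>J. \<bar>g (t j) / c\<bar> \<le> 1"
      using s t c order_trans by (fastforce simp: abs_divide)+
    then show ?thesis
      using v[unfolded real_bounded_def, rule_format, of "\<lambda>i. f (s i) / c" "\<lambda>j. g (t j) / c"]
      unfolding F_def by blast
  qed
  have eq: "s i * t j = c\<^sup>2 * (of_real (Re (s i) / c) * of_real (Re (t j) / c)
      + \<i> * (of_real (Re (s i) / c) * of_real (Im (t j) / c))
      + \<i> * (of_real (Im (s i) / c) * of_real (Re (t j) / c))
      - of_real (Im (s i) / c) * of_real (Im (t j) / c))" for i j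
    using c by (simp add: complex_eq_iff power2_eq_square field_simps)
  have "(\<Sum>i\<in>I. \<Sum>j\<in>J. v i j * (s i * t j)) = c\<^sup>2 * (F Re Re + \<i> * F Re Im + \<i> * F Im Re - F Im Im)"
    unfolding eq F_def by (simp add: sum_distrib_left sum.distrib sum_subtractf ring_distribs mult_ac)
  also have "norm \<dots> \<le> c\<^sup>2 * (norm (F Re Re) + norm (F Re Im) + norm (F Im Re) + norm (F Im Im))"
  proof -
    have "norm (F Re Re + \<i> * F Re Im + \<i> * F Im Re - F Im Im)
       \<le> norm (F Re Re) + norm (\<i> * F Re Im) + norm (\<i> * F Im Re) + norm (F Im Im)"
      by (meson norm_triangle_ineq norm_triangle_ineq4 add_mono order_refl order_trans)
    then show ?thesis using c by (simp add: norm_mult norm_power)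
  qed
  also have "\<dots> \<le> c\<^sup>2 * (1 + 1 + 1 + 1)"
    by (intro mult_left_mono add_mono F) auto
  finally show ?thesis by simp
qed

lemma l2_reindex: "inj_on h D \<Longrightarrow> l2 (h ` D) f = l2 D (\<lambda>d. f (h d))"
  by (simp add: l2_def sum.reindex)

lemma finite_nat_indexing:
  assumes "finite D"
  obtains h where "inj_on h {..<card D}" "h ` {..<card D} = D"
  using ex_bij_betw_nat_finite[OF assms] by (auto simp: bij_betw_def atLeast0LessThan)

text \<open>Truncating the Rademacher sums with coefficient vectors \<open>x i\<close>, \<open>y j\<close> bounds the best constant
  \<open>K\<close> for a fixed matrix by \<open>256 + K/2\<close>.\<close>

lemma grothendieck:
  fixes x :: "'i \<Rightarrow> 'd \<Rightarrow> complex"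
  assumes fin: "finite I" "finite J" "finite D" and v: "real_bounded I J v"
    and x: "\<And>i. i \<in> I \<Longrightarrow> l2 D (x i) \<le> 1" and y: "\<And>j. j \<in> J \<Longrightarrow> l2 D (y j) \<le> 1"
  shows "norm (\<Sum>i\<in>I. \<Sum>j\<in>J. v i j * (\<Sum>d\<in>D. x i d * y j d)) \<le> 512"
proof -
  define V where "V = (\<lambda>N (x::'i \<Rightarrow> nat \<Rightarrow> complex) y. \<Sum>i\<in>I. \<Sum>j\<in>J. v i j * (\<Sum>d<N. x i d * y j d))"
  define S where "S = {norm (V N x y) | N x y. (\<forall>i\<in>I. l2 {..<N} (x i) \<le> 1) \<and> (\<forall>j\<in>J. l2 {..<N} (y j) \<le> 1)}"
  define K where "K = Sup S"
  \<comment> \<open>The crude bound makes \<open>K\<close> a genuine upper bound, so that the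
    self-improving estimate for it can be solved for \<open>K\<close>.\<close>
  have bdd: "bdd_above S"
  proof (rule bdd_aboveI[where M = "\<Sum>i\<in>I. \<Sum>j\<in>J. norm (v i j)"])
    fix q assume "q \<in> S"
    then obtain N x y where q: "q = norm (V N x y)" and xy: "\<forall>i\<in>I. l2 {..<N} (x i) \<le> 1" "\<forall>j\<in>J. l2 {..<N} (y j) \<le> 1"
      unfolding S_def by blast
    show "q \<le> (\<Sum>i\<in>I. \<Sum>j\<in>J. norm (v i j))"
      unfolding q V_def
    proof (intro sum_norm_le)
      fix i j assume "i \<in> I" "j \<in> J"
      then have "norm (\<Sum>d<N. x i d * y j d) \<le> 1 * 1"
        using xy by (intro order_trans[OF l2_CS] mult_mono) auto
      then show "norm (v i j * (\<Sum>d<N. x i d * y j d)) \<le> norm (v i j)"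
        by (simp add: norm_mult mult_left_le)
    qed
  qed
  have K: "norm (V N x y) \<le> K" if "\<forall>i\<in>I. l2 {..<N} (x i) \<le> 1" "\<forall>j\<in>J. l2 {..<N} (y j) \<le> 1" for N x y
    unfolding K_def using that by (intro cSup_upper bdd) (auto simp: S_def)
  have KD: "norm (\<Sum>i\<in>I. \<Sum>j\<in>J. v i j * (\<Sum>d\<in>D. x i d * y j d)) \<le> K"
    if D: "finite D" and xy: "\<forall>i\<in>I. l2 D (x i) \<le> 1" "\<forall>j\<in>J. l2 D (y j) \<le> 1" for D :: "'e set" and x y
  proof -
    obtain h where h: "inj_on h {..<card D}" "h ` {..<card D} = D" using finite_nat_indexing[OF D] .
    have "(\<Sum>d\<in>D. f d) = (\<Sum>d<card D. f (h d))" for f :: "'e \<Rightarrow> complex"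
      using sum.reindex[OF h(1), of f] h(2) by simp
    moreover have "l2 D f = l2 {..<card D} (\<lambda>d. f (h d))" for f
      using l2_reindex[OF h(1), of f] h(2) by simp
    ultimately show ?thesis
      using K[of "card D" "\<lambda>i d. x i (h d)" "\<lambda>j d. y j (h d)"] xy by (simp add: V_def)
  qed
  have K0: "0 \<le> K" using K[of 0 "\<lambda>_ _. 0" "\<lambda>_ _. 0"] by (simp add: l2_def V_def)
  \<comment> \<open>An average over signs is an inner product over the coordinate set
    \<open>signs N\<close> once both factors carry the weight \<open>w = 2^(-N/2)\<close>. Random
    variables with bounded second moments are thus admissible vectors after scaling, and
    \<open>K\<close> applies to them.\<close>
  have KR: "norm (rad N (\<lambda>e. \<Sum>i\<in>I. \<Sum>j\<in>J. v i j * (P i e * Q j e))) \<le> \<alpha> * \<beta> * K"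
    if P: "\<forall>i\<in>I. rad N (\<lambda>e. (norm (P i e))\<^sup>2) \<le> \<alpha>\<^sup>2" and Q: "\<forall>j\<in>J. rad N (\<lambda>e. (norm (Q j e))\<^sup>2) \<le> \<beta>\<^sup>2"
    and ab: "0 < \<alpha>" "0 < \<beta>" for N \<alpha> \<beta> and P :: "'i \<Rightarrow> real list \<Rightarrow> complex" and Q
  proof -
    define w :: complex where "w = of_real (1 / sqrt (2^N))"
    have w2: "w * w = 1 / 2^N"
      unfolding w_def of_real_mult[symmetric] by simp
    have nw: "(norm w)\<^sup>2 = 1 / 2^N" by (simp add: w_def norm_divide power_divide)
    define x where "x = (\<lambda>i e. w / \<alpha> * P i e)"
    define y where "y = (\<lambda>j e. w / \<beta> * Q j e)"
    have "l2 (signs N) (x i) \<le> 1" if "i \<in> I" for i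
    proof -
      have "(\<Sum>e\<in>signs N. (norm (x i e))\<^sup>2) = rad N (\<lambda>e. (norm (P i e))\<^sup>2) / \<alpha>\<^sup>2"
        unfolding x_def rad_def norm_mult norm_divide power_mult_distrib power_divide nw
        by (simp add: sum_divide_distrib)
      also have "\<dots> \<le> 1" using P ab that by simp
      finally show ?thesis unfolding l2_le_1_iff .
    qed
    moreover have "l2 (signs N) (y j) \<le> 1" if "j \<in> J" for j
    proof -
      have "(\<Sum>e\<in>signs N. (norm (y j e))\<^sup>2) = rad N (\<lambda>e. (norm (Q j e))\<^sup>2) / \<beta>\<^sup>2"
        unfolding y_def rad_def norm_mult norm_divide power_mult_distrib power_divide nw
        by (simp add: sum_divide_distrib)
      also have "\<dots> \<le> 1" using Q ab that by simp
      finally show ?thesis unfolding l2_le_1_iff .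
    qed
    ultimately have le: "norm (\<Sum>i\<in>I. \<Sum>j\<in>J. v i j * (\<Sum>e\<in>signs N. x i e * y j e)) \<le> K"
      by (intro KD) auto
    have xy: "x i e * y j e = P i e * Q j e / (2^N * (of_real \<alpha> * of_real \<beta>))" for i j e
    proof -
      have "x i e * y j e = (w * w) * (P i e * Q j e) / (of_real \<alpha> * of_real \<beta>)"
        unfolding x_def y_def by simp
      then show ?thesis by (simp add: w2)
    qed
    have "(\<Sum>i\<in>I. \<Sum>j\<in>J. v i j * (\<Sum>e\<in>signs N. x i e * y j e))
        = (\<Sum>e\<in>signs N. \<Sum>i\<in>I. \<Sum>j\<in>J. v i j * (x i e * y j e))"
      by (simp add: sum_distrib_left sum.swap[of _ "signs N"])
    also have "\<dots> = rad N (\<lambda>e. \<Sum>i\<in>I. \<Sum>j\<in>J. v i j * (P i e * Q j e)) / (of_real \<alpha> * of_real \<beta>)"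
      unfolding xy rad_def by (simp add: sum_divide_distrib)
    finally have "norm (rad N (\<lambda>e. \<Sum>i\<in>I. \<Sum>j\<in>J. v i j * (P i e * Q j e))) / (\<alpha> * \<beta>) \<le> K"
      using le ab by (simp add: norm_divide norm_mult)
    then show ?thesis using ab by (simp add: field_simps)
  qed
  have step: "norm (V N x y) \<le> 256 + K / 2"
    if x: "\<forall>i\<in>I. l2 {..<N} (x i) \<le> 1" and y: "\<forall>j\<in>J. l2 {..<N} (y j) \<le> 1" for N x y
  proof -
    define X where "X = (\<lambda>i. rsum N (x i))"
    define Y where "Y = (\<lambda>j. rsum N (y j))"
    define W where "W = (\<lambda>P Q. rad N (\<lambda>e. \<Sum>i\<in>I. \<Sum>j\<in>J. v i j * (P i e * Q j e)))"
    define TX where "TX = (\<lambda>i e. trunc (X i e))"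
    define TY where "TY = (\<lambda>i e. trunc (Y i e))"
    have X1: "rad N (\<lambda>e. (norm (X i e))\<^sup>2) \<le> 1" if "i \<in> I" for i
      using x that unfolding X_def rad_sq_le l2_le_1_iff by simp
    have Y1: "rad N (\<lambda>e. (norm (Y j e))\<^sup>2) \<le> 1" if "j \<in> J" for j
      using y that unfolding Y_def rad_sq_le l2_le_1_iff by simp
    have XR: "rad N (\<lambda>e. (norm (X i e - TX i e))\<^sup>2) \<le> (1/4)\<^sup>2" if "i \<in> I" for i
      using rad_trunc_rest[where N = N and x = "x i"] x that unfolding X_def TX_def l2_le_1_iff by (simp add: power2_eq_square)
    have YR: "rad N (\<lambda>e. (norm (Y j e - TY j e))\<^sup>2) \<le> (1/4)\<^sup>2" if "j \<in> J" for j
      using rad_trunc_rest[where N = N and x = "y j"] y that unfolding Y_def TY_def l2_le_1_iff by (simp add: power2_eq_square)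
    have TX1: "rad N (\<lambda>e. (norm (TX i e))\<^sup>2) \<le> 1" if "i \<in> I" for i
      by (rule order_trans[OF rad_mono X1[OF that]]) (simp add: TX_def norm_trunc power_mono)
    have "V N x y = W X Y"
      unfolding V_def W_def X_def Y_def rad_sum rad_cmult rad_rsum_rsum ..
    \<comment> \<open>The first term is bounded for every single sign vector, with constant
      \<open>4 * 8^2 = 256\<close>. In the two others one factor is a cut-off part of second moment
      at most \<open>1/16\<close>, so each costs at most \<open>K/4\<close>.\<close>
    also have "\<dots> = W TX TY + W (\<lambda>i e. X i e - TX i e) Y + W TX (\<lambda>j e. Y j e - TY j e)"
      unfolding W_def rad_add[symmetric] sum.distrib[symmetric]
      by (intro rad_cong sum.cong refl) (simp add: algebra_simps)
    also have "norm \<dots> \<le> 4 * 8\<^sup>2 + 1/4 * 1 * K + 1 * (1/4) * K"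
    proof (intro order_trans[OF norm_triangle_ineq] add_mono)
      show "norm (W TX TY) \<le> 4 * 8\<^sup>2"
        unfolding W_def
        by (intro order_trans[OF norm_rad_le] rad_le real_bounded_complex v) (simp_all add: TX_def TY_def norm_trunc)
      show "norm (W (\<lambda>i e. X i e - TX i e) Y) \<le> 1/4 * 1 * K"
        unfolding W_def using XR Y1 by (intro KR) auto
      show "norm (W TX (\<lambda>j e. Y j e - TY j e)) \<le> 1 * (1/4) * K"
        unfolding W_def using TX1 YR by (intro KR) auto
    qed
    finally show ?thesis by simp
  qed
  have "K \<le> 256 + K / 2"
    unfolding K_def
  proof (rule cSup_least)
    have "norm (V 0 (\<lambda>_ _. 0) (\<lambda>_ _. 0)) \<in> S" unfolding S_def by (force simp: l2_def)
    then show "S \<noteq> {}" by blast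
  qed (use step K_def in \<open>auto simp: S_def\<close>)
  then have "K \<le> 512" by simp
  then show ?thesis using KD[OF fin(3)] x y by fastforce
qed

subsection \<open>Hilbert space valued summability and its factorisation\<close>

text \<open>The constant bounds the sum of the powers, not its root, which makes it multiplicative
  under tensor products. Coordinate sets of natural numbers represent all finite dimensions within
  one type.\<close>

definition hilbert_summing :: "real \<Rightarrow> real \<Rightarrow> 'i set \<Rightarrow> 'j set \<Rightarrow> ('i \<Rightarrow> 'j \<Rightarrow> complex) \<Rightarrow> bool" where
  "hilbert_summing r K I J u \<longleftrightarrow>
    (\<forall>(D::nat set) y. finite D \<longrightarrow> (\<forall>j\<in>J. l2 D (y j) \<le> 1) \<longrightarrow>
       (\<Sum>i\<in>I. l2 D (\<lambda>d. \<Sum>j\<in>J. u i j * y j d) powr r) \<le> K)"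

lemma hilbert_summingD:
  fixes D :: "'d set"
  assumes u: "hilbert_summing r K I J u" and D: "finite D" and y: "\<And>j. j \<in> J \<Longrightarrow> l2 D (y j) \<le> 1"
  shows "(\<Sum>i\<in>I. l2 D (\<lambda>d. \<Sum>j\<in>J. u i j * y j d) powr r) \<le> K"
proof -
  obtain h where h: "inj_on h {..<card D}" "h ` {..<card D} = D" using finite_nat_indexing[OF D] .
  have "l2 D f = l2 {..<card D} (\<lambda>d. f (h d))" for f
    using l2_reindex[OF h(1), of f] h(2) by simp
  then show ?thesis using u y unfolding hilbert_summing_def by simp
qed

lemma hilbert_summing_scaled:
  fixes D :: "'d set"
  assumes u: "hilbert_summing r K I J u" and D: "finite D" and y: "\<And>j. j \<in> J \<Longrightarrow> l2 D (y j) \<le> c"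
    and r: "r > 0" and c: "c \<ge> 0"
  shows "(\<Sum>i\<in>I. l2 D (\<lambda>d. \<Sum>j\<in>J. u i j * y j d) powr r) \<le> c powr r * K"
proof (cases "c = 0")
  case True
  have "y j d = 0" if "j \<in> J" "d \<in> D" for j d
  proof -
    have "l2 D (y j) = 0" using y[OF that(1)] True l2_nonneg[of D "y j"] by linarith
    then show ?thesis using that D by (simp add: l2_def sum_nonneg_eq_0_iff)
  qed
  then have "l2 D (\<lambda>d. \<Sum>j\<in>J. u i j * y j d) = 0" for i by (simp add: l2_def)
  then show ?thesis using True r by simp
next
  case False
  then have c: "c > 0" using c by simp
  have "(\<Sum>i\<in>I. l2 D (\<lambda>d. \<Sum>j\<in>J. u i j * (of_real (1/c) * y j d)) powr r) \<le> K"
    using y c by (intro hilbert_summingD[OF u D]) (simp only: l2_cmult, simp add: norm_divide)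
  moreover have "l2 D (\<lambda>d. \<Sum>j\<in>J. u i j * (of_real (1/c) * y j d)) = (1/c) * l2 D (\<lambda>d. \<Sum>j\<in>J. u i j * y j d)" for i
    using l2_cmult[of D "of_real (1/c)" "\<lambda>d. \<Sum>j\<in>J. u i j * y j d"] c
    by (simp add: sum_distrib_left mult_ac norm_divide)
  ultimately have "(1/c) powr r * (\<Sum>i\<in>I. l2 D (\<lambda>d. \<Sum>j\<in>J. u i j * y j d) powr r) \<le> K"
    using c by (simp add: powr_mult sum_distrib_left del: times_divide_eq_left)
  then show ?thesis using c by (simp add: powr_divide field_simps)
qed

lemma hilbert_summing_mono: "hilbert_summing r K I J u \<Longrightarrow> K \<le> K' \<Longrightarrow> hilbert_summing r K' I J u"
  unfolding hilbert_summing_def by (meson order_trans)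

lemma l2_Plus_sq:
  assumes "finite D" "finite E"
  shows "(l2 (D <+> E) f)\<^sup>2 = (l2 D (\<lambda>d. f (Inl d)))\<^sup>2 + (l2 E (\<lambda>d. f (Inr d)))\<^sup>2"
  using assms by (simp add: l2_sq sum.Plus)

lemma l2_Times_sq: "finite D \<Longrightarrow> finite A \<Longrightarrow> (l2 (A \<times> D) f)\<^sup>2 = (\<Sum>a\<in>A. (l2 D (\<lambda>d. f (a, d)))\<^sup>2)"
  by (simp add: l2_sq sum.cartesian_product)

text \<open>Rows with \<open>l i = 0\<close> contribute \<open>\<tau> powr (r/2)\<close> times the
  sum \<open>\<beta>\<close> of the powers \<open>b i powr r\<close>, while the other rows are
  differentiable at 0. Since \<open>r < 2\<close>, the former outweighs any linear loss for small
  \<open>\<tau>\<close>, so maximality forces \<open>\<beta> = 0\<close>. The derivative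
  \<open>G\<close> of the rest cannot be positive, which is the second claim.\<close>

lemma first_variation:
  fixes l b :: "'i \<Rightarrow> real"
  assumes I: "finite I" and r: "0 < r" "r < 2" and l: "\<And>i. i \<in> I \<Longrightarrow> 0 \<le> l i" and b: "\<And>i. i \<in> I \<Longrightarrow> 0 \<le> b i"
    and max: "\<And>\<tau>. 0 \<le> \<tau> \<Longrightarrow> \<tau> \<le> 1 \<Longrightarrow>
      (\<Sum>i\<in>I. ((1 - \<tau>) * (l i)\<^sup>2 + \<tau> * (b i)\<^sup>2) powr (r/2)) \<le> (\<Sum>i\<in>I. l i powr r)"
  shows "\<forall>i\<in>I. l i = 0 \<longrightarrow> b i = 0" and "(\<Sum>i\<in>I. l i powr (r - 2) * (b i)\<^sup>2) \<le> (\<Sum>i\<in>I. l i powr r)"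
proof -
  define Z where "Z = {i\<in>I. l i = 0}"
  define P where "P = {i\<in>I. l i > 0}"
  have fin: "finite Z" "finite P" using I by (auto simp: Z_def P_def)
  have IZP: "I = Z \<union> P" "Z \<inter> P = {}" using l by (force simp: Z_def P_def)+
  have split: "(\<Sum>i\<in>I. f i) = (\<Sum>i\<in>Z. f i) + (\<Sum>i\<in>P. f i)" for f :: "'i \<Rightarrow> real"
    using IZP fin by (simp add: sum.union_disjoint)
  define g where "g = (\<lambda>\<tau>. \<Sum>i\<in>P. ((l i)\<^sup>2 + \<tau> * ((b i)\<^sup>2 - (l i)\<^sup>2)) powr (r/2))"
  define G where "G = (\<Sum>i\<in>P. r/2 * (l i powr (r - 2) * (b i)\<^sup>2 - l i powr r))"
  define \<beta> where "\<beta> = (\<Sum>i\<in>Z. b i powr r)"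
  have \<beta>0: "\<beta> \<ge> 0" by (simp add: \<beta>_def sum_nonneg)
  have sqp: "(x\<^sup>2) powr (r/2) = x powr r" if "0 \<le> x" for x :: real
    using that powr_powr[of x 2 "r/2"] by (cases "x = 0") auto
  have g0: "g 0 = (\<Sum>i\<in>P. l i powr r)"
    unfolding g_def by (intro sum.cong) (auto simp: P_def sqp)
  have main: "\<tau> powr (r/2) * \<beta> + g \<tau> \<le> g 0" if "0 \<le> \<tau>" "\<tau> \<le> 1" for \<tau>
  proof -
    have "(\<Sum>i\<in>Z. ((1 - \<tau>) * (l i)\<^sup>2 + \<tau> * (b i)\<^sup>2) powr (r/2)) = \<tau> powr (r/2) * \<beta>"
      unfolding \<beta>_def sum_distrib_left
      using that b by (intro sum.cong) (auto simp: Z_def powr_mult sqp)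
    moreover have "(\<Sum>i\<in>P. ((1 - \<tau>) * (l i)\<^sup>2 + \<tau> * (b i)\<^sup>2) powr (r/2)) = g \<tau>"
      unfolding g_def by (simp add: algebra_simps)
    moreover have "(\<Sum>i\<in>Z. l i powr r) = 0" by (simp add: Z_def)
    ultimately show ?thesis using max[OF that] by (simp add: split g0)
  qed
  have DG: "(g has_real_derivative G) (at 0)"
  proof -
    have "((\<lambda>\<tau>. ((l i)\<^sup>2 + \<tau> * ((b i)\<^sup>2 - (l i)\<^sup>2)) powr (r/2)) has_real_derivative
         r/2 * (l i powr (r - 2) * (b i)\<^sup>2 - l i powr r)) (at 0)" if "i \<in> P" for i
    proof -
      have li: "l i > 0" using that by (simp add: P_def)
      have e: "(l i)\<^sup>2 powr (r/2 - 1) = l i powr (r - 2)"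
        using li powr_powr[of "l i" 2 "r/2 - 1"] by (simp add: algebra_simps)
      have e2: "l i powr (r - 2) * (l i)\<^sup>2 = l i powr r"
        using li powr_add[of "l i" "r - 2" 2] by simp
      have "((\<lambda>\<tau>. ((l i)\<^sup>2 + \<tau> * ((b i)\<^sup>2 - (l i)\<^sup>2)) powr (r/2)) has_real_derivative
         r/2 * ((l i)\<^sup>2 + 0 * ((b i)\<^sup>2 - (l i)\<^sup>2)) powr (r/2 - 1) * ((b i)\<^sup>2 - (l i)\<^sup>2)) (at 0)"
        using li by (auto intro!: derivative_eq_intros simp: zero_less_power)
      moreover have "r/2 * ((l i)\<^sup>2 + 0 * ((b i)\<^sup>2 - (l i)\<^sup>2)) powr (r/2 - 1) * ((b i)\<^sup>2 - (l i)\<^sup>2)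
         = r/2 * (l i powr (r - 2) * (b i)\<^sup>2 - l i powr r)"
        by (simp add: e e2[symmetric] right_diff_distrib)
      ultimately show ?thesis by (simp only:)
    qed
    then show ?thesis unfolding g_def G_def by (rule DERIV_sum)
  qed
  have G0: "G \<le> 0"
  proof (rule ccontr)
    assume "\<not> G \<le> 0"
    then obtain d where d: "d > 0" "\<And>h. 0 < h \<Longrightarrow> h < d \<Longrightarrow> g 0 < g (0 + h)"
      using DERIV_pos_inc_right[OF DG] by auto
    define h where "h = min (d/2) 1"
    have "0 < h" "h < d" "h \<le> 1" using d(1) by (auto simp: h_def)
    moreover from this have "g h \<le> g 0" using main[of h] mult_nonneg_nonneg[OF powr_ge_zero \<beta>0, of h "r/2"] by linarith
    ultimately show False using d(2)[of h] by simp
  qed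
  have "\<beta> = 0"
  proof (rule ccontr)
    assume "\<beta> \<noteq> 0"
    then have \<beta>: "\<beta> > 0" using \<beta>0 by simp
    \<comment> \<open>With this \<open>c\<close> the function \<open>g \<tau> + c \<tau>\<close> has
      derivative 1 at 0, so \<open>g\<close> loses less than \<open>c h\<close> over a short step
      \<open>h\<close>.\<close>
    define c where "c = 1 - G"
    have c: "c > 0" using G0 by (simp add: c_def)
    have "((\<lambda>\<tau>. g \<tau> + c * \<tau>) has_real_derivative (G + c)) (at 0)"
      using DERIV_add[OF DG DERIV_cmult[OF DERIV_ident]] by simp
    moreover have "G + c > 0" by (simp add: c_def)
    ultimately obtain d where d: "d > 0" "\<And>h. 0 < h \<Longrightarrow> h < d \<Longrightarrow> g 0 + c * 0 < g (0 + h) + c * (0 + h)"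
      using DERIV_pos_inc_right[of "\<lambda>\<tau>. g \<tau> + c * \<tau>" "G + c" 0] by auto
    define q where "q = 1 - r/2"
    have q: "q > 0" using r by (simp add: q_def)
    \<comment> \<open>The last bound ensures \<open>c h \<le> \<beta> h powr (r/2)\<close>, so that
      the gain from the vanishing rows covers the loss.\<close>
    define h where "h = min (min (d/2) 1) ((\<beta>/c) powr (1/q))"
    have h: "0 < h" "h < d" "h \<le> 1" using d(1) \<beta> c by (auto simp: h_def)
    have "h powr q \<le> ((\<beta>/c) powr (1/q)) powr q"
      using h(1) q by (intro powr_mono2) (auto simp: h_def)
    also have "\<dots> = \<beta>/c" using q \<beta> c by (simp add: powr_powr)
    finally have "c * h powr q \<le> \<beta>" using c by (simp add: field_simps)
    then have "h powr (r/2) * (c * h powr q) \<le> h powr (r/2) * \<beta>" by (intro mult_left_mono) auto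
    moreover have "h powr (r/2) * h powr q = h" using h by (simp add: powr_add[symmetric] q_def)
    ultimately have "c * h \<le> h powr (r/2) * \<beta>" by (simp add: mult.left_commute)
    moreover have "g 0 < g h + c * h" using d(2)[of h] h by simp
    ultimately show False using main[of h] h by simp
  qed
  then show "\<forall>i\<in>I. l i = 0 \<longrightarrow> b i = 0"
    unfolding \<beta>_def using fin b by (subst (asm) sum_nonneg_eq_0_iff) (auto simp: Z_def)
  have "r/2 * ((\<Sum>i\<in>P. l i powr (r - 2) * (b i)\<^sup>2) - (\<Sum>i\<in>P. l i powr r)) \<le> 0"
    using G0 unfolding G_def by (simp add: sum_distrib_left sum_subtractf right_diff_distrib)
  then have "(\<Sum>i\<in>P. l i powr (r - 2) * (b i)\<^sup>2) \<le> (\<Sum>i\<in>P. l i powr r)"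
    using r by (simp add: mult_le_0_iff)
  then show "(\<Sum>i\<in>I. l i powr (r - 2) * (b i)\<^sup>2) \<le> (\<Sum>i\<in>I. l i powr r)"
    by (simp add: split) (simp add: Z_def)
qed

text \<open>The weights are the row norms of a limit of near-maximisers \<open>y\<close>: replacing \<open>y\<close> by
  \<open>sqrt (1 - \<tau>) y \<oplus> sqrt \<tau> \<eta>\<close> cannot increase the maximum, and the first variation at
  \<open>\<tau> = 0\<close> is the assertion.\<close>

lemma maurey_factorisation:
  assumes fin: "finite I" "finite J" and r: "0 < r" "r < 2" and u: "hilbert_summing r K I J u"
  obtains l where "\<forall>i. 0 \<le> l i" "(\<Sum>i\<in>I. l i powr r) \<le> K"
    "\<forall>(D::nat set) y. finite D \<longrightarrow> (\<forall>j\<in>J. l2 D (y j) \<le> 1) \<longrightarrow>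
       (\<forall>i\<in>I. l i = 0 \<longrightarrow> l2 D (\<lambda>d. \<Sum>j\<in>J. u i j * y j d) = 0) \<and>
       (\<Sum>i\<in>I. l i powr (r - 2) * (l2 D (\<lambda>d. \<Sum>j\<in>J. u i j * y j d))\<^sup>2) \<le> K"
proof -
  define b where "b = (\<lambda>(D::nat set) y i. l2 D (\<lambda>d. \<Sum>j\<in>J. u i j * y j d))"
  define adm where "adm = (\<lambda>(D::nat set) y. finite D \<and> (\<forall>j\<in>J. l2 D (y j) \<le> 1))"
  define S where "S = {(\<Sum>i\<in>I. b D y i powr r) | D y. adm D y}"
  define B where "B = Sup S"
  have SK: "s \<le> K" if "s \<in> S" for s
    using that u unfolding S_def adm_def b_def hilbert_summing_def by blast
  have bdd: "bdd_above S" by (rule bdd_aboveI[OF SK])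
  have "adm {} (\<lambda>_ _. 0)" by (simp add: adm_def l2_def)
  then have ne: "S \<noteq> {}" by (auto simp: S_def)
  have BK: "B \<le> K" unfolding B_def by (rule cSup_least[OF ne SK])
  have B: "(\<Sum>i\<in>I. b D y i powr r) \<le> B" if "adm D y" for D y
    unfolding B_def using that by (intro cSup_upper bdd) (auto simp: S_def)
  have "\<exists>D y. adm D y \<and> B - 1 / real (Suc k) < (\<Sum>i\<in>I. b D y i powr r)" for k
  proof -
    have "B - 1 / real (Suc k) < Sup S" by (simp add: B_def)
    then obtain s where "s \<in> S" "B - 1 / real (Suc k) < s" using less_cSup_iff[OF ne bdd] by blast
    then show ?thesis by (auto simp: S_def)
  qed
  then obtain DD yy where DY: "\<And>k. adm (DD k) (yy k)"
    "\<And>k. B - 1 / real (Suc k) < (\<Sum>i\<in>I. b (DD k) (yy k) i powr r)" by metis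
  define \<Lambda> where "\<Lambda> = (\<lambda>k i. b (DD k) (yy k) i)"
  have \<Lambda>0: "0 \<le> \<Lambda> k i" for k i by (simp add: \<Lambda>_def b_def)
  have \<Lambda>b: "\<Lambda> k i \<le> K powr (1/r)" if "i \<in> I" for k i
  proof -
    have "\<Lambda> k i powr r \<le> (\<Sum>i\<in>I. \<Lambda> k i powr r)"
      using that fin by (intro member_le_sum) auto
    also have "\<dots> \<le> K" using B[OF DY(1), of k] BK by (simp add: \<Lambda>_def)
    finally have "(\<Lambda> k i powr r) powr (1/r) \<le> K powr (1/r)" using r by (intro powr_mono2) auto
    then show ?thesis using r \<Lambda>0 by (simp add: powr_powr)
  qed
  \<comment> \<open>The dimensions of the near-maximisers may grow, so convergence of the vectors
    themselves is not at hand. Their row norms stay in a fixed bounded box, and a subsequence of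
    these converges.\<close>
  have "\<forall>\<delta>\<subseteq>I. \<exists>l::'a \<Rightarrow> real. \<exists>\<rho>::nat\<Rightarrow>nat. strict_mono \<rho> \<and>
     (\<forall>\<epsilon>>0. eventually (\<lambda>n. \<forall>i\<in>\<delta>. dist (\<Lambda> (\<rho> n) i) (l i) < \<epsilon>) sequentially)"
  proof (rule compact_lemma_general[where unproj = "\<lambda>x. x"])
    show "bounded ((\<lambda>x. x k) ` range \<Lambda>)" if "k \<in> I" for k
      using \<Lambda>b[OF that] \<Lambda>0 by (auto intro!: boundedI[of _ "K powr (1/r)"])
  qed (use fin in auto)
  then obtain l' :: "'a \<Rightarrow> real" and \<rho> :: "nat \<Rightarrow> nat" where \<rho>: "strict_mono \<rho>"
    and l': "\<And>\<epsilon>. \<epsilon> > 0 \<Longrightarrow> eventually (\<lambda>n. \<forall>i\<in>I. dist (\<Lambda> (\<rho> n) i) (l' i) < \<epsilon>) sequentially"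
    by blast
  have lim: "(\<lambda>n. \<Lambda> (\<rho> n) i) \<longlonglongrightarrow> l' i" if "i \<in> I" for i
    unfolding tendsto_iff using that by (auto intro: eventually_mono[OF l'])
  define l where "l = (\<lambda>i. if i \<in> I then l' i else 0)"
  have l0: "0 \<le> l i" for i
    using LIMSEQ_le_const[OF lim, of i 0] \<Lambda>0 by (auto simp: l_def)
  have lim': "(\<lambda>n. \<Lambda> (\<rho> n) i) \<longlonglongrightarrow> l i" if "i \<in> I" for i
    using lim[OF that] that by (simp add: l_def)
  have var: "(\<Sum>i\<in>I. ((1 - \<tau>) * (l i)\<^sup>2 + \<tau> * (b D y i)\<^sup>2) powr (r/2)) \<le> B"
    if \<tau>: "0 \<le> \<tau>" "\<tau> \<le> 1" and adm: "adm D y" for \<tau> D y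
  proof (rule LIMSEQ_le_const2)
    show "(\<lambda>n. \<Sum>i\<in>I. ((1 - \<tau>) * (\<Lambda> (\<rho> n) i)\<^sup>2 + \<tau> * (b D y i)\<^sup>2) powr (r/2))
      \<longlonglongrightarrow> (\<Sum>i\<in>I. ((1 - \<tau>) * (l i)\<^sup>2 + \<tau> * (b D y i)\<^sup>2) powr (r/2))"
      using \<tau> r by (intro tendsto_sum tendsto_powr' tendsto_intros lim') (auto intro!: always_eventually)
    have "(\<Sum>i\<in>I. ((1 - \<tau>) * (\<Lambda> k i)\<^sup>2 + \<tau> * (b D y i)\<^sup>2) powr (r/2)) \<le> B" for k
    proof -
      define E where "E = DD k <+> D"
      define z where "z = (\<lambda>j. case_sum (\<lambda>d. of_real (sqrt (1 - \<tau>)) * yy k j d) (\<lambda>d. of_real (sqrt \<tau>) * y j d))"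
      have fE: "finite (DD k)" "finite D" using DY(1)[of k] adm by (auto simp: adm_def)
      have z1: "l2 E (z j) \<le> 1" if "j \<in> J" for j
      proof -
        have le: "(l2 (DD k) (yy k j))\<^sup>2 \<le> 1" "(l2 D (y j))\<^sup>2 \<le> 1"
          using DY(1)[of k] adm that by (auto simp: adm_def intro!: power_le_one)
        have "(l2 E (z j))\<^sup>2 = (1 - \<tau>) * (l2 (DD k) (yy k j))\<^sup>2 + \<tau> * (l2 D (y j))\<^sup>2"
          using \<tau> unfolding E_def l2_Plus_sq[OF fE] by (simp add: z_def l2_cmult power_mult_distrib)
        also have "\<dots> \<le> (1 - \<tau>) * 1 + \<tau> * 1" using \<tau> le by (intro add_mono mult_left_mono) auto
        finally show ?thesis using power2_le_imp_le[of "l2 E (z j)" 1] by simp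
      qed
      have eq: "l2 E (\<lambda>d. \<Sum>j\<in>J. u i j * z j d) powr r = ((1 - \<tau>) * (\<Lambda> k i)\<^sup>2 + \<tau> * (b D y i)\<^sup>2) powr (r/2)" for i
      proof -
        have "(\<Sum>j\<in>J. u i j * z j (Inl d)) = of_real (sqrt (1 - \<tau>)) * (\<Sum>j\<in>J. u i j * yy k j d)" for d
          by (simp add: z_def sum_distrib_left mult_ac)
        moreover have "(\<Sum>j\<in>J. u i j * z j (Inr d)) = of_real (sqrt \<tau>) * (\<Sum>j\<in>J. u i j * y j d)" for d
          by (simp add: z_def sum_distrib_left mult_ac)
        ultimately have "(l2 E (\<lambda>d. \<Sum>j\<in>J. u i j * z j d))\<^sup>2 = (1 - \<tau>) * (\<Lambda> k i)\<^sup>2 + \<tau> * (b D y i)\<^sup>2"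
          using \<tau> unfolding E_def l2_Plus_sq[OF fE] by (simp add: l2_cmult power_mult_distrib \<Lambda>_def b_def)
        then have "((1 - \<tau>) * (\<Lambda> k i)\<^sup>2 + \<tau> * (b D y i)\<^sup>2) powr (r/2) = ((l2 E (\<lambda>d. \<Sum>j\<in>J. u i j * z j d))\<^sup>2) powr (r/2)"
          by simp
        then show ?thesis
          using powr_powr[of "l2 E (\<lambda>d. \<Sum>j\<in>J. u i j * z j d)" 2 "r/2"] r
          by (cases "l2 E (\<lambda>d. \<Sum>j\<in>J. u i j * z j d) = 0") auto
      qed
      have fE': "finite E" using fE by (simp add: E_def)
      obtain h where h: "inj_on h {..<card E}" "h ` {..<card E} = E" using finite_nat_indexing[OF fE'] .
      have re: "l2 E f = l2 {..<card E} (\<lambda>d. f (h d))" for f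
        using l2_reindex[OF h(1), of f] h(2) by simp
      have "(\<Sum>i\<in>I. b {..<card E} (\<lambda>j d. z j (h d)) i powr r) \<le> B"
        using z1 by (intro B) (simp add: adm_def re)
      then show ?thesis unfolding eq[symmetric] by (simp add: b_def re)
    qed
    then show "\<exists>N. \<forall>n\<ge>N. (\<Sum>i\<in>I. ((1 - \<tau>) * (\<Lambda> (\<rho> n) i)\<^sup>2 + \<tau> * (b D y i)\<^sup>2) powr (r/2)) \<le> B" by blast
  qed
  have lB: "(\<Sum>i\<in>I. l i powr r) = B"
  proof (rule antisym)
    have sqp: "(x\<^sup>2) powr (r/2) = x powr r" if "0 \<le> x" for x :: real
      using that powr_powr[of x 2 "r/2"] by (cases "x = 0") auto
    show "(\<Sum>i\<in>I. l i powr r) \<le> B"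
      using var[of 0 "{}" "\<lambda>_ _. 0"] l0 \<open>adm {} (\<lambda>_ _. 0)\<close> by (simp add: sqp)
    have "(\<lambda>n. \<Sum>i\<in>I. \<Lambda> (\<rho> n) i powr r) \<longlonglongrightarrow> (\<Sum>i\<in>I. l i powr r)"
      using r \<Lambda>0 by (intro tendsto_sum tendsto_powr' tendsto_intros lim') (auto intro!: always_eventually)
    moreover have "(\<lambda>n. B - 1 / real (Suc (\<rho> n))) \<longlonglongrightarrow> B - 0"
      by (intro tendsto_diff tendsto_const LIMSEQ_subseq_LIMSEQ[OF LIMSEQ_inverse_real_of_nat \<rho>, unfolded o_def inverse_eq_divide])
    ultimately show "B \<le> (\<Sum>i\<in>I. l i powr r)"
      using DY(2) by (intro LIMSEQ_le[of "\<lambda>n. B - 1 / real (Suc (\<rho> n))" _ "\<lambda>n. \<Sum>i\<in>I. \<Lambda> (\<rho> n) i powr r"])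
        (auto simp: \<Lambda>_def intro!: less_imp_le exI[of _ 0])
  qed
  show ?thesis
  proof (rule that[of l])
    show "(\<Sum>i\<in>I. l i powr r) \<le> K" using lB BK by simp
    show "\<forall>i. 0 \<le> l i" using l0 by simp
  next
    show "\<forall>(D::nat set) y. finite D \<longrightarrow> (\<forall>j\<in>J. l2 D (y j) \<le> 1) \<longrightarrow>
       (\<forall>i\<in>I. l i = 0 \<longrightarrow> l2 D (\<lambda>d. \<Sum>j\<in>J. u i j * y j d) = 0) \<and>
       (\<Sum>i\<in>I. l i powr (r - 2) * (l2 D (\<lambda>d. \<Sum>j\<in>J. u i j * y j d))\<^sup>2) \<le> K"
    proof (intro allI impI)
      fix D :: "nat set" and y :: "'b \<Rightarrow> nat \<Rightarrow> complex"
      assume "finite D" "\<forall>j\<in>J. l2 D (y j) \<le> 1"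
      then have adm: "adm D y" by (simp add: adm_def)
      have fv: "\<And>\<tau>. 0 \<le> \<tau> \<Longrightarrow> \<tau> \<le> 1 \<Longrightarrow>
        (\<Sum>i\<in>I. ((1 - \<tau>) * (l i)\<^sup>2 + \<tau> * (b D y i)\<^sup>2) powr (r/2)) \<le> (\<Sum>i\<in>I. l i powr r)"
        using var adm by (simp add: lB)
      have b0: "0 \<le> b D y i" for i by (simp add: b_def)
      show "(\<forall>i\<in>I. l i = 0 \<longrightarrow> l2 D (\<lambda>d. \<Sum>j\<in>J. u i j * y j d) = 0) \<and>
         (\<Sum>i\<in>I. l i powr (r - 2) * (l2 D (\<lambda>d. \<Sum>j\<in>J. u i j * y j d))\<^sup>2) \<le> K"
        using first_variation[OF fin(1) r l0 b0 fv] lB BK by (simp add: b_def)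
    qed
  qed
qed

text \<open>Hoelder's inequality with exponents \<open>1/\<alpha>\<close> and
  \<open>1/(1 - \<alpha>)\<close>, obtained from the weighted mean inequality for the terms divided
  by their sums.\<close>

lemma hoelder_powr_sum:
  fixes a b :: "'i \<Rightarrow> real"
  assumes I: "finite I" and a: "\<And>i. i \<in> I \<Longrightarrow> 0 \<le> a i" and b: "\<And>i. i \<in> I \<Longrightarrow> 0 \<le> b i"
    and \<alpha>: "0 < \<alpha>" "\<alpha> < 1"
  shows "(\<Sum>i\<in>I. a i powr \<alpha> * b i powr (1 - \<alpha>)) \<le> (\<Sum>i\<in>I. a i) powr \<alpha> * (\<Sum>i\<in>I. b i) powr (1 - \<alpha>)"
proof -
  define A where "A = (\<Sum>i\<in>I. a i)"
  define B where "B = (\<Sum>i\<in>I. b i)"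
  show ?thesis
  proof (cases "A = 0 \<or> B = 0")
    case True
    then have "\<forall>i\<in>I. a i = 0 \<or> b i = 0"
      using I a b by (auto simp: A_def B_def sum_nonneg_eq_0_iff)
    then have "(\<Sum>i\<in>I. a i powr \<alpha> * b i powr (1 - \<alpha>)) = 0" by (intro sum.neutral) auto
    then show ?thesis by simp
  next
    case False
    then have AB: "A > 0" "B > 0"
      using a b sum_nonneg[of I a] sum_nonneg[of I b] by (auto simp: A_def B_def less_le)
    have "a i powr \<alpha> * b i powr (1 - \<alpha>) \<le> A powr \<alpha> * B powr (1 - \<alpha>) * (\<alpha> * (a i / A) + (1 - \<alpha>) * (b i / B))"
      if i: "i \<in> I" for i
    proof (cases "a i = 0 \<or> b i = 0")
      case True
      then show ?thesis using AB \<alpha> a[OF i] b[OF i] by auto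
    next
      case False
      then have "(a i / A) powr \<alpha> * (b i / B) powr (1 - \<alpha>) \<le> \<alpha> * (a i / A) + (1 - \<alpha>) * (b i / B)"
        using AB \<alpha> a[OF i] b[OF i] by (intro Youngs_inequality_0) auto
      then have "A powr \<alpha> * B powr (1 - \<alpha>) * ((a i / A) powr \<alpha> * (b i / B) powr (1 - \<alpha>))
        \<le> A powr \<alpha> * B powr (1 - \<alpha>) * (\<alpha> * (a i / A) + (1 - \<alpha>) * (b i / B))"
        by (intro mult_left_mono) auto
      then show ?thesis using AB a[OF i] b[OF i] by (simp add: powr_divide)
    qed
    then have "(\<Sum>i\<in>I. a i powr \<alpha> * b i powr (1 - \<alpha>))
      \<le> (\<Sum>i\<in>I. A powr \<alpha> * B powr (1 - \<alpha>) * (\<alpha> * (a i / A) + (1 - \<alpha>) * (b i / B)))"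
      by (rule sum_mono)
    also have "\<dots> = A powr \<alpha> * B powr (1 - \<alpha>) * (\<alpha> * ((\<Sum>i\<in>I. a i) / A) + (1 - \<alpha>) * ((\<Sum>i\<in>I. b i) / B))"
      unfolding sum_divide_distrib sum_distrib_left sum.distrib[symmetric] ..
    also have "\<dots> = A powr \<alpha> * B powr (1 - \<alpha>)" using AB by (simp add: A_def[symmetric] B_def[symmetric])
    finally show ?thesis by (simp add: A_def B_def)
  qed
qed

text \<open>Applying \<open>v\<close> in the second index and dividing row \<open>i2\<close> by
  \<open>\<sigma> i2\<close> produces vectors \<open>t' j1\<close> over the coordinates
  \<open>I2 \<times> D\<close>, of norm at most \<open>sqrt Kv\<close>. The matrix \<open>u\<close>
  can be applied to these as Hilbert space vectors, and the hypothesis on \<open>S\<close> puts the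
  factors \<open>\<sigma>\<close> back.\<close>

lemma hilbert_summing_tensor_weights:
  fixes u :: "'i1 \<Rightarrow> 'j1 \<Rightarrow> complex" and v :: "'i2 \<Rightarrow> 'j2 \<Rightarrow> complex"
  assumes fin: "finite I1" "finite I2" "finite J1" "finite J2" and u: "hilbert_summing r Ku I1 J1 u" and r: "r > 0"
    and \<sigma>: "\<And>i. 0 \<le> \<sigma> i" and K0: "0 \<le> Kv" "0 \<le> S"
    and v: "\<And>(D::nat set) y. finite D \<Longrightarrow> (\<And>j. j \<in> J2 \<Longrightarrow> l2 D (y j) \<le> 1) \<Longrightarrow>
       (\<forall>i\<in>I2. \<sigma> i = 0 \<longrightarrow> l2 D (\<lambda>d. \<Sum>j\<in>J2. v i j * y j d) = 0) \<and>
       (\<Sum>i\<in>I2. (l2 D (\<lambda>d. \<Sum>j\<in>J2. v i j * y j d) / \<sigma> i)\<^sup>2) \<le> Kv"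
    and S: "\<And>f. (\<And>i. 0 \<le> f i) \<Longrightarrow> (\<Sum>i\<in>I2. (\<sigma> i * f i) powr r) \<le> S * (\<Sum>i\<in>I2. (f i)\<^sup>2) powr (r/2)"
  shows "hilbert_summing r (S * (Kv powr (r/2) * Ku)) (I1 \<times> I2) (J1 \<times> J2)
    (\<lambda>i j. u (fst i) (fst j) * v (snd i) (snd j))"
  unfolding hilbert_summing_def
proof (intro allI impI)
  fix D :: "nat set" and t :: "'j1 \<times> 'j2 \<Rightarrow> nat \<Rightarrow> complex"
  assume D: "finite D" and t: "\<forall>j\<in>J1 \<times> J2. l2 D (t j) \<le> 1"
  define G where "G = (\<lambda>i2 j1 d. \<Sum>j2\<in>J2. v i2 j2 * t (j1, j2) d)"
  \<comment> \<open>In a row with \<open>\<sigma> i2 = 0\<close> the quotient is 0 by convention.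
    Nothing is lost, since \<open>G\<close> vanishes there.\<close>
  define t' where "t' = (\<lambda>j1 (i2, d). G i2 j1 d / of_real (\<sigma> i2))"
  define f where "f = (\<lambda>i1 i2. l2 D (\<lambda>d. \<Sum>j1\<in>J1. u i1 j1 * t' j1 (i2, d)))"
  have vG: "(\<forall>i\<in>I2. \<sigma> i = 0 \<longrightarrow> l2 D (G i j1) = 0) \<and> (\<Sum>i\<in>I2. (l2 D (G i j1) / \<sigma> i)\<^sup>2) \<le> Kv" if "j1 \<in> J1" for j1
    unfolding G_def using t that by (intro v D) auto
  have t'1: "l2 (I2 \<times> D) (t' j1) \<le> sqrt Kv" if "j1 \<in> J1" for j1
  proof -
    have "(l2 (I2 \<times> D) (t' j1))\<^sup>2 = (\<Sum>i\<in>I2. (l2 D (G i j1) / \<sigma> i)\<^sup>2)"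
    proof (subst l2_Times_sq[OF D fin(2)], rule sum.cong[OF refl])
      fix i assume "i \<in> I2"
      have "l2 D (\<lambda>d. t' j1 (i, d)) = l2 D (\<lambda>d. of_real (1 / \<sigma> i) * G i j1 d)" by (simp add: t'_def)
      also have "\<dots> = l2 D (G i j1) / \<sigma> i" using \<sigma>[of i] unfolding l2_cmult by (simp add: norm_divide)
      finally show "(l2 D (\<lambda>d. t' j1 (i, d)))\<^sup>2 = (l2 D (G i j1) / \<sigma> i)\<^sup>2" by simp
    qed
    with vG[OF that] show ?thesis by (simp add: real_le_rsqrt)
  qed
  have Y: "l2 D (\<lambda>d. \<Sum>j\<in>J1 \<times> J2. u i1 (fst j) * v i2 (snd j) * t j d) = \<sigma> i2 * f i1 i2" if i2: "i2 \<in> I2" for i1 i2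
  proof -
    have "(\<Sum>j\<in>J1 \<times> J2. u i1 (fst j) * v i2 (snd j) * t j d) = of_real (\<sigma> i2) * (\<Sum>j1\<in>J1. u i1 j1 * t' j1 (i2, d))"
      if "d \<in> D" for d
    proof -
      have G': "G i2 j1 d = of_real (\<sigma> i2) * t' j1 (i2, d)" if "j1 \<in> J1" for j1
      proof (cases "\<sigma> i2 = 0")
        case True
        then have "l2 D (G i2 j1) = 0" using vG[OF that] i2 by simp
        then have "G i2 j1 d = 0" using \<open>d \<in> D\<close> D by (simp add: l2_def sum_nonneg_eq_0_iff)
        then show ?thesis using True by simp
      qed (simp add: t'_def)
      have "(\<Sum>j\<in>J1 \<times> J2. u i1 (fst j) * v i2 (snd j) * t j d) = (\<Sum>j1\<in>J1. u i1 j1 * G i2 j1 d)"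
        unfolding G_def sum_distrib_left by (simp add: sum.cartesian_product case_prod_unfold mult_ac)
      also have "\<dots> = (\<Sum>j1\<in>J1. of_real (\<sigma> i2) * (u i1 j1 * t' j1 (i2, d)))"
        by (intro sum.cong refl) (simp add: G')
      finally show ?thesis by (simp add: sum_distrib_left)
    qed
    then have "l2 D (\<lambda>d. \<Sum>j\<in>J1 \<times> J2. u i1 (fst j) * v i2 (snd j) * t j d)
       = l2 D (\<lambda>d. of_real (\<sigma> i2) * (\<Sum>j1\<in>J1. u i1 j1 * t' j1 (i2, d)))"
      by (simp add: l2_def)
    then show ?thesis using \<sigma>[of i2] by (simp only: l2_cmult f_def) simp
  qed
  have "(\<Sum>i\<in>I1 \<times> I2. l2 D (\<lambda>d. \<Sum>j\<in>J1 \<times> J2. u (fst i) (fst j) * v (snd i) (snd j) * t j d) powr r)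
    = (\<Sum>i1\<in>I1. \<Sum>i2\<in>I2. (\<sigma> i2 * f i1 i2) powr r)"
    unfolding sum.cartesian_product case_prod_unfold by (intro sum.cong refl) (simp add: Y mem_Times_iff)
  also have "\<dots> \<le> (\<Sum>i1\<in>I1. S * (l2 (I2 \<times> D) (\<lambda>d. \<Sum>j1\<in>J1. u i1 j1 * t' j1 d)) powr r)"
  proof (rule sum_mono)
    fix i1
    have "(\<Sum>i2\<in>I2. (f i1 i2)\<^sup>2) = (l2 (I2 \<times> D) (\<lambda>d. \<Sum>j1\<in>J1. u i1 j1 * t' j1 d))\<^sup>2"
      by (simp add: l2_Times_sq[OF D fin(2)] f_def)
    then have "(\<Sum>i2\<in>I2. (f i1 i2)\<^sup>2) powr (r/2) = (l2 (I2 \<times> D) (\<lambda>d. \<Sum>j1\<in>J1. u i1 j1 * t' j1 d)) powr r"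
      using powr_powr[of "l2 (I2 \<times> D) (\<lambda>d. \<Sum>j1\<in>J1. u i1 j1 * t' j1 d)" 2 "r/2"] r
      by (cases "l2 (I2 \<times> D) (\<lambda>d. \<Sum>j1\<in>J1. u i1 j1 * t' j1 d) = 0") auto
    moreover have "0 \<le> f i1 i" for i by (simp add: f_def)
    ultimately show "(\<Sum>i2\<in>I2. (\<sigma> i2 * f i1 i2) powr r) \<le> S * (l2 (I2 \<times> D) (\<lambda>d. \<Sum>j1\<in>J1. u i1 j1 * t' j1 d)) powr r"
      using S[of "f i1"] by simp
  qed
  also have "\<dots> \<le> S * (sqrt Kv powr r * Ku)"
    unfolding sum_distrib_left[symmetric] using fin D K0 t'1 r
    by (intro mult_left_mono hilbert_summing_scaled[OF u]) auto
  also have "sqrt Kv powr r = Kv powr (r/2)"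
    using K0 by (simp add: powr_half_sqrt[symmetric] powr_powr)
  finally show "(\<Sum>i\<in>I1 \<times> I2. l2 D (\<lambda>d. \<Sum>j\<in>J1 \<times> J2. u (fst i) (fst j) * v (snd i) (snd j) * t j d) powr r)
    \<le> S * (Kv powr (r/2) * Ku)" .
qed

text \<open>For \<open>r < 2\<close> the weight is \<open>\<sigma> = l powr ((2 - r)/2)\<close>, so
  that dividing by its square gives the factor \<open>l powr (r - 2)\<close> of the factorisation,
  and Hoelder's inequality restores it at the price \<open>Kv powr (1 - r/2)\<close>. The two powers
  of \<open>Kv\<close> combine to \<open>Kv\<close>, so the constants multiply exactly. For
  \<open>r = 2\<close> constant weights do.\<close>

lemma hilbert_summing_tensor:
  fixes u :: "'i1 \<Rightarrow> 'j1 \<Rightarrow> complex" and v :: "'i2 \<Rightarrow> 'j2 \<Rightarrow> complex"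
  assumes fin: "finite I1" "finite I2" "finite J1" "finite J2" and u: "hilbert_summing r Ku I1 J1 u"
    and v: "hilbert_summing r Kv I2 J2 v" and r: "0 < r" "r \<le> 2" and K0: "0 \<le> Ku" "0 \<le> Kv"
  shows "hilbert_summing r (Ku * Kv) (I1 \<times> I2) (J1 \<times> J2)
    (\<lambda>i j. u (fst i) (fst j) * v (snd i) (snd j))"
proof (cases "r = 2")
  case True
  have "hilbert_summing r (1 * (Kv powr (r/2) * Ku)) (I1 \<times> I2) (J1 \<times> J2)
    (\<lambda>i j. u (fst i) (fst j) * v (snd i) (snd j))"
  proof (rule hilbert_summing_tensor_weights[OF fin u r(1), where \<sigma> = "\<lambda>_. 1"])
    fix D :: "nat set" and y :: "'j2 \<Rightarrow> nat \<Rightarrow> complex"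
    assume "finite D" "\<And>j. j \<in> J2 \<Longrightarrow> l2 D (y j) \<le> 1"
    from hilbert_summingD[OF v this]
    show "(\<forall>i\<in>I2. (1::real) = 0 \<longrightarrow> l2 D (\<lambda>d. \<Sum>j\<in>J2. v i j * y j d) = 0) \<and>
       (\<Sum>i\<in>I2. (l2 D (\<lambda>d. \<Sum>j\<in>J2. v i j * y j d) / 1)\<^sup>2) \<le> Kv"
      by (simp add: True)
  qed (use K0 True in \<open>simp_all add: sum_nonneg\<close>)
  then show ?thesis using True K0 by (simp add: mult.commute)
next
  case False
  then have r2: "r < 2" using r by simp
  from maurey_factorisation[OF fin(2,4) r(1) r2 v] obtain l where l0: "\<forall>i. 0 \<le> l i" and l: "(\<Sum>i\<in>I2. l i powr r) \<le> Kv"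
    "\<forall>(D::nat set) y. finite D \<longrightarrow> (\<forall>j\<in>J2. l2 D (y j) \<le> 1) \<longrightarrow>
       (\<forall>i\<in>I2. l i = 0 \<longrightarrow> l2 D (\<lambda>d. \<Sum>j\<in>J2. v i j * y j d) = 0) \<and>
       (\<Sum>i\<in>I2. l i powr (r - 2) * (l2 D (\<lambda>d. \<Sum>j\<in>J2. v i j * y j d))\<^sup>2) \<le> Kv"
    .
  define \<sigma> where "\<sigma> = (\<lambda>i. l i powr ((2 - r)/2))"
  have \<sigma>2: "(b / \<sigma> i)\<^sup>2 = l i powr (r - 2) * b\<^sup>2" for i b
  proof (cases "l i = 0")
    case False
    then have "(\<sigma> i)\<^sup>2 = l i powr (2 - r)" using l0[rule_format, of i]
      by (simp add: \<sigma>_def powr_powr[symmetric] power2_eq_square powr_add[symmetric])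
    moreover have "l i powr (2 - r) * l i powr (r - 2) = 1"
      using False l0[rule_format, of i] by (simp add: powr_add[symmetric])
    ultimately show ?thesis using False l0[rule_format, of i] by (simp add: power_divide field_simps)
  qed (simp add: \<sigma>_def)
  have S: "(\<Sum>i\<in>I2. (\<sigma> i * f i) powr r) \<le> Kv powr (1 - r/2) * (\<Sum>i\<in>I2. (f i)\<^sup>2) powr (r/2)" if f: "\<And>i. 0 \<le> f i" for f
  proof -
    have e: "(\<sigma> i * f i) powr r = (l i powr r) powr (1 - r/2) * ((f i)\<^sup>2) powr (1 - (1 - r/2))" for i
    proof -
      have "((f i)\<^sup>2) powr (1 - (1 - r/2)) = f i powr r"
        using f[of i] powr_powr[of "f i" 2 "r/2"] r by (cases "f i = 0") auto
      moreover have "(l i powr r) powr (1 - r/2) = (\<sigma> i) powr r"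
        by (simp add: \<sigma>_def powr_powr field_simps)
      ultimately show ?thesis using f[of i] by (simp add: powr_mult \<sigma>_def)
    qed
    have "(\<Sum>i\<in>I2. (\<sigma> i * f i) powr r) \<le> (\<Sum>i\<in>I2. l i powr r) powr (1 - r/2) * (\<Sum>i\<in>I2. (f i)\<^sup>2) powr (1 - (1 - r/2))"
      unfolding e using r r2 fin by (intro hoelder_powr_sum) auto
    also have "\<dots> \<le> Kv powr (1 - r/2) * (\<Sum>i\<in>I2. (f i)\<^sup>2) powr (1 - (1 - r/2))"
      using l(1) r2 by (intro mult_right_mono powr_mono2) (auto intro: sum_nonneg)
    finally show ?thesis by simp
  qed
  have "hilbert_summing r (Kv powr (1 - r/2) * (Kv powr (r/2) * Ku)) (I1 \<times> I2) (J1 \<times> J2)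
    (\<lambda>i j. u (fst i) (fst j) * v (snd i) (snd j))"
  proof (rule hilbert_summing_tensor_weights[OF fin u r(1), where \<sigma> = \<sigma>])
    fix D :: "nat set" and y :: "'j2 \<Rightarrow> nat \<Rightarrow> complex"
    assume "finite D" "\<And>j. j \<in> J2 \<Longrightarrow> l2 D (y j) \<le> 1"
    then show "(\<forall>i\<in>I2. \<sigma> i = 0 \<longrightarrow> l2 D (\<lambda>d. \<Sum>j\<in>J2. v i j * y j d) = 0) \<and>
       (\<Sum>i\<in>I2. (l2 D (\<lambda>d. \<Sum>j\<in>J2. v i j * y j d) / \<sigma> i)\<^sup>2) \<le> Kv"
      using l(2)[rule_format, of D y] unfolding \<sigma>2 by (auto simp: \<sigma>_def)
  qed (use S K0 in \<open>auto simp: \<sigma>_def\<close>)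
  moreover have "Kv powr (1 - r/2) * (Kv powr (r/2) * Ku) = Ku * Kv"
    using K0 r by (cases "Kv = 0") (auto simp: powr_add[symmetric] mult.assoc[symmetric])
  ultimately show ?thesis by simp
qed

text \<open>One tensor factor is split off at a time, and the constants multiply. The empty product
  is the matrix with the single entry 1.\<close>

lemma hilbert_summing_words:
  fixes u :: "nat \<Rightarrow> 'i \<Rightarrow> 'j \<Rightarrow> complex"
  assumes fin: "finite I" "finite J" and u: "\<And>k. k < m \<Longrightarrow> hilbert_summing r K I J (u k)"
    and r: "0 < r" "r \<le> 2" and K0: "0 \<le> K"
  shows "hilbert_summing r (K ^ m) (words I m) (words J m) (\<lambda>is js. \<Prod>k<m. u k (is ! k) (js ! k))"
  using u
proof (induction m arbitrary: u)
  case 0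
  show ?case
    using r by (auto simp: hilbert_summing_def powr_le1)
next
  case (Suc m)
  define c where "c = (\<lambda>is js. \<Prod>k<m. u (Suc k) (is ! k) (js ! k))"
  have "hilbert_summing r (K ^ m) (words I m) (words J m) c"
    unfolding c_def by (rule Suc.IH) (use Suc.prems in auto)
  then have h: "hilbert_summing r (K * K ^ m) (I \<times> words I m) (J \<times> words J m)
    (\<lambda>i j. u 0 (fst i) (fst j) * c (snd i) (snd j))"
    using Suc.prems fin r K0 by (intro hilbert_summing_tensor) (auto intro: finite_words)
  have e: "(\<Prod>k<Suc m. u k ((i # is) ! k) ((j # js) ! k)) = u 0 i j * c is js" for i "is" j js
    unfolding c_def by (simp only: prod.lessThan_Suc_shift nth_Cons_0 nth_Cons_Suc)
  show ?case
    unfolding hilbert_summing_def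
  proof (intro allI impI)
    fix D :: "nat set" and y :: "'j list \<Rightarrow> nat \<Rightarrow> complex"
    assume D: "finite D" and y: "\<forall>j\<in>words J (Suc m). l2 D (y j) \<le> 1"
    have "(\<Sum>i\<in>I \<times> words I m. l2 D (\<lambda>d. \<Sum>j\<in>J \<times> words J m. u 0 (fst i) (fst j) * c (snd i) (snd j) * y (fst j # snd j) d) powr r) \<le> K * K ^ m"
      using y by (intro hilbert_summingD[OF h D]) (auto simp: words_def)
    then show "(\<Sum>i\<in>words I (Suc m). l2 D (\<lambda>d. \<Sum>j\<in>words J (Suc m). (\<Prod>k<Suc m. u k (i ! k) (j ! k)) * y j d) powr r) \<le> K ^ Suc m"
      unfolding sum_words_Suc e by (simp add: sum.cartesian_product case_prod_unfold)
  qed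
qed

text \<open>Pairing each row with its own normalised conjugate \<open>w i\<close> turns the sum of
  row norms into the expression bounded by Grothendieck's inequality.\<close>

lemma hilbert_summing_1:
  fixes v :: "'i \<Rightarrow> 'j \<Rightarrow> complex"
  assumes fin: "finite I" "finite J" and v: "real_bounded I J v"
  shows "hilbert_summing 1 512 I J v"
  unfolding hilbert_summing_def
proof (intro allI impI)
  fix D :: "nat set" and y :: "'j \<Rightarrow> nat \<Rightarrow> complex"
  assume D: "finite D" and y: "\<forall>j\<in>J. l2 D (y j) \<le> 1"
  define U where "U = (\<lambda>i d. \<Sum>j\<in>J. v i j * y j d)"
  \<comment> \<open>For a vanishing row the convention \<open>1/0 = 0\<close> makes
    \<open>w i\<close> zero, which is still in the unit ball.\<close>
  define w where "w = (\<lambda>i d. of_real (1 / l2 D (U i)) * cnj (U i d))"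
  have nc: "l2 D (\<lambda>d. cnj (U i d)) = l2 D (U i)" for i by (simp add: l2_def)
  have w1: "l2 D (w i) \<le> 1" for i
    unfolding w_def l2_cmult nc by (simp add: norm_divide)
  have wU: "(\<Sum>d\<in>D. w i d * U i d) = of_real (l2 D (U i))" for i
  proof -
    have "(\<Sum>d\<in>D. w i d * U i d) = of_real (1 / l2 D (U i)) * of_real ((l2 D (U i))\<^sup>2)"
      unfolding w_def l2_sq of_real_sum
      by (simp add: sum_distrib_left mult_ac complex_norm_square[symmetric] flip: of_real_power)
    also have "\<dots> = of_real (l2 D (U i))"
      by (simp add: power2_eq_square)
    finally show ?thesis .
  qed
  have "complex_of_real (\<Sum>i\<in>I. l2 D (U i)) = (\<Sum>i\<in>I. \<Sum>d\<in>D. w i d * U i d)"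
    by (simp add: wU)
  also have "\<dots> = (\<Sum>i\<in>I. \<Sum>j\<in>J. v i j * (\<Sum>d\<in>D. w i d * y j d))"
    unfolding U_def by (simp add: sum_distrib_left sum.swap[of _ D] mult_ac)
  finally have "norm (complex_of_real (\<Sum>i\<in>I. l2 D (U i))) \<le> 512"
    using grothendieck[OF fin D v, of w y] w1 y by simp
  then have "(\<Sum>i\<in>I. l2 D (U i)) \<le> 512" by (simp add: norm_of_real sum_nonneg del: of_real_sum)
  then show "(\<Sum>i\<in>I. l2 D (\<lambda>d. \<Sum>j\<in>J. v i j * y j d) powr 1) \<le> 512" by (simp add: U_def)
qed

subsection \<open>Bounded tensors\<close>

text \<open>The coefficients of an \<open>n\<close>-linear map from sup-normed sequences to an l1
  space, normalised so that arguments from the real unit balls have images of norm at most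
  1.\<close>

definition tensor_bounded :: "nat \<Rightarrow> 'i set \<Rightarrow> 'j set \<Rightarrow> ('i list \<Rightarrow> 'j \<Rightarrow> complex) \<Rightarrow> bool" where
  "tensor_bounded n I J a \<longleftrightarrow> (\<forall>\<epsilon>. (\<forall>k<n. \<forall>x\<in>I. \<bar>\<epsilon> k x\<bar> \<le> 1) \<longrightarrow>
     (\<Sum>j\<in>J. norm (\<Sum>xs\<in>words I n. of_real (\<Prod>k<n. \<epsilon> k (xs ! k)) * a xs j)) \<le> 1)"

text \<open>Fixing the first argument leaves a bounded map of one order less; the inductions on the
  order of a tensor rest on this.\<close>

lemma tensor_bounded_contract:
  assumes a: "tensor_bounded (Suc n) I J a" and \<delta>: "\<And>x. x \<in> I \<Longrightarrow> \<bar>\<delta> x\<bar> \<le> 1"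
  shows "tensor_bounded n I J (\<lambda>xs j. \<Sum>x\<in>I. of_real (\<delta> x) * a (x # xs) j)"
  unfolding tensor_bounded_def
proof (intro allI impI)
  fix \<epsilon> :: "nat \<Rightarrow> 'a \<Rightarrow> real"
  assume \<epsilon>: "\<forall>k<n. \<forall>x\<in>I. \<bar>\<epsilon> k x\<bar> \<le> 1"
  define \<epsilon>' where "\<epsilon>' = (\<lambda>k. case k of 0 \<Rightarrow> \<delta> | Suc k \<Rightarrow> \<epsilon> k)"
  have "\<forall>k<Suc n. \<forall>x\<in>I. \<bar>\<epsilon>' k x\<bar> \<le> 1" using \<epsilon> \<delta> by (auto simp: \<epsilon>'_def split: nat.splits)
  then have "(\<Sum>j\<in>J. norm (\<Sum>xs\<in>words I (Suc n). of_real (\<Prod>k<Suc n. \<epsilon>' k (xs ! k)) * a xs j)) \<le> 1"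
    using a unfolding tensor_bounded_def by blast
  moreover have "(\<Sum>xs\<in>words I (Suc n). of_real (\<Prod>k<Suc n. \<epsilon>' k (xs ! k)) * a xs j)
    = (\<Sum>xs\<in>words I n. of_real (\<Prod>k<n. \<epsilon> k (xs ! k)) * (\<Sum>x\<in>I. of_real (\<delta> x) * a (x # xs) j))" for j
  proof -
    have "(\<Prod>k<Suc n. \<epsilon>' k ((x # xs) ! k)) = \<delta> x * (\<Prod>k<n. \<epsilon> k (xs ! k))" for x xs
      unfolding prod.lessThan_Suc_shift by (simp add: \<epsilon>'_def)
    then show ?thesis
      unfolding sum_words_Suc by (simp add: sum_distrib_left sum.swap[of _ I] mult_ac del: prod.lessThan_Suc of_real_prod)
  qed
  ultimately show "(\<Sum>j\<in>J. norm (\<Sum>xs\<in>words I n. of_real (\<Prod>k<n. \<epsilon> k (xs ! k)) * (\<Sum>x\<in>I. of_real (\<delta> x) * a (x # xs) j))) \<le> 1"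
    by simp
qed

text \<open>An l1 norm in one distinguished index \<open>c\<close> of an l2 norm in all others.
  Khinchin's inequality removes the other indices one by one, each at the cost of a factor 2 and a
  contraction with signs. What remains is a bounded matrix in \<open>c\<close> and \<open>j\<close>,
  to which Grothendieck's inequality applies.\<close>

lemma mixed_summability:
  fixes N :: nat and y :: "'j \<Rightarrow> 'd \<Rightarrow> complex"
  assumes fin: "finite C" "finite J" "finite D" and y: "\<And>j. j \<in> J \<Longrightarrow> l2 D (y j) \<le> 1"
    and a: "\<And>\<delta>. (\<And>c. c \<in> C \<Longrightarrow> \<bar>\<delta> c\<bar> \<le> 1) \<Longrightarrow>
       tensor_bounded n {..<N} J (\<lambda>xs j. \<Sum>c\<in>C. of_real (\<delta> c) * a c xs j)"
  shows "(\<Sum>c\<in>C. sqrt (\<Sum>xs\<in>words {..<N} n. (l2 D (\<lambda>d. \<Sum>j\<in>J. a c xs j * y j d))\<^sup>2)) \<le> 2 ^ n * 512"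
  using a
proof (induction n arbitrary: a)
  case 0
  have "real_bounded C J (\<lambda>c j. a c [] j)"
    unfolding real_bounded_def
  proof (intro allI impI)
    fix s :: "'a \<Rightarrow> real" and t :: "'j \<Rightarrow> real"
    assume s: "\<forall>i\<in>C. \<bar>s i\<bar> \<le> 1" and t: "\<forall>j\<in>J. \<bar>t j\<bar> \<le> 1"
    have "norm (\<Sum>c\<in>C. \<Sum>j\<in>J. a c [] j * (of_real (s c) * of_real (t j)))
       = norm (\<Sum>j\<in>J. of_real (t j) * (\<Sum>c\<in>C. of_real (s c) * a c [] j))"
      by (simp add: sum_distrib_left sum.swap[of _ J] mult_ac)
    also have "\<dots> \<le> (\<Sum>j\<in>J. norm (\<Sum>c\<in>C. of_real (s c) * a c [] j))"
      by (rule sum_norm_le) (use t in \<open>simp add: norm_mult mult_left_le_one_le\<close>)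
    also have "\<dots> \<le> 1" using "0.prems"[of s] s by (simp add: tensor_bounded_def)
    finally show "norm (\<Sum>c\<in>C. \<Sum>j\<in>J. a c [] j * (of_real (s c) * of_real (t j))) \<le> 1" .
  qed
  from hilbert_summingD[OF hilbert_summing_1[OF fin(1,2) this] fin(3) y]
  show ?case by simp
next
  case (Suc n)
  define a' where "a' = (\<lambda>e c xs j. \<Sum>x<N. of_real (e ! x) * a c (x # xs) j)"
  have ih: "(\<Sum>c\<in>C. sqrt (\<Sum>xs\<in>words {..<N} n. (l2 D (\<lambda>d. \<Sum>j\<in>J. a' e c xs j * y j d))\<^sup>2)) \<le> 2 ^ n * 512"
    if e: "e \<in> signs N" for e
  proof (rule Suc.IH)
    fix \<delta> :: "'a \<Rightarrow> real" assume \<delta>: "\<And>c. c \<in> C \<Longrightarrow> \<bar>\<delta> c\<bar> \<le> 1"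
    have "tensor_bounded n {..<N} J (\<lambda>xs j. \<Sum>x<N. of_real (e ! x) * (\<Sum>c\<in>C. of_real (\<delta> c) * a c (x # xs) j))"
      using signs_nth[OF e] \<delta> by (intro tensor_bounded_contract[OF Suc.prems]) auto
    then show "tensor_bounded n {..<N} J (\<lambda>xs j. \<Sum>c\<in>C. of_real (\<delta> c) * a' e c xs j)"
      by (simp add: a'_def sum_distrib_left sum.swap[of _ C] mult_ac)
  qed
  have "(\<Sum>c\<in>C. sqrt (\<Sum>xs\<in>words {..<N} (Suc n). (l2 D (\<lambda>d. \<Sum>j\<in>J. a c xs j * y j d))\<^sup>2))
    \<le> (\<Sum>c\<in>C. 2 * rad N (\<lambda>e. sqrt (\<Sum>xs\<in>words {..<N} n. (l2 D (\<lambda>d. \<Sum>j\<in>J. a' e c xs j * y j d))\<^sup>2)))"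
  proof (rule sum_mono)
    fix c
    define X where "X = (\<lambda>x p. \<Sum>j\<in>J. a c (x # fst p) j * y j (snd p))"
    have fw: "finite (words {..<N} n)" by (simp add: finite_words)
    have sq: "sqrt (\<Sum>xs\<in>words {..<N} n. (l2 D (\<lambda>d. g xs d))\<^sup>2) = l2 (words {..<N} n \<times> D) (\<lambda>p. g (fst p) (snd p))" for g
      using l2_Times_sq[OF fin(3) fw, of "\<lambda>p. g (fst p) (snd p)"]
      by (intro real_sqrt_unique) simp_all
    have "(\<Sum>xs\<in>words {..<N} (Suc n). (l2 D (\<lambda>d. \<Sum>j\<in>J. a c xs j * y j d))\<^sup>2)
       = (\<Sum>x<N. \<Sum>p\<in>words {..<N} n \<times> D. (norm (X x p))\<^sup>2)"
      unfolding sum_words_Suc l2_sq X_def by (simp add: sum.cartesian_product case_prod_unfold)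
    then have "sqrt (\<Sum>xs\<in>words {..<N} (Suc n). (l2 D (\<lambda>d. \<Sum>j\<in>J. a c xs j * y j d))\<^sup>2)
       \<le> 2 * rad N (\<lambda>e. l2 (words {..<N} n \<times> D) (\<lambda>p. rsum N (\<lambda>x. X x p) e))"
      using khinchin[where N = N and D = "words {..<N} n \<times> D" and x = X] by simp
    also have "(\<lambda>e. l2 (words {..<N} n \<times> D) (\<lambda>p. rsum N (\<lambda>x. X x p) e))
       = (\<lambda>e. sqrt (\<Sum>xs\<in>words {..<N} n. (l2 D (\<lambda>d. \<Sum>j\<in>J. a' e c xs j * y j d))\<^sup>2))"
      unfolding sq rsum_def X_def a'_def
      by (simp add: sum_distrib_left sum_distrib_right sum.swap[of _ J] mult_ac)
    finally show "sqrt (\<Sum>xs\<in>words {..<N} (Suc n). (l2 D (\<lambda>d. \<Sum>j\<in>J. a c xs j * y j d))\<^sup>2)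
       \<le> 2 * rad N (\<lambda>e. sqrt (\<Sum>xs\<in>words {..<N} n. (l2 D (\<lambda>d. \<Sum>j\<in>J. a' e c xs j * y j d))\<^sup>2))" .
  qed
  also have "\<dots> = 2 * rad N (\<lambda>e. \<Sum>c\<in>C. sqrt (\<Sum>xs\<in>words {..<N} n. (l2 D (\<lambda>d. \<Sum>j\<in>J. a' e c xs j * y j d))\<^sup>2))"
    by (simp add: rad_sum sum_distrib_left)
  also have "\<dots> \<le> 2 * (2 ^ n * 512)"
    by (intro mult_left_mono rad_le ih) auto
  finally show ?case by simp
qed

lemma L2_set_sum_le: "finite J \<Longrightarrow> L2_set (\<lambda>x. \<Sum>j\<in>J. f j x) X \<le> (\<Sum>j\<in>J. L2_set (f j) X)"
proof (induction J rule: finite_induct)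
  case (insert j J)
  then show ?case using L2_set_triangle_ineq[of "f j" "\<lambda>x. \<Sum>j\<in>J. f j x" X] by simp
qed (simp add: L2_set_0')

text \<open>For each fixed \<open>j\<close>, Khinchin's inequality replaces the square sum in one
  index by an average over signs; the contracted tensor is again bounded, uniformly in the
  signs.\<close>

lemma tensor_cotype_aux:
  fixes N :: nat
  assumes "finite J" and a: "tensor_bounded n {..<N} J a"
  shows "(\<Sum>j\<in>J. l2 (words {..<N} n) (\<lambda>xs. a xs j)) \<le> 2 ^ n"
  using a
proof (induction n arbitrary: a)
  case 0
  then show ?case by (simp add: tensor_bounded_def l2_def)
next
  case (Suc n)
  have "(\<Sum>j\<in>J. l2 (words {..<N} (Suc n)) (\<lambda>xs. a xs j))
    \<le> (\<Sum>j\<in>J. 2 * rad N (\<lambda>e. l2 (words {..<N} n) (\<lambda>xs. rsum N (\<lambda>x. a (x # xs) j) e)))"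
    unfolding l2_def[of "words _ (Suc n)"] sum_words_Suc by (intro sum_mono khinchin)
  also have "\<dots> = 2 * rad N (\<lambda>e. \<Sum>j\<in>J. l2 (words {..<N} n) (\<lambda>xs. rsum N (\<lambda>x. a (x # xs) j) e))"
    by (simp add: rad_sum sum_distrib_left)
  also have "\<dots> \<le> 2 * 2 ^ n"
  proof (intro mult_left_mono rad_le)
    fix e assume e: "e \<in> signs N"
    show "(\<Sum>j\<in>J. l2 (words {..<N} n) (\<lambda>xs. rsum N (\<lambda>x. a (x # xs) j) e)) \<le> 2 ^ n"
      unfolding rsum_def using signs_nth[OF e] by (intro Suc.IH tensor_bounded_contract[OF Suc.prems]) auto
  qed simp
  finally show ?case by simp
qed

text \<open>Minkowski's inequality exchanges the l1 norm in \<open>j\<close> with the l2 norm over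
  the multi-indices.\<close>

lemma tensor_cotype:
  fixes N :: nat
  assumes J: "finite J" and a: "tensor_bounded n {..<N} J a"
  shows "(\<Sum>xs\<in>words {..<N} n. (\<Sum>j\<in>J. norm (a xs j))\<^sup>2) \<le> 4 ^ n"
proof -
  have "L2_set (\<lambda>xs. \<Sum>j\<in>J. norm (a xs j)) (words {..<N} n) \<le> 2 ^ n"
    using L2_set_sum_le[OF J, of "\<lambda>j xs. norm (a xs j)" "words {..<N} n"] tensor_cotype_aux[OF J a]
    by (simp add: l2_eq_L2_set)
  then have "(L2_set (\<lambda>xs. \<Sum>j\<in>J. norm (a xs j)) (words {..<N} n))\<^sup>2 \<le> (2 ^ n)\<^sup>2"
    by (intro power_mono) auto
  then show ?thesis by (simp add: L2_set_def sum_nonneg power_mult_distrib[symmetric] power2_eq_square)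
qed

text \<open>Jensen's inequality for the power function, from Young's inequality applied to
  \<open>Z e\<close> and the constant \<open>a powr (\<rho> - 1)\<close>, where \<open>a\<close> is
  the mean.\<close>

lemma rad_powr:
  fixes Z :: "real list \<Rightarrow> real"
  assumes Z: "\<And>e. 0 \<le> Z e" and \<rho>: "1 \<le> \<rho>"
  shows "rad N Z powr \<rho> \<le> rad N (\<lambda>e. Z e powr \<rho>)"
proof (cases "\<rho> = 1 \<or> rad N Z = 0")
  case True
  have "0 \<le> rad N (\<lambda>e. Z e powr \<rho>)" "0 \<le> rad N Z"
    using rad_mono[of N "\<lambda>_. 0" "\<lambda>e. Z e powr \<rho>"] rad_mono[of N "\<lambda>_. 0" Z] Z by auto
  then show ?thesis using True Z by auto
next
  case False
  define a where "a = rad N Z"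
  have a: "a > 0" using False rad_mono[of N "\<lambda>_. 0" Z] Z by (auto simp: a_def)
  have r: "\<rho> > 1" using False \<rho> by simp
  define q where "q = \<rho> / (\<rho> - 1)"
  have q: "q > 1" "1/\<rho> + 1/q = 1" using r by (auto simp: q_def field_simps)
  have "Z e * a powr (\<rho> - 1) \<le> Z e powr \<rho> / \<rho> + a powr \<rho> / q" for e
  proof -
    have "(a powr (\<rho> - 1)) powr q = a powr \<rho>" using r by (simp add: powr_powr q_def)
    then show ?thesis using Youngs_inequality[OF r q Z[of e], of "a powr (\<rho> - 1)"] by simp
  qed
  then have "rad N (\<lambda>e. a powr (\<rho> - 1) * Z e) \<le> rad N (\<lambda>e. Z e powr \<rho> / \<rho> + a powr \<rho> / q)"
    by (intro rad_mono) (simp add: mult.commute)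
  then have "a powr (\<rho> - 1) * a \<le> rad N (\<lambda>e. Z e powr \<rho>) / \<rho> + a powr \<rho> / q"
    by (simp add: rad_cmult rad_add rad_cdiv a_def)
  moreover have "a powr (\<rho> - 1) * a = a powr \<rho>" using a powr_add[of a "\<rho> - 1" 1] by simp
  moreover have "a powr \<rho> / q = a powr \<rho> - a powr \<rho> / \<rho>"
  proof -
    have "1 / q = 1 - 1 / \<rho>" using q by simp
    then have "a powr \<rho> * (1 / q) = a powr \<rho> * (1 - 1 / \<rho>)" by simp
    then show ?thesis by (simp add: right_diff_distrib)
  qed
  ultimately have "a powr \<rho> / \<rho> \<le> rad N (\<lambda>e. Z e powr \<rho>) / \<rho>" by simp
  then show ?thesis using r by (simp add: a_def divide_le_cancel)
qed

text \<open>With \<open>G\<close> the geometric mean, \<open>ln (w/G) \<le> w/G - 1\<close> is used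
  at \<open>x\<close>, \<open>y\<close> and \<open>z\<close>; the logarithms cancel in the weighted
  sum.\<close>

lemma weighted_amgm3:
  fixes x y z :: real
  assumes "0 < x" "0 < y" "0 < z" "0 \<le> a" "0 \<le> b" "0 \<le> c" "a + b + c = 1"
  shows "x powr a * y powr b * z powr c \<le> a * x + b * y + c * z"
proof -
  define G where "G = x powr a * y powr b * z powr c"
  have G: "G > 0" using assms by (simp add: G_def)
  have lnG: "ln G = a * ln x + b * ln y + c * ln z" using assms by (simp add: G_def ln_mult ln_powr)
  have t: "1 + ln w - ln G \<le> w / G" if "w > 0" for w
    using ln_le_minus_one[of "w / G"] that G by (simp add: ln_div)
  have "(a + b + c) * (1 - ln G) + (a * ln x + b * ln y + c * ln z) = a * (1 + ln x - ln G) + b * (1 + ln y - ln G) + c * (1 + ln z - ln G)"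
    by (simp add: algebra_simps)
  also have "\<dots> \<le> a * (x / G) + b * (y / G) + c * (z / G)"
    using assms by (intro add_mono mult_left_mono t) auto
  finally have "1 \<le> (a * x + b * y + c * z) / G"
    using assms(7) lnG by (simp add: add_divide_distrib)
  then show ?thesis using G by (simp add: G_def field_simps)
qed

text \<open>With \<open>\<alpha> c\<close>, \<open>\<beta> x\<close> the row and column \<open>\<ell>\<^sub>2\<close> norms, \<open>w\<^sup>r\<close> is a weighted geometric mean
  of \<open>w\<^sup>2 / \<alpha>\<close>, \<open>w\<^sup>2 \<beta>\<^bsup>\<rho>-2\<^esup>\<close> and \<open>\<alpha> \<beta>\<^bsup>\<rho>\<^esup>\<close>, each of which has sum at most 1.\<close>

lemma blei_step:
  fixes w :: "'c \<Rightarrow> 'x \<Rightarrow> real"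
  assumes fin: "finite C" "finite X" and w: "\<And>c x. 0 \<le> w c x" and n: "n \<ge> 1"
    and row: "(\<Sum>c\<in>C. sqrt (\<Sum>x\<in>X. (w c x)\<^sup>2)) \<le> 1"
    and col: "(\<Sum>x\<in>X. sqrt (\<Sum>c\<in>C. (w c x)\<^sup>2) powr (2 * real n / (real n + 1))) \<le> 1"
  shows "(\<Sum>c\<in>C. \<Sum>x\<in>X. w c x powr (2 * real (Suc n) / (real (Suc n) + 1))) \<le> 1"
proof -
  define \<alpha> where "\<alpha> = (\<lambda>c. sqrt (\<Sum>x\<in>X. (w c x)\<^sup>2))"
  define \<beta> where "\<beta> = (\<lambda>x. sqrt (\<Sum>c\<in>C. (w c x)\<^sup>2))"
  define \<rho> where "\<rho> = 2 * real n / (real n + 1)"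
  define r where "r = 2 * real (Suc n) / (real (Suc n) + 1)"
  \<comment> \<open>The weights \<open>A\<close>, \<open>B\<close>, \<open>A\<close> add up to 1,
    and the total power of \<open>w\<close> is \<open>2A + 2B = r\<close>. The powers of
    \<open>\<alpha>\<close> cancel by symmetry, those of \<open>\<beta>\<close> because
    \<open>(2 - \<rho>) B = \<rho> A\<close>.\<close>
  define A where "A = 1 / (real n + 2)"
  define B where "B = real n / (real n + 2)"
  have AB: "A \<ge> 0" "B \<ge> 0" "A + B + A = 1" "2 * A + 2 * B = r"
    by (auto simp: A_def B_def r_def add_divide_distrib[symmetric] algebra_simps)
  have e3: "(2 - \<rho>) * B = \<rho> * A"
    by (simp add: A_def B_def \<rho>_def divide_simps)
  have \<alpha>2: "(\<alpha> c)\<^sup>2 = (\<Sum>x\<in>X. (w c x)\<^sup>2)" for c by (simp add: \<alpha>_def sum_nonneg)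
  have \<beta>2: "(\<beta> x)\<^sup>2 = (\<Sum>c\<in>C. (w c x)\<^sup>2)" for x by (simp add: \<beta>_def sum_nonneg)
  have pt: "w c x powr r \<le> A * ((w c x)\<^sup>2 / \<alpha> c) + B * ((w c x)\<^sup>2 * \<beta> x powr (\<rho> - 2)) + A * (\<alpha> c * \<beta> x powr \<rho>)"
    if cx: "c \<in> C" "x \<in> X" for c x
  proof (cases "w c x = 0")
    case True
    have "0 \<le> \<alpha> c" by (simp add: \<alpha>_def sum_nonneg)
    then show ?thesis using True AB by (simp add: r_def)
  next
    case False
    then have w0: "w c x > 0" using w[of c x] by simp
    have "(w c x)\<^sup>2 \<le> (\<alpha> c)\<^sup>2" unfolding \<alpha>2 using cx fin by (intro member_le_sum) auto
    then have "w c x \<le> \<alpha> c" by (rule power2_le_imp_le) (simp add: \<alpha>_def sum_nonneg)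
    with w0 have \<alpha>0: "\<alpha> c > 0" by linarith
    have "(w c x)\<^sup>2 \<le> (\<beta> x)\<^sup>2" unfolding \<beta>2 using cx fin by (intro member_le_sum[of c C "\<lambda>c. (w c x)\<^sup>2"]) auto
    then have "w c x \<le> \<beta> x" by (rule power2_le_imp_le) (simp add: \<beta>_def sum_nonneg)
    with w0 have \<beta>0: "\<beta> x > 0" by linarith
    have "w c x powr r = ((w c x)\<^sup>2 / \<alpha> c) powr A * ((w c x)\<^sup>2 * \<beta> x powr (\<rho> - 2)) powr B * (\<alpha> c * \<beta> x powr \<rho>) powr A"
    proof -
      have sq: "((w c x)\<^sup>2) powr t = w c x powr (2 * t)" for t
        using w0 powr_powr[of "w c x" 2 t] by simp
      have "\<beta> x powr ((\<rho> - 2) * B) * \<beta> x powr (\<rho> * A) = 1"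
        using \<beta>0 e3 by (simp add: powr_add[symmetric] algebra_simps)
      moreover have "w c x powr (2 * A) * w c x powr (2 * B) = w c x powr r"
        using AB(4) by (simp add: powr_add[symmetric])
      ultimately have "w c x powr r * (\<alpha> c powr A / \<alpha> c powr A)
        = (w c x powr (2 * A) / \<alpha> c powr A) * (w c x powr (2 * B) * \<beta> x powr ((\<rho> - 2) * B)) * (\<alpha> c powr A * \<beta> x powr (\<rho> * A))"
        by (simp add: algebra_simps)
      then show ?thesis using w0 \<alpha>0 \<beta>0
        by (simp add: powr_mult powr_divide powr_powr sq)
    qed
    also have "\<dots> \<le> A * ((w c x)\<^sup>2 / \<alpha> c) + B * ((w c x)\<^sup>2 * \<beta> x powr (\<rho> - 2)) + A * (\<alpha> c * \<beta> x powr \<rho>)"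
      using w0 \<alpha>0 \<beta>0 AB by (intro weighted_amgm3) auto
    finally show ?thesis .
  qed
  have s1: "(\<Sum>c\<in>C. \<Sum>x\<in>X. (w c x)\<^sup>2 / \<alpha> c) \<le> 1"
  proof -
    have "(\<Sum>c\<in>C. \<Sum>x\<in>X. (w c x)\<^sup>2 / \<alpha> c) = (\<Sum>c\<in>C. \<alpha> c)"
      unfolding sum_divide_distrib[symmetric] \<alpha>2[symmetric] by (simp add: power2_eq_square)
    then show ?thesis using row by (simp add: \<alpha>_def)
  qed
  have s2: "(\<Sum>c\<in>C. \<Sum>x\<in>X. (w c x)\<^sup>2 * \<beta> x powr (\<rho> - 2)) \<le> 1"
  proof -
    have "(\<Sum>c\<in>C. \<Sum>x\<in>X. (w c x)\<^sup>2 * \<beta> x powr (\<rho> - 2)) = (\<Sum>x\<in>X. (\<beta> x)\<^sup>2 * \<beta> x powr (\<rho> - 2))"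
      unfolding \<beta>2 sum_distrib_right by (rule sum.swap)
    also have "\<dots> = (\<Sum>x\<in>X. \<beta> x powr \<rho>)"
    proof (intro sum.cong refl)
      fix x
      have "0 \<le> \<beta> x" by (simp add: \<beta>_def sum_nonneg)
      then show "(\<beta> x)\<^sup>2 * \<beta> x powr (\<rho> - 2) = \<beta> x powr \<rho>"
        using powr_add[of "\<beta> x" 2 "\<rho> - 2"] by (cases "\<beta> x = 0") auto
    qed
    also have "\<dots> \<le> 1" using col by (simp add: \<beta>_def \<rho>_def)
    finally show ?thesis .
  qed
  have s3: "(\<Sum>c\<in>C. \<Sum>x\<in>X. \<alpha> c * \<beta> x powr \<rho>) \<le> 1"
  proof -
    have "(\<Sum>c\<in>C. \<Sum>x\<in>X. \<alpha> c * \<beta> x powr \<rho>) = (\<Sum>c\<in>C. \<alpha> c) * (\<Sum>x\<in>X. \<beta> x powr \<rho>)"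
      by (simp add: sum_product)
    also have "\<dots> \<le> 1 * 1"
      using row col by (intro mult_mono) (auto simp: \<alpha>_def \<beta>_def \<rho>_def sum_nonneg)
    finally show ?thesis by simp
  qed
  have "(\<Sum>c\<in>C. \<Sum>x\<in>X. w c x powr r) \<le> (\<Sum>c\<in>C. \<Sum>x\<in>X. A * ((w c x)\<^sup>2 / \<alpha> c) + B * ((w c x)\<^sup>2 * \<beta> x powr (\<rho> - 2)) + A * (\<alpha> c * \<beta> x powr \<rho>))"
    by (intro sum_mono pt)
  also have "\<dots> = A * (\<Sum>c\<in>C. \<Sum>x\<in>X. (w c x)\<^sup>2 / \<alpha> c) + B * (\<Sum>c\<in>C. \<Sum>x\<in>X. (w c x)\<^sup>2 * \<beta> x powr (\<rho> - 2))
      + A * (\<Sum>c\<in>C. \<Sum>x\<in>X. \<alpha> c * \<beta> x powr \<rho>)"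
    by (simp only: sum.distrib sum_distrib_left)
  also have "\<dots> \<le> A * 1 + B * 1 + A * 1"
    using s1 s2 s3 AB by (intro add_mono mult_left_mono) auto
  finally show ?thesis using AB by (simp add: r_def)
qed

text \<open>The base of the square dominates both the row bound \<open>2^n * 512\<close> and the
  column bound \<open>4 * blei_const n\<close>. The square accounts for an exponent of at most
  2.\<close>

primrec blei_const :: "nat \<Rightarrow> real" where
  "blei_const 0 = 1"
| "blei_const (Suc n) = (2 ^ n * 512 + 4 * blei_const n)\<^sup>2"

lemma blei_const_ge_1: "1 \<le> blei_const n"
proof (induction n)
  case (Suc n)
  have "1 \<le> 2 ^ n * 512 + 4 * blei_const n"
    using Suc by (simp add: add_increasing)
  then show ?case by simp
qed simp

text \<open>For \<open>n = 1\<close> this is the matrix case with exponent 1. In the step the first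
  index \<open>c\<close> is separated: mixed summability bounds the rows, and the columns are
  bounded by Khinchin's inequality in \<open>c\<close> together with the induction hypothesis for
  the contracted tensors, whose exponent is the old one. Dividing by \<open>M\<close> normalises
  both bounds for \<open>blei_step\<close>, which yields the next exponent.\<close>

lemma tensor_hilbert_summing:
  assumes J: "finite J" and n: "n \<ge> 1" and a: "tensor_bounded n {..<N} J a"
  shows "hilbert_summing (2 * real n / (real n + 1)) (blei_const n) (words {..<N::nat} n) J a"
  using n a
proof (induction n arbitrary: a rule: dec_induct)
  case base
  have one: "words {..<N} 1 = (\<lambda>x. [x]) ` {..<N}" by (auto simp: words_Suc)
  have "real_bounded {..<N} J (\<lambda>x. a [x])"
    unfolding real_bounded_def
  proof (intro allI impI)
    fix s :: "nat \<Rightarrow> real" and t :: "'a \<Rightarrow> real"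
    assume s: "\<forall>i\<in>{..<N}. \<bar>s i\<bar> \<le> 1" and t: "\<forall>j\<in>J. \<bar>t j\<bar> \<le> 1"
    have "norm (\<Sum>x<N. \<Sum>j\<in>J. a [x] j * (of_real (s x) * of_real (t j)))
       = norm (\<Sum>j\<in>J. of_real (t j) * (\<Sum>x<N. of_real (s x) * a [x] j))"
      by (simp add: sum_distrib_left sum.swap[of _ J] mult_ac)
    also have "\<dots> \<le> (\<Sum>j\<in>J. norm (\<Sum>x<N. of_real (s x) * a [x] j))"
      by (rule sum_norm_le) (use t in \<open>simp add: norm_mult mult_left_le_one_le\<close>)
    also have "\<dots> \<le> 1" using base[unfolded tensor_bounded_def, rule_format, of "\<lambda>_. s"] s
      by (simp add: sum_words_Suc)
    finally show "norm (\<Sum>x<N. \<Sum>j\<in>J. a [x] j * (of_real (s x) * of_real (t j))) \<le> 1" .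
  qed
  then have "hilbert_summing 1 512 {..<N} J (\<lambda>x. a [x])"
    using J by (intro hilbert_summing_1) auto
  then have "hilbert_summing 1 512 (words {..<N} 1) J a"
    unfolding hilbert_summing_def one by (simp add: sum.reindex inj_on_def)
  then show ?case using hilbert_summing_mono[of 1 512 "words {..<N} 1" J a "blei_const 1"] by simp
next
  case (step n)
  define \<rho> where "\<rho> = 2 * real n / (real n + 1)"
  define r where "r = 2 * real (Suc n) / (real (Suc n) + 1)"
  define M where "M = 2 ^ n * 512 + 4 * blei_const n"
  have \<rho>: "1 \<le> \<rho>" "\<rho> \<le> 2" using step.hyps by (auto simp: \<rho>_def field_simps)
  have r: "0 \<le> r" "r \<le> 2" by (auto simp: r_def field_simps)
  have M1: "1 \<le> M" using blei_const_ge_1[of n] by (simp add: M_def add_increasing)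
  show ?case
    unfolding hilbert_summing_def r_def[symmetric]
  proof (intro allI impI)
    fix D :: "nat set" and y :: "'a \<Rightarrow> nat \<Rightarrow> complex"
    assume D: "finite D" and y: "\<forall>j\<in>J. l2 D (y j) \<le> 1"
    define U where "U = (\<lambda>xs d. \<Sum>j\<in>J. a xs j * y j d)"
    define w where "w = (\<lambda>c xs. l2 D (U (c # xs)) / M)"
    have w2: "(w c xs)\<^sup>2 = (l2 D (U (c # xs)))\<^sup>2 / M\<^sup>2" for c xs by (simp add: w_def power_divide)
    have row: "(\<Sum>c<N. sqrt (\<Sum>xs\<in>words {..<N} n. (w c xs)\<^sup>2)) \<le> 1"
    proof -
      have "(\<Sum>c<N. sqrt (\<Sum>xs\<in>words {..<N} n. (l2 D (\<lambda>d. \<Sum>j\<in>J. a (c # xs) j * y j d))\<^sup>2)) \<le> 2 ^ n * 512"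
        using J D y step.prems by (intro mixed_summability tensor_bounded_contract) auto
      also have "\<dots> \<le> M" using blei_const_ge_1[of n] by (simp add: M_def)
      finally have "(\<Sum>c<N. sqrt (\<Sum>xs\<in>words {..<N} n. (l2 D (U (c # xs)))\<^sup>2)) / M \<le> 1"
        using M1 by (simp add: U_def)
      moreover have "sqrt (\<Sum>xs\<in>words {..<N} n. (w c xs)\<^sup>2) = sqrt (\<Sum>xs\<in>words {..<N} n. (l2 D (U (c # xs)))\<^sup>2) / M" for c
        using M1 by (simp add: w2 sum_divide_distrib[symmetric] real_sqrt_divide)
      ultimately show ?thesis by (simp add: sum_divide_distrib)
    qed
    have col: "(\<Sum>xs\<in>words {..<N} n. sqrt (\<Sum>c<N. (w c xs)\<^sup>2) powr \<rho>) \<le> 1"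
    proof -
      define Z where "Z = (\<lambda>xs e. l2 D (\<lambda>d. \<Sum>j\<in>J. (\<Sum>c<N. of_real (e ! c) * a (c # xs) j) * y j d))"
      have "(\<Sum>xs\<in>words {..<N} n. sqrt (\<Sum>c<N. (l2 D (U (c # xs)))\<^sup>2) powr \<rho>)
         \<le> (\<Sum>xs\<in>words {..<N} n. 4 * rad N (\<lambda>e. Z xs e powr \<rho>))"
      proof (rule sum_mono)
        fix xs
        have "sqrt (\<Sum>c<N. (l2 D (U (c # xs)))\<^sup>2) \<le> 2 * rad N (\<lambda>e. l2 D (\<lambda>d. rsum N (\<lambda>c. U (c # xs) d) e))"
          unfolding l2_sq by (rule khinchin)
        also have "(\<lambda>e. l2 D (\<lambda>d. rsum N (\<lambda>c. U (c # xs) d) e)) = Z xs"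
          unfolding Z_def rsum_def U_def by (simp add: sum_distrib_left sum_distrib_right sum.swap[of _ J] mult_ac)
        finally have "sqrt (\<Sum>c<N. (l2 D (U (c # xs)))\<^sup>2) powr \<rho> \<le> (2 * rad N (Z xs)) powr \<rho>"
          using \<rho> by (intro powr_mono2) (auto intro!: sum_nonneg)
        also have "\<dots> = 2 powr \<rho> * rad N (Z xs) powr \<rho>"
          by (rule powr_mult)
        also have "\<dots> \<le> 2 powr 2 * rad N (\<lambda>e. Z xs e powr \<rho>)"
          using \<rho> by (intro mult_mono powr_mono rad_powr) (auto simp: Z_def)
        finally show "sqrt (\<Sum>c<N. (l2 D (U (c # xs)))\<^sup>2) powr \<rho> \<le> 4 * rad N (\<lambda>e. Z xs e powr \<rho>)" by simp
      qed
      also have "\<dots> = 4 * rad N (\<lambda>e. \<Sum>xs\<in>words {..<N} n. Z xs e powr \<rho>)"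
        by (simp add: rad_sum sum_distrib_left)
      also have "\<dots> \<le> 4 * blei_const n"
      proof (intro mult_left_mono rad_le)
        fix e assume e: "e \<in> signs N"
        have "hilbert_summing \<rho> (blei_const n) (words {..<N} n) J (\<lambda>xs j. \<Sum>c<N. of_real (e ! c) * a (c # xs) j)"
          unfolding \<rho>_def using signs_nth[OF e] by (intro step.IH tensor_bounded_contract[OF step.prems]) auto
        then show "(\<Sum>xs\<in>words {..<N} n. Z xs e powr \<rho>) \<le> blei_const n"
          unfolding Z_def using D y by (intro hilbert_summingD) auto
      qed simp
      also have "\<dots> \<le> M powr \<rho>"
      proof -
        have "M powr 1 \<le> M powr \<rho>" using M1 \<rho> by (intro powr_mono) auto
        then have "M \<le> M powr \<rho>" using M1 by simp
        moreover have "4 * blei_const n \<le> M" by (simp add: M_def)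
        ultimately show ?thesis by linarith
      qed
      finally have "(\<Sum>xs\<in>words {..<N} n. sqrt (\<Sum>c<N. (l2 D (U (c # xs)))\<^sup>2) powr \<rho>) / M powr \<rho> \<le> 1"
        using M1 by simp
      moreover have "sqrt (\<Sum>c<N. (w c xs)\<^sup>2) powr \<rho> = sqrt (\<Sum>c<N. (l2 D (U (c # xs)))\<^sup>2) powr \<rho> / M powr \<rho>" for xs
        using M1 by (simp add: w2 sum_divide_distrib[symmetric] real_sqrt_divide powr_divide sum_nonneg)
      ultimately show ?thesis by (simp add: sum_divide_distrib)
    qed
    have "(\<Sum>c<N. \<Sum>xs\<in>words {..<N} n. w c xs powr r) \<le> 1"
      unfolding r_def using M1 row col step.hyps
      by (intro blei_step) (auto simp: w_def finite_words \<rho>_def)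
    moreover have "w c xs powr r = l2 D (U (c # xs)) powr r / M powr r" for c xs
      using M1 by (simp add: w_def powr_divide)
    ultimately have "(\<Sum>c<N. \<Sum>xs\<in>words {..<N} n. l2 D (U (c # xs)) powr r) / M powr r \<le> 1"
      by (simp add: sum_divide_distrib)
    then have "(\<Sum>c<N. \<Sum>xs\<in>words {..<N} n. l2 D (U (c # xs)) powr r) \<le> M powr r"
      using M1 by simp
    also have "\<dots> \<le> M powr 2" using M1 r by (intro powr_mono) auto
    also have "\<dots> = blei_const (Suc n)" using M1 by (simp add: M_def)
    finally show "(\<Sum>xs\<in>words {..<N} (Suc n). l2 D (\<lambda>d. \<Sum>j\<in>J. a xs j * y j d) powr r) \<le> blei_const (Suc n)"
      by (simp add: sum_words_Suc U_def)
  qed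
qed

subsection \<open>A multilinear Grothendieck inequality\<close>

text \<open>Bessel's inequality for the orthonormal coordinate functions. The sum \<open>S\<close>
  of the squared coefficients is the pairing of \<open>f\<close> with its own projection, whose
  second moment is \<open>S\<close>; hence \<open>S \<le> S/2 + F/2\<close>.\<close>

lemma rad_bessel:
  fixes f :: "real list \<Rightarrow> complex"
  shows "(\<Sum>i<M. (norm (rad M (\<lambda>e. of_real (e ! i) * f e)))\<^sup>2) \<le> rad M (\<lambda>e. (norm (f e))\<^sup>2)"
proof -
  define c where "c = (\<lambda>i. rad M (\<lambda>e. of_real (e ! i) * f e))"
  define S where "S = (\<Sum>i<M. (norm (c i))\<^sup>2)"
  define F where "F = rad M (\<lambda>e. (norm (f e))\<^sup>2)"
  have S0: "S \<ge> 0" by (simp add: S_def sum_nonneg)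
  have F0: "F \<ge> 0" using rad_mono[of M "\<lambda>_. 0" "\<lambda>e. (norm (f e))\<^sup>2"] by (simp add: F_def)
  have "complex_of_real S = (\<Sum>i<M. cnj (c i) * c i)"
    by (simp add: S_def complex_norm_square mult.commute del: of_real_power)
  also have "\<dots> = rad M (\<lambda>e. rsum M (\<lambda>i. cnj (c i)) e * f e)"
  proof -
    have "(\<Sum>i<M. cnj (c i) * c i) = (\<Sum>i<M. rad M (\<lambda>e. cnj (c i) * (of_real (e ! i) * f e)))"
      by (simp add: rad_cmult c_def)
    also have "\<dots> = rad M (\<lambda>e. \<Sum>i<M. cnj (c i) * (of_real (e ! i) * f e))" by (simp add: rad_sum)
    finally show ?thesis by (simp add: rsum_def sum_distrib_left sum_distrib_right mult_ac)
  qed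
  finally have eq: "complex_of_real S = rad M (\<lambda>e. rsum M (\<lambda>i. cnj (c i)) e * f e)" .
  have "S = norm (complex_of_real S)" using S0 by simp
  also have "\<dots> \<le> rad M (\<lambda>e. norm (rsum M (\<lambda>i. cnj (c i)) e * f e))"
    unfolding eq by (rule norm_rad_le)
  also have "\<dots> \<le> rad M (\<lambda>e. (norm (rsum M (\<lambda>i. cnj (c i)) e))\<^sup>2 / 2 + (norm (f e))\<^sup>2 / 2)"
  proof (rule rad_mono)
    fix e
    show "norm (rsum M (\<lambda>i. cnj (c i)) e * f e) \<le> (norm (rsum M (\<lambda>i. cnj (c i)) e))\<^sup>2 / 2 + (norm (f e))\<^sup>2 / 2"
      using sum_squares_bound[of "norm (rsum M (\<lambda>i. cnj (c i)) e)" "norm (f e)"]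
      by (simp add: norm_mult)
  qed
  also have "\<dots> = S / 2 + F / 2"
    by (simp add: rad_add rad_cdiv rad_sq_le F_def S_def)
  finally show ?thesis by (simp add: S_def F_def c_def)
qed

text \<open>Induction on the number of factors: truncating only the Rademacher sum of the first factor leaves
  the sequence length \<open>M\<close> unchanged.\<close>

lemma multilinear_grothendieck:
  fixes b :: "nat list \<Rightarrow> complex" and x :: "nat \<Rightarrow> nat \<Rightarrow> nat \<Rightarrow> complex"
  assumes n: "n \<ge> 2" and b: "tensor_bounded n {..<N} {()} (\<lambda>xs _. b xs)"
    and x: "\<And>l r. l < n \<Longrightarrow> r < N \<Longrightarrow> l2 {..<M} (\<lambda>i. x l i r) \<le> 1"
  shows "norm (\<Sum>i<M. \<Sum>xs\<in>words {..<N} n. (\<Prod>l<n. x l i (xs ! l)) * b xs) \<le> 512 * 32 ^ (n - 2)"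
  using n b x
proof (induction n arbitrary: b x rule: dec_induct)
  case base
  have w2: "(\<Sum>xs\<in>words {..<N} 2. f xs) = (\<Sum>r<N. \<Sum>s<N. f [r, s])" for f :: "nat list \<Rightarrow> complex"
    by (simp add: numeral_2_eq_2 sum_words_Suc)
  have "real_bounded {..<N} {..<N} (\<lambda>r s. b [r, s])"
    unfolding real_bounded_def
  proof (intro allI impI)
    fix s t :: "nat \<Rightarrow> real"
    assume s: "\<forall>i\<in>{..<N}. \<bar>s i\<bar> \<le> 1" and t: "\<forall>j\<in>{..<N}. \<bar>t j\<bar> \<le> 1"
    define \<epsilon> where "\<epsilon> = (\<lambda>k::nat. if k = 0 then s else t)"
    have "\<forall>k<2. \<forall>x\<in>{..<N}. \<bar>\<epsilon> k x\<bar> \<le> 1" using s t by (simp add: \<epsilon>_def)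
    then have "(\<Sum>j\<in>{()}. norm (\<Sum>xs\<in>words {..<N} 2. of_real (\<Prod>k<2. \<epsilon> k (xs ! k)) * b xs)) \<le> 1"
      using base(1) unfolding tensor_bounded_def by blast
    then show "norm (\<Sum>i<N. \<Sum>j<N. b [i, j] * (of_real (s i) * of_real (t j))) \<le> 1"
      by (simp add: numeral_2_eq_2 sum_words_Suc \<epsilon>_def mult_ac)
  qed
  from grothendieck[OF _ _ _ this, of "{..<M}" "\<lambda>r i. x 0 i r" "\<lambda>s i. x 1 i s"]
  have "norm (\<Sum>r<N. \<Sum>s<N. b [r, s] * (\<Sum>i<M. x 0 i r * x 1 i s)) \<le> 512"
    using base(2) by simp
  also have "(\<Sum>r<N. \<Sum>s<N. b [r, s] * (\<Sum>i<M. x 0 i r * x 1 i s))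
     = (\<Sum>i<M. \<Sum>xs\<in>words {..<N} 2. (\<Prod>l<2. x l i (xs ! l)) * b xs)"
    unfolding w2 by (simp add: numeral_2_eq_2 sum_distrib_left sum.swap[of _ "{..<M}"] mult_ac)
  finally show ?case by simp
next
  case (step n)
  define x' where "x' = (\<lambda>l. x (Suc l))"
  define tc where "tc = (512 * 32 ^ (n - 2) :: real)"
  define \<Phi> where "\<Phi> = (\<lambda>z. \<Sum>i<M. \<Sum>r<N. \<Sum>xs\<in>words {..<N} n. z i r * (\<Prod>l<n. x' l i (xs ! l)) * b (r # xs))"
  define S where "S = {norm (\<Phi> z) | z. \<forall>r<N. l2 {..<M} (\<lambda>i. z i r) \<le> 1}"
  define K where "K = Sup S"
  have bdd: "bdd_above S"
  proof (rule bdd_aboveI)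
    fix q assume "q \<in> S"
    then obtain z where q: "q = norm (\<Phi> z)" and z: "\<forall>r<N. l2 {..<M} (\<lambda>i. z i r) \<le> 1" by (auto simp: S_def)
    show "q \<le> (\<Sum>i<M. \<Sum>r<N. \<Sum>xs\<in>words {..<N} n. norm ((\<Prod>l<n. x' l i (xs ! l)) * b (r # xs)))"
      unfolding q \<Phi>_def
    proof (intro sum_norm_le)
      fix i r xs assume "i \<in> {..<M}" "r \<in> {..<N}"
      then have "norm (z i r) \<le> 1"
        using z member_le_L2_set[of "{..<M}" i "\<lambda>i. norm (z i r)"] by (fastforce simp: l2_eq_L2_set)
      then show "norm (z i r * (\<Prod>l<n. x' l i (xs ! l)) * b (r # xs)) \<le> norm ((\<Prod>l<n. x' l i (xs ! l)) * b (r # xs))"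
        unfolding mult.assoc norm_mult[of "z i r"] by (intro mult_left_le_one_le) auto
    qed
  qed
  have K: "norm (\<Phi> z) \<le> K" if "\<forall>r<N. l2 {..<M} (\<lambda>i. z i r) \<le> 1" for z
    unfolding K_def using that by (intro cSup_upper bdd) (auto simp: S_def)
  have tc0: "tc > 0" by (simp add: tc_def)
  have stepK: "norm (\<Phi> z) \<le> 16 * tc + K / 4" if z: "\<forall>r<N. l2 {..<M} (\<lambda>i. z i r) \<le> 1" for z
  proof -
    define X where "X = (\<lambda>r. rsum M (\<lambda>i. z i r))"
    define T where "T = (\<lambda>r e. trunc (X r e))"
    \<comment> \<open>The coefficients of the truncated sum and of the cut-off part. Orthonormality
      gives \<open>z = p + q\<close>, and by Bessel's inequality \<open>q\<close> has norms at most
      \<open>1/4\<close>, so \<open>\<Phi> q\<close> costs only \<open>K/4\<close>.\<close>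
    define p where "p = (\<lambda>i r. rad M (\<lambda>e. of_real (e ! i) * T r e))"
    define q where "q = (\<lambda>i r. rad M (\<lambda>e. of_real (e ! i) * (X r e - T r e)))"
    have "z i r = p i r + q i r" if "i < M" for i r
      unfolding p_def q_def rad_add[symmetric] distrib_left[symmetric] using rad_nth_rsum[OF that, of "\<lambda>i. z i r"]
      by (simp add: X_def)
    then have "\<Phi> z = (\<Sum>i<M. \<Sum>r<N. \<Sum>xs\<in>words {..<N} n. (p i r + q i r) * (\<Prod>l<n. x' l i (xs ! l)) * b (r # xs))"
      unfolding \<Phi>_def by (intro sum.cong refl) simp
    then have pq: "\<Phi> z = \<Phi> p + \<Phi> q"
      unfolding \<Phi>_def by (simp add: sum.distrib distrib_right)
    have q4: "norm (\<Phi> q) \<le> K / 4"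
    proof -
      have "l2 {..<M} (\<lambda>i. 4 * q i r) \<le> 1" if r: "r < N" for r
      proof -
        have "(\<Sum>i<M. (norm (q i r))\<^sup>2) \<le> rad M (\<lambda>e. (norm (X r e - T r e))\<^sup>2)"
          unfolding q_def by (rule rad_bessel)
        also have "\<dots> \<le> 1/16"
          unfolding X_def T_def using z r by (intro rad_trunc_rest) (simp add: l2_le_1_iff)
        finally show ?thesis unfolding l2_le_1_iff norm_mult power_mult_distrib sum_distrib_left[symmetric] by simp
      qed
      then have "norm (\<Phi> (\<lambda>i r. 4 * q i r)) \<le> K" by (intro K) auto
      moreover have "\<Phi> (\<lambda>i r. 4 * q i r) = 4 * \<Phi> q"
        by (simp add: \<Phi>_def sum_distrib_left mult_ac)
      ultimately show ?thesis by (simp add: norm_mult)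
    qed
    have p4: "norm (\<Phi> p) \<le> 16 * tc"
    proof -
      \<comment> \<open>For a fixed sign vector \<open>e\<close> the truncated values depend on
        \<open>r\<close> but no longer on \<open>i\<close>, so they may be contracted into the
        tensor as bounded scalars. The sign \<open>e ! i\<close> is absorbed into the first of the
        remaining factors without changing its norm, and the induction hypothesis applies.\<close>
      define \<Psi> where "\<Psi> = (\<lambda>e s. \<Sum>i<M. \<Sum>xs\<in>words {..<N} n. of_real (e ! i) * (\<Prod>l<n. x' l i (xs ! l)) * (\<Sum>r<N. s r * b (r # xs)))"
      have \<Psi>: "norm (\<Psi> e (\<lambda>r. of_real (s r))) \<le> tc" if e: "e \<in> signs M" and s: "\<And>r. r < N \<Longrightarrow> \<bar>s r\<bar> \<le> 1" for e s
      proof -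
        define x'' where "x'' = (\<lambda>l i r. (if l = 0 then of_real (e ! i) else 1) * x' l i r)"
        have "n > 0" using step.hyps by simp
        then obtain n' where n': "n = Suc n'" by (cases n) auto
        have e1: "(\<Prod>l<n. x'' l i (xs ! l)) = of_real (e ! i) * (\<Prod>l<n. x' l i (xs ! l))" for i xs
          unfolding x''_def n' prod.lessThan_Suc_shift by simp
        have "tensor_bounded n {..<N} {()} (\<lambda>xs _. \<Sum>r<N. of_real (s r) * b (r # xs))"
          using s by (intro tensor_bounded_contract[OF step.prems(1)]) auto
        moreover have "l2 {..<M} (\<lambda>i. x'' l i r) \<le> 1" if "l < n" "r < N" for l r
        proof -
          have "l2 {..<M} (\<lambda>i. x'' l i r) = l2 {..<M} (\<lambda>i. x' l i r)"
            unfolding l2_def x''_def using signs_nth[OF e] by (auto intro!: sum.cong simp: norm_mult)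
          then show ?thesis using step.prems(2)[of "Suc l" r] that by (simp add: x'_def)
        qed
        ultimately have "norm (\<Sum>i<M. \<Sum>xs\<in>words {..<N} n. (\<Prod>l<n. x'' l i (xs ! l)) * (\<Sum>r<N. of_real (s r) * b (r # xs))) \<le> tc"
          unfolding tc_def by (rule step.IH)
        then show ?thesis by (simp add: e1 \<Psi>_def)
      qed
      have "\<Phi> p = rad M (\<lambda>e. \<Psi> e (\<lambda>r. T r e))"
      proof -
        have "\<Phi> p = (\<Sum>i<M. \<Sum>r<N. \<Sum>xs\<in>words {..<N} n. rad M (\<lambda>e. ((\<Prod>l<n. x' l i (xs ! l)) * b (r # xs)) * (of_real (e ! i) * T r e)))"
          unfolding rad_cmult \<Phi>_def p_def by (simp add: mult_ac)
        also have "\<dots> = rad M (\<lambda>e. \<Sum>i<M. \<Sum>r<N. \<Sum>xs\<in>words {..<N} n. ((\<Prod>l<n. x' l i (xs ! l)) * b (r # xs)) * (of_real (e ! i) * T r e))"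
          by (simp only: rad_sum)
        also have "\<dots> = rad M (\<lambda>e. \<Psi> e (\<lambda>r. T r e))"
          unfolding \<Psi>_def by (simp add: sum_distrib_left sum.swap[of _ "{..<N}" "words {..<N} n"] mult_ac)
        finally show ?thesis .
      qed
      also have "norm \<dots> \<le> 16 * tc"
      proof (intro order_trans[OF norm_rad_le] rad_le)
        fix e assume e: "e \<in> signs M"
        have T8: "\<bar>Re (T r e) / 8\<bar> \<le> 1" "\<bar>Im (T r e) / 8\<bar> \<le> 1" for r
          using norm_trunc(1)[of "X r e"] abs_Re_le_cmod[of "T r e"] abs_Im_le_cmod[of "T r e"] by (auto simp: T_def)
        have "T r e = 8 * (of_real (Re (T r e) / 8) + \<i> * of_real (Im (T r e) / 8))" for r
          by (simp add: complex_eq_iff)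
        then have "\<Psi> e (\<lambda>r. T r e) = \<Psi> e (\<lambda>r. 8 * (of_real (Re (T r e) / 8) + \<i> * of_real (Im (T r e) / 8)))" by simp
        also have "\<dots> = 8 * (\<Psi> e (\<lambda>r. of_real (Re (T r e) / 8)) + \<i> * \<Psi> e (\<lambda>r. of_real (Im (T r e) / 8)))"
          unfolding \<Psi>_def by (simp add: sum_distrib_left sum.distrib[symmetric] distrib_left distrib_right mult_ac)
        also have "norm \<dots> \<le> 8 * (tc + tc)"
        proof -
          have "norm (\<Psi> e (\<lambda>r. of_real (Re (T r e) / 8)) + \<i> * \<Psi> e (\<lambda>r. of_real (Im (T r e) / 8)))
            \<le> norm (\<Psi> e (\<lambda>r. of_real (Re (T r e) / 8))) + norm (\<Psi> e (\<lambda>r. of_real (Im (T r e) / 8)))"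
            by (rule order_trans[OF norm_triangle_ineq]) (simp only: norm_mult norm_ii mult_1 order_refl)
          also have "\<dots> \<le> tc + tc" by (intro add_mono \<Psi> e T8)
          finally show ?thesis unfolding norm_mult[of 8] by simp
        qed
        finally show "norm (\<Psi> e (\<lambda>r. T r e)) \<le> 16 * tc" by simp
      qed
      finally show ?thesis .
    qed
    show ?thesis unfolding pq using norm_triangle_ineq[of "\<Phi> p" "\<Phi> q"] p4 q4 by linarith
  qed
  have "K \<le> 16 * tc + K / 4"
    unfolding K_def
  proof (rule cSup_least)
    have "norm (\<Phi> (\<lambda>_ _. 0)) \<in> S" unfolding S_def by (force simp: l2_def)
    then show "S \<noteq> {}" by blast
  qed (use stepK K_def in \<open>auto simp: S_def\<close>)
  \<comment> \<open>Here \<open>16 = 8 + 8\<close> comes from the truncation level for real and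
    imaginary parts, and solving for \<open>K\<close> gives \<open>64/3\<close>, rounded up to
    32.\<close>
  then have "K \<le> 32 * tc" using tc0 by simp
  moreover have "norm (\<Phi> (x 0)) \<le> K" using step.prems(2) by (intro K) auto
  moreover have "\<Phi> (x 0) = (\<Sum>i<M. \<Sum>xs\<in>words {..<N} (Suc n). (\<Prod>l<Suc n. x l i (xs ! l)) * b xs)"
    unfolding \<Phi>_def x'_def sum_words_Suc prod.lessThan_Suc_shift by simp
  moreover have "32 * tc = 512 * 32 ^ (Suc n - 2)"
  proof -
    have "Suc n - 2 = Suc (n - 2)" using step.hyps(1) by simp
    then show ?thesis by (simp only: tc_def power_Suc)
  qed
  ultimately show ?case by (simp del: prod.lessThan_Suc)
qed

text \<open>The matrix in \<open>i\<close> and \<open>j\<close> is bounded up to \<open>c\<close>: a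
  test vector \<open>s\<close> is absorbed into the first family \<open>x\<close>, a test vector
  \<open>t\<close> contracts the index \<open>j\<close>, and the multilinear inequality bounds the
  result. The bilinear inequality then contributes the second factor 512.\<close>

lemma grothendieck_rows_summing:
  fixes a :: "nat list \<Rightarrow> 'j \<Rightarrow> complex" and x :: "nat \<Rightarrow> nat \<Rightarrow> nat \<Rightarrow> complex"
  assumes n: "n \<ge> 2" and J: "finite J" and a: "tensor_bounded n {..<N} J a"
    and x: "\<And>l r. l < n \<Longrightarrow> r < N \<Longrightarrow> l2 {..<M} (\<lambda>i. x l i r) \<le> 1"
  shows "hilbert_summing 1 (512 * (512 * 32 ^ (n - 2))) {..<M} J
     (\<lambda>i j. \<Sum>xs\<in>words {..<N} n. (\<Prod>l<n. x l i (xs ! l)) * a xs j)"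
proof -
  define c where "c = (512 * 32 ^ (n - 2) :: real)"
  have c: "c > 0" by (simp add: c_def)
  define v where "v = (\<lambda>i j. \<Sum>xs\<in>words {..<N} n. (\<Prod>l<n. x l i (xs ! l)) * a xs j)"
  have "real_bounded {..<M} J (\<lambda>i j. v i j / of_real c)"
    unfolding real_bounded_def
  proof (intro allI impI)
    fix s :: "nat \<Rightarrow> real" and t :: "'j \<Rightarrow> real"
    assume s: "\<forall>i\<in>{..<M}. \<bar>s i\<bar> \<le> 1" and t: "\<forall>j\<in>J. \<bar>t j\<bar> \<le> 1"
    define b where "b = (\<lambda>xs. \<Sum>j\<in>J. of_real (t j) * a xs j)"
    define x' where "x' = (\<lambda>l i r. (if l = 0 then of_real (s i) else 1) * x l i r)"
    obtain n' where n': "n = Suc n'" using n by (cases n) auto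
    have e1: "(\<Prod>l<n. x' l i (xs ! l)) = of_real (s i) * (\<Prod>l<n. x l i (xs ! l))" for i xs
      unfolding x'_def n' prod.lessThan_Suc_shift by simp
    have "tensor_bounded n {..<N} {()} (\<lambda>xs _. b xs)"
      unfolding tensor_bounded_def
    proof (intro allI impI)
      fix \<epsilon> :: "nat \<Rightarrow> nat \<Rightarrow> real" assume \<epsilon>: "\<forall>k<n. \<forall>x\<in>{..<N}. \<bar>\<epsilon> k x\<bar> \<le> 1"
      have "norm (\<Sum>xs\<in>words {..<N} n. of_real (\<Prod>k<n. \<epsilon> k (xs ! k)) * b xs)
        = norm (\<Sum>j\<in>J. of_real (t j) * (\<Sum>xs\<in>words {..<N} n. of_real (\<Prod>k<n. \<epsilon> k (xs ! k)) * a xs j))"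
        unfolding b_def by (simp add: sum_distrib_left sum_distrib_right sum.swap[of _ J] mult_ac)
      also have "\<dots> \<le> (\<Sum>j\<in>J. norm (\<Sum>xs\<in>words {..<N} n. of_real (\<Prod>k<n. \<epsilon> k (xs ! k)) * a xs j))"
        by (rule sum_norm_le) (use t in \<open>simp add: norm_mult mult_left_le_one_le del: of_real_prod\<close>)
      also have "\<dots> \<le> 1" using a \<epsilon> unfolding tensor_bounded_def by blast
      finally show "(\<Sum>j\<in>{()}. norm (\<Sum>xs\<in>words {..<N} n. of_real (\<Prod>k<n. \<epsilon> k (xs ! k)) * b xs)) \<le> 1" by simp
    qed
    moreover have "l2 {..<M} (\<lambda>i. x' l i r) \<le> 1" if "l < n" "r < N" for l r
    proof -
      have "l2 {..<M} (\<lambda>i. x' l i r) \<le> l2 {..<M} (\<lambda>i. x l i r)"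
        unfolding l2_eq_L2_set x'_def using s by (intro L2_set_mono) (auto simp: norm_mult mult_left_le_one_le)
      then show ?thesis using x[OF that] by simp
    qed
    ultimately have "norm (\<Sum>i<M. \<Sum>xs\<in>words {..<N} n. (\<Prod>l<n. x' l i (xs ! l)) * b xs) \<le> c"
      unfolding c_def by (rule multilinear_grothendieck[OF n])
    moreover have "(\<Sum>i<M. \<Sum>j\<in>J. v i j / of_real c * (of_real (s i) * of_real (t j)))
      = (\<Sum>i<M. \<Sum>xs\<in>words {..<N} n. (\<Prod>l<n. x' l i (xs ! l)) * b xs) / of_real c"
      unfolding e1 v_def b_def
      by (simp add: sum_distrib_left sum_distrib_right sum_divide_distrib sum.swap[of _ J] mult_ac)
    ultimately show "norm (\<Sum>i<M. \<Sum>j\<in>J. v i j / of_real c * (of_real (s i) * of_real (t j))) \<le> 1"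
      using c by (simp add: norm_divide)
  qed
  then have h: "hilbert_summing 1 512 {..<M} J (\<lambda>i j. v i j / of_real c)"
    using J by (intro hilbert_summing_1) auto
  show ?thesis
    unfolding hilbert_summing_def v_def[symmetric] c_def[symmetric]
  proof (intro allI impI)
    fix D :: "nat set" and y :: "'j \<Rightarrow> nat \<Rightarrow> complex"
    assume D: "finite D" and y: "\<forall>j\<in>J. l2 D (y j) \<le> 1"
    have "(\<Sum>i<M. l2 D (\<lambda>d. \<Sum>j\<in>J. v i j / of_real c * y j d) powr 1) \<le> 512"
      using y by (intro hilbert_summingD[OF h D]) auto
    moreover have "l2 D (\<lambda>d. \<Sum>j\<in>J. v i j / of_real c * y j d) = l2 D (\<lambda>d. \<Sum>j\<in>J. v i j * y j d) / c" for i
      using l2_cmult[of D "of_real (1/c)" "\<lambda>d. \<Sum>j\<in>J. v i j * y j d"] c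
      by (simp add: sum_divide_distrib norm_divide mult_ac)
    ultimately have "(\<Sum>i<M. l2 D (\<lambda>d. \<Sum>j\<in>J. v i j * y j d) / c) \<le> 512" by simp
    then show "(\<Sum>i<M. l2 D (\<lambda>d. \<Sum>j\<in>J. v i j * y j d) powr 1) \<le> 512 * c"
      using c by (simp add: sum_divide_distrib[symmetric] field_simps)
  qed
qed

subsection \<open>Complex interpolation\<close>

text \<open>The factor \<open>exp (\<epsilon> (z^2 - 1))\<close> has modulus at most 1 on the strip
  and decays along it, so the maximum principle on a large rectangle suffices; then
  \<open>\<epsilon>\<close> tends to 0.\<close>

lemma three_lines:
  assumes hol: "f holomorphic_on UNIV"
    and bdd: "\<And>z. 0 \<le> Re z \<Longrightarrow> Re z \<le> 1 \<Longrightarrow> norm (f z) \<le> B"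
    and edges: "\<And>z. Re z = 0 \<or> Re z = 1 \<Longrightarrow> norm (f z) \<le> 1"
    and z0: "0 \<le> Re z0" "Re z0 \<le> 1"
  shows "norm (f z0) \<le> 1"
proof -
  have *: "norm (f z0) * norm (exp (of_real \<epsilon> * (z0\<^sup>2 - 1))) \<le> 1" if \<epsilon>: "\<epsilon> > 0" for \<epsilon> :: real
  proof -
    define g where "g = (\<lambda>z. f z * exp (of_real \<epsilon> * (z\<^sup>2 - 1)))"
    have e: "norm (exp (of_real \<epsilon> * (z\<^sup>2 - 1))) \<le> exp (- (\<epsilon> * (Im z)\<^sup>2))" if "0 \<le> Re z" "Re z \<le> 1" for z
    proof -
      have "(Re z)\<^sup>2 \<le> 1" using that by (simp add: power_le_one)
      then have "\<epsilon> * ((Re z)\<^sup>2 - (Im z)\<^sup>2 - 1) \<le> \<epsilon> * (- (Im z)\<^sup>2)"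
        using \<epsilon> by (intro mult_left_mono) auto
      moreover have "Re (of_real \<epsilon> * (z\<^sup>2 - 1)) = \<epsilon> * ((Re z)\<^sup>2 - (Im z)\<^sup>2 - 1)"
        by (simp add: power2_eq_square)
      ultimately have "Re (of_real \<epsilon> * (z\<^sup>2 - 1)) \<le> \<epsilon> * (- (Im z)\<^sup>2)" by (simp only:)
      then show ?thesis by (simp only: norm_exp_eq_Re exp_le_cancel_iff mult_minus_right)
    qed
    have e1: "norm (exp (of_real \<epsilon> * (z\<^sup>2 - 1))) \<le> 1" if "0 \<le> Re z" "Re z \<le> 1" for z
      by (rule order_trans[OF e[OF that]]) (use \<epsilon> in simp)
    have B0: "B \<ge> 0" using bdd[OF z0] norm_ge_zero order_trans by blast
    \<comment> \<open>The rectangle contains \<open>z0\<close>, and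
      \<open>B \<le> \<epsilon> R^2 \<le> exp (\<epsilon> R^2)\<close>, so the damped function is at
      most 1 on the horizontal sides.\<close>
    define R where "R = \<bar>Im z0\<bar> + sqrt (B / \<epsilon>) + 1"
    have R: "R > 0" "\<bar>Im z0\<bar> \<le> R" using B0 \<epsilon> by (auto simp: R_def add_nonneg_pos)
    have "(sqrt (B / \<epsilon>))\<^sup>2 \<le> R\<^sup>2" using B0 \<epsilon> by (intro power_mono) (auto simp: R_def)
    then have "B \<le> \<epsilon> * R\<^sup>2" using B0 \<epsilon> by (simp add: field_simps)
    then have BR: "B \<le> exp (\<epsilon> * R\<^sup>2)" using exp_ge_add_one_self[of "\<epsilon> * R\<^sup>2"] by linarith
    define S where "S = cbox (Complex 0 (-R)) (Complex 1 R)"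
    have inS: "z \<in> S \<longleftrightarrow> 0 \<le> Re z \<and> Re z \<le> 1 \<and> \<bar>Im z\<bar> \<le> R" for z
      by (auto simp: S_def in_cbox_complex_iff)
    have "norm (g z0) \<le> 1"
    proof (rule maximum_modulus_frontier[of g S])
      show "g holomorphic_on interior S"
        unfolding g_def by (intro holomorphic_intros holomorphic_on_subset[OF hol]) auto
      have "continuous_on UNIV g"
        unfolding g_def by (intro continuous_intros holomorphic_on_imp_continuous_on hol)
      then show "continuous_on (closure S) g" by (rule continuous_on_subset) simp
      show "bounded S" by (simp add: S_def)
      show "z0 \<in> S" using z0 R by (simp add: inS)
      fix z assume "z \<in> frontier S"
      then have z: "z \<in> S" "z \<notin> box (Complex 0 (-R)) (Complex 1 R)"
        by (auto simp: S_def frontier_def interior_cbox)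
      then have zS: "0 \<le> Re z" "Re z \<le> 1" by (auto simp: inS)
      have "Re z = 0 \<or> Re z = 1 \<or> \<bar>Im z\<bar> = R"
        using z by (auto simp: inS in_box_complex_iff)
      then show "norm (g z) \<le> 1"
      proof (elim disjE)
        assume "\<bar>Im z\<bar> = R"
        then have "(Im z)\<^sup>2 = R\<^sup>2" by (metis power2_abs)
        have "norm (g z) \<le> B * exp (- (\<epsilon> * R\<^sup>2))"
          unfolding g_def norm_mult using bdd[OF zS] e[OF zS] \<open>(Im z)\<^sup>2 = R\<^sup>2\<close> B0
          by (intro mult_mono) auto
        also have "\<dots> \<le> exp (\<epsilon> * R\<^sup>2) * exp (- (\<epsilon> * R\<^sup>2))" using BR by (intro mult_right_mono) auto
        also have "\<dots> = 1" by (simp add: exp_minus_inverse)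
        finally show ?thesis .
      next
        assume "Re z = 0"
        have "norm (g z) \<le> 1 * 1" unfolding g_def norm_mult
          using edges[of z] \<open>Re z = 0\<close> e1[OF zS] by (intro mult_mono) auto
        then show ?thesis by simp
      next
        assume "Re z = 1"
        have "norm (g z) \<le> 1 * 1" unfolding g_def norm_mult
          using edges[of z] \<open>Re z = 1\<close> e1[OF zS] by (intro mult_mono) auto
        then show ?thesis by simp
      qed
    qed
    then show ?thesis by (simp add: g_def norm_mult)
  qed
  have "((\<lambda>\<epsilon>. norm (f z0) * norm (exp (of_real \<epsilon> * (z0\<^sup>2 - 1)))) \<longlongrightarrow> norm (f z0) * norm (exp (of_real 0 * (z0\<^sup>2 - 1)))) (at_right (0::real))"
    by (intro tendsto_intros)
  then have "norm (f z0) * norm (exp (of_real 0 * (z0\<^sup>2 - 1))) \<le> 1"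
    by (rule tendsto_upperbound) (use * in \<open>auto simp: eventually_at_right_less intro: eventually_at_rightI[of 0 1]\<close>)
  then show ?thesis by simp
qed

text \<open>The unit ball of \<open>\<ell>\<^bsub>1/b\<^esub>(D)\<close>, with \<open>b = 0\<close> standing for the exponent \<open>\<infinity>\<close>.\<close>

definition lball :: "real \<Rightarrow> 'd set \<Rightarrow> ('d \<Rightarrow> complex) \<Rightarrow> bool" where
  "lball b D f \<longleftrightarrow> (\<forall>d\<in>D. norm (f d) \<le> 1) \<and> (b > 0 \<longrightarrow> (\<Sum>d\<in>D. norm (f d) powr (1/b)) \<le> 1)"

lemma lballI:
  assumes "finite D" "b > 0" "(\<Sum>d\<in>D. norm (f d) powr (1/b)) \<le> 1"
  shows "lball b D f"
proof -
  have "norm (f d) \<le> 1" if "d \<in> D" for d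
  proof (rule ccontr)
    assume "\<not> norm (f d) \<le> 1"
    then have "1 < norm (f d) powr (1/b)" using assms(2) by (intro gr_one_powr) auto
    also have "\<dots> \<le> (\<Sum>d\<in>D. norm (f d) powr (1/b))" using assms(1) that by (intro member_le_sum) auto
    finally show False using assms(3) by simp
  qed
  then show ?thesis using assms by (simp add: lball_def)
qed

lemma lball_half_iff: "finite D \<Longrightarrow> lball (1/2) D f \<longleftrightarrow> l2 D f \<le> 1"
proof
  assume D: "finite D" and "l2 D f \<le> 1"
  then show "lball (1/2) D f" by (intro lballI) (auto simp: l2_le_1_iff)
qed (auto simp: lball_def l2_le_1_iff)

text \<open>Hoelder's inequality for conjugate exponents, with the pair 1 and \<infinity> included
  at both ends.\<close>

lemma lball_pairing:
  assumes D: "finite D" and b: "0 \<le> b" "b \<le> 1" and f: "lball b D f" and g: "lball (1 - b) D g"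
  shows "(\<Sum>d\<in>D. norm (f d) * norm (g d)) \<le> 1"
proof -
  consider "b = 0" | "b = 1" | "0 < b" "b < 1" using b by linarith
  then show ?thesis
  proof cases
    case 1
    have "(\<Sum>d\<in>D. norm (f d) * norm (g d)) \<le> (\<Sum>d\<in>D. norm (g d))"
      using f by (intro sum_mono mult_left_le_one_le) (auto simp: lball_def)
    then show ?thesis using g 1 by (simp add: lball_def)
  next
    case 2
    have "(\<Sum>d\<in>D. norm (f d) * norm (g d)) \<le> (\<Sum>d\<in>D. norm (f d))"
      using g by (intro sum_mono mult_right_le_one_le) (auto simp: lball_def)
    then show ?thesis using f 2 by (simp add: lball_def)
  next
    case 3
    have "norm (f d) * norm (g d) \<le> b * norm (f d) powr (1/b) + (1 - b) * norm (g d) powr (1/(1-b))" for d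
      using Youngs_inequality[of "1/b" "1/(1-b)" "norm (f d)" "norm (g d)"] 3 by (simp add: mult.commute)
    then have "(\<Sum>d\<in>D. norm (f d) * norm (g d)) \<le> (\<Sum>d\<in>D. b * norm (f d) powr (1/b) + (1 - b) * norm (g d) powr (1/(1-b)))"
      by (intro sum_mono)
    also have "\<dots> = b * (\<Sum>d\<in>D. norm (f d) powr (1/b)) + (1 - b) * (\<Sum>d\<in>D. norm (g d) powr (1/(1-b)))"
      by (simp add: sum.distrib sum_distrib_left)
    also have "\<dots> \<le> b * 1 + (1 - b) * 1"
      using f g 3 by (intro add_mono mult_left_mono) (auto simp: lball_def)
    finally show ?thesis by simp
  qed
qed

text \<open>The norming functional is written down from the equality case of Hoelder's
  inequality.\<close>

lemma lball_dual:
  assumes D: "finite D" and b: "0 < b" "b < 1"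
  obtains g where "lball (1 - b) D g"
    "(\<Sum>d\<in>D. g d * f d) = of_real ((\<Sum>d\<in>D. norm (f d) powr (1/b)) powr b)"
proof -
  define P where "P = (\<Sum>d\<in>D. norm (f d) powr (1/b))"
  have P0: "P \<ge> 0" by (simp add: P_def sum_nonneg)
  define g where "g = (\<lambda>d. cnj (sgn (f d)) * of_real (norm (f d) powr (1/b - 1) / P powr (1 - b)))"
  show ?thesis
  proof (cases "P = 0")
    case True
    then have "\<forall>d\<in>D. norm (f d) powr (1/b) = 0"
      unfolding P_def using D by (subst (asm) sum_nonneg_eq_0_iff) auto
    then show ?thesis using that[of "\<lambda>_. 0"] True by (simp add: lball_def P_def)
  next
    case False
    then have P: "P > 0" using P0 by simp
    have ng: "norm (g d) powr (1/(1-b)) \<le> norm (f d) powr (1/b) / P" for d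
    proof (cases "f d = 0")
      case False
      have "(1/b - 1) * (1/(1-b)) = 1/b" using b by (simp add: field_simps)
      moreover have "norm (g d) = norm (f d) powr (1/b - 1) / P powr (1 - b)"
        using False by (simp add: g_def norm_mult norm_divide norm_sgn)
      ultimately show ?thesis using P b by (simp add: powr_divide powr_powr)
    qed (simp add: g_def)
    have "(\<Sum>d\<in>D. norm (g d) powr (1/(1-b))) \<le> (\<Sum>d\<in>D. norm (f d) powr (1/b) / P)"
      by (intro sum_mono ng)
    also have "\<dots> = 1" using P by (simp add: sum_divide_distrib[symmetric] P_def[symmetric])
    finally have "lball (1 - b) D g" using D b by (intro lballI) auto
    moreover have "(\<Sum>d\<in>D. g d * f d) = of_real (P powr b)"
    proof -
      have "g d * f d = of_real (norm (f d) powr (1/b) / P powr (1 - b))" for d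
      proof (cases "f d = 0")
        case False
        have "cnj (sgn (f d)) * f d = of_real (norm (f d))"
          using False complex_norm_square[of "f d"] by (simp add: sgn_div_norm scaleR_conv_of_real field_simps power2_eq_square)
        moreover have "norm (f d) * norm (f d) powr (1/b - 1) = norm (f d) powr (1/b)"
          using False powr_add[of "norm (f d)" 1 "1/b - 1"] by simp
        ultimately show ?thesis unfolding g_def
          by (metis (no_types, lifting) mult.assoc mult.commute of_real_mult times_divide_eq_right)
      qed (use b in \<open>simp add: g_def\<close>)
      then have "(\<Sum>d\<in>D. g d * f d) = of_real (P / P powr (1 - b))"
        by (simp add: P_def sum_divide_distrib)
      moreover have "P / P powr (1 - b) = P powr b" using P by (simp add: powr_diff)
      ultimately show ?thesis by simp
    qed
    ultimately show ?thesis using that[of g] by (simp add: P_def)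
  qed
qed

text \<open>The phase of \<open>x\<close> times the complex power \<open>z\<close> of its modulus.
  It is entire in \<open>z\<close>, equals \<open>x\<close> at \<open>z = 1\<close>, and its modulus
  depends only on the real part of \<open>z\<close>.\<close>

definition cpw :: "complex \<Rightarrow> complex \<Rightarrow> complex" where
  "cpw z x = (if x = 0 then 0 else sgn x * exp (z * of_real (ln (norm x))))"

lemma norm_cpw: "norm (cpw z x) = norm x powr Re z"
  by (simp add: cpw_def norm_mult norm_sgn norm_exp_eq_Re powr_def)

lemma cpw_1 [simp]: "cpw 1 x = x"
  by (simp add: cpw_def exp_of_real sgn_div_norm scaleR_conv_of_real flip: of_real_mult)

lemma holomorphic_cpw: "f holomorphic_on S \<Longrightarrow> (\<lambda>z. cpw (f z) x) holomorphic_on S"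
  by (cases "x = 0") (auto simp: cpw_def intro!: holomorphic_intros)

text \<open>Raising moduli to the power \<open>Re z\<close> divides the exponent \<open>1/b\<close>
  by \<open>Re z\<close>; for \<open>Re z = 0\<close> only the sup bound remains, which is the ball
  for \<open>b = 0\<close>.\<close>

lemma lball_cpw:
  assumes "finite D" "lball b D f" "0 < b" "0 \<le> Re z"
  shows "lball (b * Re z) D (\<lambda>d. cpw z (f d))"
  unfolding lball_def norm_cpw
proof (intro conjI ballI impI)
  show "norm (f d) powr Re z \<le> 1" if "d \<in> D" for d
    using assms that by (intro powr_le1) (auto simp: lball_def)
  show "(\<Sum>d\<in>D. (norm (f d) powr Re z) powr (1 / (b * Re z))) \<le> 1" if "0 < b * Re z"
  proof -
    have "Re z \<noteq> 0" using that by auto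
    then show ?thesis using assms by (simp add: powr_powr lball_def)
  qed
qed

text \<open>\<open>A\<close> and \<open>B\<close> are reciprocal exponents. The families
  \<open>\<gamma>\<close>, \<open>h\<close> and \<open>t\<close> are deformed together so that at
  real part \<open>l\<close> they lie in the balls belonging to \<open>A l\<close> and
  \<open>B l\<close>. On the edges the hypothesis \<open>ends\<close> therefore applies for every
  imaginary part, and at \<open>\<theta>\<close> the deformation is trivial.\<close>

lemma interpolation:
  fixes c :: "'i \<Rightarrow> 'j \<Rightarrow> complex"
  assumes fin: "finite I" "finite J" "finite D"
    and ends: "\<And>l \<gamma> h t. l = 0 \<or> l = 1 \<Longrightarrow> lball (1 - B l) I \<gamma> \<Longrightarrow> (\<And>i. i \<in> I \<Longrightarrow> lball (1 - A l) D (h i)) \<Longrightarrow>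
       (\<And>j. j \<in> J \<Longrightarrow> lball (A l) D (t j)) \<Longrightarrow>
       norm (\<Sum>i\<in>I. \<Sum>d\<in>D. \<Sum>j\<in>J. \<gamma> i * (h i d * (c i j * t j d))) \<le> 1"
    and A: "A = (\<lambda>z. (1 - z) * a0 + z * a1)" and B: "B = (\<lambda>z. (1 - z) * b0 + z * b1)"
    and rng: "0 \<le> a0" "a0 \<le> 1" "0 \<le> a1" "a1 \<le> 1" "0 \<le> b0" "b0 \<le> 1" "0 \<le> b1" "b1 \<le> 1"
    and \<theta>: "0 \<le> \<theta>" "\<theta> \<le> 1" and int: "0 < A \<theta>" "A \<theta> < 1" "0 < B \<theta>" "B \<theta> < (1::real)"
    and \<gamma>: "lball (1 - B \<theta>) I \<gamma>" and h: "\<And>i. i \<in> I \<Longrightarrow> lball (1 - A \<theta>) D (h i)"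
    and t: "\<And>j. j \<in> J \<Longrightarrow> lball (A \<theta>) D (t j)"
  shows "norm (\<Sum>i\<in>I. \<Sum>d\<in>D. \<Sum>j\<in>J. \<gamma> i * (h i d * (c i j * t j d))) \<le> 1"
proof -
  define AA where "AA = (\<lambda>z. (1 - z) * of_real a0 + z * of_real a1 :: complex)"
  define BB where "BB = (\<lambda>z. (1 - z) * of_real b0 + z * of_real b1 :: complex)"
  define f where "f = (\<lambda>z. \<Sum>i\<in>I. \<Sum>d\<in>D. \<Sum>j\<in>J. cpw ((1 - BB z) / of_real (1 - B \<theta>)) (\<gamma> i) *
      (cpw ((1 - AA z) / of_real (1 - A \<theta>)) (h i d) * (c i j * cpw (AA z / of_real (A \<theta>)) (t j d))))"
  have ReA: "Re (AA z) = A (Re z)" and ReB: "Re (BB z) = B (Re z)" for z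
    by (simp_all add: AA_def BB_def A B)
  have Rng: "0 \<le> A x \<and> A x \<le> 1 \<and> 0 \<le> B x \<and> B x \<le> 1" if "0 \<le> x" "x \<le> 1" for x
    using rng that unfolding A B by (auto intro!: convex_bound_le)
  have Re1: "Re ((1 - BB z) / of_real (1 - B \<theta>)) = (1 - B (Re z)) / (1 - B \<theta>)"
    and Re2: "Re ((1 - AA z) / of_real (1 - A \<theta>)) = (1 - A (Re z)) / (1 - A \<theta>)"
    and Re3: "Re (AA z / of_real (A \<theta>)) = A (Re z) / A \<theta>" for z
    unfolding Re_divide_of_real by (simp_all add: ReA ReB)
  have lb: "lball (1 - B (Re z)) I (\<lambda>i. cpw ((1 - BB z) / of_real (1 - B \<theta>)) (\<gamma> i))"
    "\<And>i. i \<in> I \<Longrightarrow> lball (1 - A (Re z)) D (\<lambda>d. cpw ((1 - AA z) / of_real (1 - A \<theta>)) (h i d))"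
    "\<And>j. j \<in> J \<Longrightarrow> lball (A (Re z)) D (\<lambda>d. cpw (AA z / of_real (A \<theta>)) (t j d))"
    if "0 \<le> Re z" "Re z \<le> 1" for z
    using Rng[OF that] int lball_cpw[OF fin(1) \<gamma>, of "(1 - BB z) / of_real (1 - B \<theta>)"]
      lball_cpw[OF fin(3) h, of _ "(1 - AA z) / of_real (1 - A \<theta>)"]
      lball_cpw[OF fin(3) t, of _ "AA z / of_real (A \<theta>)"]
    unfolding Re1 Re2 Re3 by auto
  have "norm (f (of_real \<theta>)) \<le> 1"
  proof (rule three_lines[where f = f])
    show "f holomorphic_on UNIV"
      unfolding f_def AA_def BB_def using int by (intro holomorphic_intros holomorphic_cpw) auto
    show "norm (f z) \<le> (\<Sum>i\<in>I. \<Sum>d\<in>D. \<Sum>j\<in>J. norm (c i j))" if "0 \<le> Re z" "Re z \<le> 1" for z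
      unfolding f_def
    proof (intro sum_norm_le)
      fix i d j assume "i \<in> I" "d \<in> D" "j \<in> J"
      then have "norm (cpw ((1 - BB z) / of_real (1 - B \<theta>)) (\<gamma> i)) \<le> 1"
        "norm (cpw ((1 - AA z) / of_real (1 - A \<theta>)) (h i d)) \<le> 1"
        "norm (cpw (AA z / of_real (A \<theta>)) (t j d)) \<le> 1"
        using lb[OF that] by (auto simp: lball_def)
      then have "norm (cpw ((1 - BB z) / of_real (1 - B \<theta>)) (\<gamma> i)) * (norm (cpw ((1 - AA z) / of_real (1 - A \<theta>)) (h i d)) *
        (norm (c i j) * norm (cpw (AA z / of_real (A \<theta>)) (t j d)))) \<le> 1 * (1 * (norm (c i j) * 1))"
        by (intro mult_mono) auto
      then show "norm (cpw ((1 - BB z) / of_real (1 - B \<theta>)) (\<gamma> i) *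
        (cpw ((1 - AA z) / of_real (1 - A \<theta>)) (h i d) * (c i j * cpw (AA z / of_real (A \<theta>)) (t j d)))) \<le> norm (c i j)"
        by (simp add: norm_mult)
    qed
    show "norm (f z) \<le> 1" if "Re z = 0 \<or> Re z = 1" for z
      unfolding f_def using that by (intro ends[of "Re z"] lb) auto
  qed (use \<theta> in auto)
  moreover have "(1 - BB (of_real \<theta>)) / of_real (1 - B \<theta>) = 1" "(1 - AA (of_real \<theta>)) / of_real (1 - A \<theta>) = 1"
     "AA (of_real \<theta>) / of_real (A \<theta>) = 1"
  proof -
    have "AA (of_real \<theta>) = of_real (A \<theta>)" "1 - AA (of_real \<theta>) = of_real (1 - A \<theta>)" "1 - BB (of_real \<theta>) = of_real (1 - B \<theta>)"
      by (simp_all add: AA_def BB_def A B)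
    moreover have "1 - B \<theta> \<noteq> 0" "1 - A \<theta> \<noteq> 0" "A \<theta> \<noteq> 0" using int by auto
    ultimately show "(1 - BB (of_real \<theta>)) / of_real (1 - B \<theta>) = 1" "(1 - AA (of_real \<theta>)) / of_real (1 - A \<theta>) = 1"
     "AA (of_real \<theta>) / of_real (A \<theta>) = 1"
      by (simp_all only: divide_self of_real_eq_0_iff not_False_eq_True)
  qed
  ultimately show ?thesis by (simp add: f_def)
qed

text \<open>Interpolation with the trivial estimate by absolute row sums, which holds both for
  \<open>\<ell>\<^sub>1\<close> and for \<open>\<ell>\<^sub>\<infinity>\<close>; the first is used for \<open>p < 2\<close>, the second for \<open>p > 2\<close>.\<close>

lemma interpolated_summing:
  fixes c :: "'i \<Rightarrow> 'j \<Rightarrow> complex" and D :: "nat set"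
  assumes fin: "finite I" "finite J" "finite D" and C: "C > 0"
    and row: "lball b0 I (\<lambda>i. of_real ((\<Sum>j\<in>J. norm (c i j)) / C))"
    and hil: "hilbert_summing (1 / b1) (C powr (1 / b1)) I J c"
    and b: "0 \<le> b0" "b0 \<le> 1" "0 < b1" "b1 \<le> 1" and p: "1 < p"
    and \<theta>: "\<theta> = (if p \<le> 2 then 2 - 2 / p else 2 / p)" and bt: "bt = (1 - \<theta>) * b0 + \<theta> * b1"
    and btr: "0 < bt" "bt < 1 \<or> p = 2"
    and t: "\<And>j. j \<in> J \<Longrightarrow> (\<Sum>d\<in>D. norm (t j d) powr p) \<le> 1"
  shows "(\<Sum>i\<in>I. (\<Sum>d\<in>D. norm (\<Sum>j\<in>J. c i j * t j d) powr p) powr (1 / (p * bt))) \<le> C powr (1 / bt)"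
proof (cases "p = 2")
  case True
  then have "bt = b1" using bt \<theta> by simp
  moreover have "(\<Sum>i\<in>I. l2 D (\<lambda>d. \<Sum>j\<in>J. c i j * t j d) powr (1 / b1)) \<le> C powr (1 / b1)"
    using t True by (intro hilbert_summingD[OF hil fin(3)]) (simp add: l2_le_1_iff)
  moreover have "(\<Sum>d\<in>D. norm (\<Sum>j\<in>J. c i j * t j d) powr p) powr (1 / (p * b1)) = l2 D (\<lambda>d. \<Sum>j\<in>J. c i j * t j d) powr (1 / b1)" for i
    unfolding l2_def by (simp add: True powr_half_sqrt[symmetric] powr_powr sum_nonneg)
  ultimately show ?thesis by simp
next
  case False
  \<comment> \<open>The end away from 2 has target l1 for \<open>p < 2\<close> and the sup norm for
    \<open>p > 2\<close>; \<open>\<theta>\<close> is the parameter with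
    \<open>A \<theta> = 1/p\<close>.\<close>
  define a0 :: real where "a0 = (if p \<le> 2 then 1 else 0)"
  define A where "A = (\<lambda>z. (1 - z) * a0 + z * (1/2))"
  define B where "B = (\<lambda>z. (1 - z) * b0 + z * b1)"
  have \<theta>01: "0 < \<theta>" "\<theta> < 1" using p False by (auto simp: \<theta> field_simps)
  have A\<theta>: "A \<theta> = 1 / p" by (simp add: A_def a0_def \<theta> field_simps)
  have B\<theta>: "B \<theta> = bt" by (simp add: B_def bt)
  define Y where "Y = (\<lambda>i d. \<Sum>j\<in>J. c i j * t j d)"
  define N where "N = (\<lambda>i. (\<Sum>d\<in>D. norm (Y i d) powr p) powr (1/p))"
  have "\<exists>h. lball (1 - 1/p) D h \<and> (\<Sum>d\<in>D. h d * Y i d) = of_real (N i)" for i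
  proof -
    have "0 < 1 / p" "1 / p < 1" using p by auto
    from lball_dual[OF fin(3) this, of "Y i"] obtain g where "lball (1 - 1/p) D g"
      "(\<Sum>d\<in>D. g d * Y i d) = of_real ((\<Sum>d\<in>D. norm (Y i d) powr (1/(1/p))) powr (1/p))" .
    then show ?thesis by (auto simp: N_def)
  qed
  then obtain h where h: "\<And>i. lball (1 - 1/p) D (h i)" "\<And>i. (\<Sum>d\<in>D. h i d * Y i d) = of_real (N i)" by metis
  obtain \<gamma> where \<gamma>: "lball (1 - bt) I \<gamma>" "(\<Sum>i\<in>I. \<gamma> i * of_real (N i)) = of_real ((\<Sum>i\<in>I. norm (complex_of_real (N i)) powr (1/bt)) powr bt)"
  proof -
    have "bt < 1" using btr False by simp
    from lball_dual[OF fin(1) btr(1) this, of "\<lambda>i. complex_of_real (N i)"] that show ?thesis .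
  qed
  have "norm (\<Sum>i\<in>I. \<Sum>d\<in>D. \<Sum>j\<in>J. \<gamma> i * (h i d * (c i j / of_real C * t j d))) \<le> 1"
  proof (rule interpolation[OF fin _ A_def B_def, where \<theta> = \<theta>])
    fix l :: real and \<gamma> h t
    assume l: "l = 0 \<or> l = 1" and \<gamma>: "lball (1 - B l) I \<gamma>" and h: "\<And>i. i \<in> I \<Longrightarrow> lball (1 - A l) D (h i)"
      and t: "\<And>j. j \<in> J \<Longrightarrow> lball (A l) D (t j)"
    show "norm (\<Sum>i\<in>I. \<Sum>d\<in>D. \<Sum>j\<in>J. \<gamma> i * (h i d * (c i j / of_real C * t j d))) \<le> 1"
      using l
    proof
      \<comment> \<open>At this end the pairing of each \<open>t j\<close> with each
        \<open>h i\<close> is at most 1, so only the absolute row sums of \<open>c\<close> remain,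
        paired with \<open>\<gamma>\<close>.\<close>
      assume l: "l = 0"
      have bl: "B l = b0" "A l = a0" by (simp_all add: l A_def B_def)
      have ht: "(\<Sum>d\<in>D. norm (t j d) * norm (h i d)) \<le> 1" if "i \<in> I" "j \<in> J" for i j
        using h[OF that(1)] t[OF that(2)] fin unfolding bl
        by (intro lball_pairing[of D a0]) (auto simp: a0_def)
      have "norm (\<Sum>i\<in>I. \<Sum>d\<in>D. \<Sum>j\<in>J. \<gamma> i * (h i d * (c i j / of_real C * t j d)))
        \<le> (\<Sum>i\<in>I. \<Sum>d\<in>D. \<Sum>j\<in>J. norm (\<gamma> i) * (norm (c i j) / C) * (norm (t j d) * norm (h i d)))"
        using C by (intro sum_norm_le) (simp add: norm_mult norm_divide mult_ac)
      also have "\<dots> = (\<Sum>i\<in>I. \<Sum>j\<in>J. norm (\<gamma> i) * (norm (c i j) / C) * (\<Sum>d\<in>D. norm (t j d) * norm (h i d)))"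
        unfolding sum_distrib_left by (simp add: sum.swap[of _ D])
      also have "\<dots> \<le> (\<Sum>i\<in>I. \<Sum>j\<in>J. norm (\<gamma> i) * (norm (c i j) / C) * 1)"
        using C ht by (intro sum_mono mult_left_mono) auto
      also have "\<dots> = (\<Sum>i\<in>I. norm (complex_of_real ((\<Sum>j\<in>J. norm (c i j)) / C)) * norm (\<gamma> i))"
        unfolding norm_of_real using C
        by (simp add: abs_of_nonneg sum_nonneg sum_distrib_left sum_distrib_right sum_divide_distrib mult_ac)
      also have "\<dots> \<le> 1" using \<gamma> row b fin unfolding bl by (intro lball_pairing[of I b0]) auto
      finally show ?thesis .
    next
      assume l: "l = 1"
      have bl: "B l = b1" "A l = 1/2" by (simp_all add: l A_def B_def)
      define y where "y = (\<lambda>i d. \<Sum>j\<in>J. c i j * t j d)"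
      have y: "(\<Sum>i\<in>I. l2 D (y i) powr (1 / b1)) \<le> C powr (1 / b1)"
        unfolding y_def using t fin bl by (intro hilbert_summingD[OF hil fin(3)]) (simp add: lball_half_iff)
      have yl: "lball b1 I (\<lambda>i. of_real (l2 D (y i) / C))"
      proof (rule lballI)
        have "(\<Sum>i\<in>I. norm (complex_of_real (l2 D (y i) / C)) powr (1 / b1)) = (\<Sum>i\<in>I. l2 D (y i) powr (1 / b1)) / C powr (1 / b1)"
          using C by (simp add: norm_divide powr_divide sum_divide_distrib)
        also have "\<dots> \<le> 1" using y C by simp
        finally show "(\<Sum>i\<in>I. norm (complex_of_real (l2 D (y i) / C)) powr (1 / b1)) \<le> 1" .
      qed (use fin b in auto)
      have "(\<Sum>i\<in>I. \<Sum>d\<in>D. \<Sum>j\<in>J. \<gamma> i * (h i d * (c i j / of_real C * t j d))) = (\<Sum>i\<in>I. \<gamma> i / of_real C * (\<Sum>d\<in>D. h i d * y i d))"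
        unfolding y_def by (simp add: sum_distrib_left mult_ac)
      also have "norm \<dots> \<le> (\<Sum>i\<in>I. norm (complex_of_real (l2 D (y i) / C)) * norm (\<gamma> i))"
      proof (rule sum_norm_le)
        fix i assume i: "i \<in> I"
        have "l2 D (h i) \<le> 1" using h[OF i] fin unfolding bl by (simp add: lball_half_iff)
        then have "l2 D (h i) * l2 D (y i) \<le> 1 * l2 D (y i)" by (intro mult_right_mono) auto
        then have "norm (\<Sum>d\<in>D. h i d * y i d) \<le> l2 D (y i)" using l2_CS[of "h i" "y i" D] by simp
        then have "norm (\<gamma> i) / C * norm (\<Sum>d\<in>D. h i d * y i d) \<le> norm (\<gamma> i) / C * l2 D (y i)"
          using C by (intro mult_left_mono) auto
        then show "norm (\<gamma> i / of_real C * (\<Sum>d\<in>D. h i d * y i d)) \<le> norm (complex_of_real (l2 D (y i) / C)) * norm (\<gamma> i)"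
          unfolding norm_of_real using C by (simp add: norm_mult norm_divide abs_of_nonneg mult_ac)
      qed
      also have "\<dots> \<le> 1" using \<gamma> yl b fin unfolding bl by (intro lball_pairing[of I b1]) auto
      finally show ?thesis .
    qed
  next
    show "lball (1 - B \<theta>) I \<gamma>" using \<gamma>(1) B\<theta> by simp
    show "lball (1 - A \<theta>) D (h i)" for i using h(1) A\<theta> by simp
    show "lball (A \<theta>) D (t j)" if "j \<in> J" for j unfolding A\<theta> using t[OF that] p fin by (intro lballI) auto
  qed (use b \<theta>01 p btr False in \<open>auto simp: a0_def A\<theta> B\<theta>\<close>)
  also have "(\<Sum>i\<in>I. \<Sum>d\<in>D. \<Sum>j\<in>J. \<gamma> i * (h i d * (c i j / of_real C * t j d))) = (\<Sum>i\<in>I. \<gamma> i * (\<Sum>d\<in>D. h i d * Y i d)) / of_real C"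
    unfolding Y_def by (simp add: sum_distrib_left sum_divide_distrib mult_ac)
  also have "\<dots> = of_real ((\<Sum>i\<in>I. N i powr (1/bt)) powr bt / C)"
    unfolding h(2) \<gamma>(2) by (simp add: N_def)
  finally have "(\<Sum>i\<in>I. N i powr (1/bt)) powr bt \<le> C"
    using C by (simp add: norm_divide del: of_real_sum)
  then have "((\<Sum>i\<in>I. N i powr (1/bt)) powr bt) powr (1/bt) \<le> C powr (1/bt)"
    using btr by (intro powr_mono2) auto
  then have "(\<Sum>i\<in>I. N i powr (1/bt)) \<le> C powr (1/bt)"
    using btr by (simp add: powr_powr sum_nonneg)
  then show ?thesis by (simp add: N_def Y_def powr_powr)
qed

section \<open>Finite forms of the two summability theorems\<close>

lemma sum_norm_prod_words:
  fixes u :: "nat \<Rightarrow> 'i \<Rightarrow> 'j \<Rightarrow> complex"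
  shows "(\<Sum>js\<in>words J m. norm (\<Prod>k<m. u k (is ! k) (js ! k))) = (\<Prod>k<m. \<Sum>j\<in>J. norm (u k (is ! k) j))"
  unfolding prod_norm[symmetric] by (rule sum_prod_words[of "\<lambda>k j. norm (u k (is ! k) j)"])

text \<open>The ends of the interpolation are \<open>b0 = 1/2\<close>, from the cotype estimate for
  absolute row sums, and \<open>b1 = (n + 1)/(2n)\<close>, from the Hilbert space estimate. Both
  pass to the product of \<open>m\<close> matrices, and \<open>C\<close> is chosen to serve both
  ends.\<close>

lemma multiple_summing_finite:
  fixes a :: "nat \<Rightarrow> nat list \<Rightarrow> nat \<Rightarrow> complex" and D :: "nat set"
  assumes n: "n \<ge> 1" and p: "1 < p" and fin: "finite J" "finite D"
    and a: "\<And>k. k < m \<Longrightarrow> tensor_bounded n {..<N} J (a k)"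
    and \<theta>: "\<theta> = (if p \<le> 2 then 2 - 2 / p else 2 / p)" and r: "1 / r = 1/2 + \<theta> / (2 * real n)"
    and t: "\<And>js. js \<in> words J m \<Longrightarrow> (\<Sum>d\<in>D. norm (t js d) powr p) \<le> 1"
  shows "(\<Sum>is\<in>words (words {..<N} n) m.
      (\<Sum>d\<in>D. norm (\<Sum>js\<in>words J m. (\<Prod>k<m. a k (is ! k) (js ! k)) * t js d) powr p) powr (r / p))
    \<le> (2 ^ (n * m) + blei_const n ^ m) powr r"
proof -
  define I where "I = words (words {..<N} n) m"
  define c where "c = (\<lambda>is js. \<Prod>k<m. a k (is ! k) (js ! k))"
  define C where "C = 2 ^ (n * m) + blei_const n ^ m"
  define b1 where "b1 = (real n + 1) / (2 * real n)"
  define bt where "bt = 1/2 + \<theta> / (2 * real n)"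
  have \<theta>01: "0 < \<theta>" "\<theta> \<le> 1" "\<theta> < 1 \<or> p = 2" using p by (auto simp: \<theta> field_simps)
  have K1: "1 \<le> blei_const n ^ m" using blei_const_ge_1[of n] by simp
  have C1: "C \<ge> 1" "blei_const n ^ m \<le> C" "2 ^ (n * m) \<le> C" using K1 by (auto simp: C_def add_increasing)
  have b1: "0 < b1" "b1 \<le> 1" using n by (auto simp: b1_def field_simps)
  have bt0: "0 < bt" "bt = (1 - \<theta>) * (1/2) + \<theta> * b1" "bt < 1 \<or> p = 2"
  proof -
    show "0 < bt" using \<theta>01 by (simp add: bt_def add_pos_nonneg)
    show "bt = (1 - \<theta>) * (1/2) + \<theta> * b1" using n by (simp add: bt_def b1_def field_simps)
    have "\<theta> / (2 * real n) \<le> \<theta> / 2" using n \<theta>01 by (intro divide_left_mono) auto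
    then show "bt < 1 \<or> p = 2" using \<theta>01 by (auto simp: bt_def)
  qed
  have fI: "finite I" by (simp add: I_def finite_words)
  have "hilbert_summing (2 * real n / (real n + 1)) (blei_const n ^ m) I (words J m) c"
    unfolding I_def c_def using fin n a blei_const_ge_1[of n]
    by (intro hilbert_summing_words tensor_hilbert_summing) (auto simp: finite_words field_simps)
  moreover have "2 * real n / (real n + 1) = 1 / b1" by (simp add: b1_def)
  moreover have "blei_const n ^ m \<le> C powr (1 / b1)"
  proof -
    have "C powr 1 \<le> C powr (1 / b1)" using C1 b1 by (intro powr_mono) auto
    then show ?thesis using C1 by simp
  qed
  ultimately have hil: "hilbert_summing (1 / b1) (C powr (1 / b1)) I (words J m) c"
    using hilbert_summing_mono by metis
  have row: "lball (1/2) I (\<lambda>is. of_real ((\<Sum>js\<in>words J m. norm (c is js)) / C))"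
  proof (subst lball_half_iff[OF fI], unfold l2_le_1_iff)
    have "(\<Sum>is\<in>I. (\<Sum>js\<in>words J m. norm (c is js))\<^sup>2) = (\<Sum>is\<in>I. \<Prod>k<m. (\<Sum>j\<in>J. norm (a k (is ! k) j))\<^sup>2)"
      by (simp add: c_def sum_norm_prod_words prod_power_distrib)
    also have "\<dots> = (\<Prod>k<m. \<Sum>xs\<in>words {..<N} n. (\<Sum>j\<in>J. norm (a k xs j))\<^sup>2)"
      unfolding I_def by (rule sum_prod_words)
    also have "\<dots> \<le> (\<Prod>k<m. 4 ^ n)"
      using a fin by (intro prod_mono) (auto intro!: tensor_cotype sum_nonneg)
    also have "\<dots> = (2 ^ (n * m))\<^sup>2" by (simp add: power_mult power2_eq_square flip: power_mult_distrib)
    also have "\<dots> \<le> C\<^sup>2" using C1 by (intro power_mono) auto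
    finally show "(\<Sum>is\<in>I. (norm (complex_of_real ((\<Sum>js\<in>words J m. norm (c is js)) / C)))\<^sup>2) \<le> 1"
      using C1 by (simp only: norm_of_real power2_abs power_divide sum_divide_distrib[symmetric]) simp
  qed
  have "(\<Sum>is\<in>I. (\<Sum>d\<in>D. norm (\<Sum>js\<in>words J m. c is js * t js d) powr p) powr (1 / (p * bt))) \<le> C powr (1 / bt)"
    using C1 b1 bt0 p t fin by (intro interpolated_summing[OF fI _ fin(2) _ row hil _ _ _ _ p \<theta>]) (auto simp: finite_words)
  moreover have "1 / bt = r" using r by (simp add: bt_def[symmetric]) (metis inverse_eq_divide inverse_inverse_eq)
  then have "1 / (p * bt) = r / p" "1 / bt = r" by auto
  ultimately show ?thesis by (simp add: I_def c_def C_def)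
qed

text \<open>In dimension one the vectors may be the conjugate phases of the entries of row
  \<open>i\<close>, and then the norm of the image is the absolute row sum. The predicate
  \<open>Q\<close> lets any bound on the former be read as a bound on the latter.\<close>

lemma hilbert_summing_row_bound:
  fixes u :: "'i \<Rightarrow> 'j \<Rightarrow> complex"
  assumes y: "\<And>(D::nat set) y. finite D \<Longrightarrow> (\<forall>j\<in>J. l2 D (y j) \<le> 1) \<Longrightarrow> Q (l2 D (\<lambda>d. \<Sum>j\<in>J. u i j * y j d))"
  shows "Q (\<Sum>j\<in>J. norm (u i j))"
proof -
  define y where "y = (\<lambda>j (d::nat). cnj (sgn (u i j)))"
  have "l2 {0} (y j) \<le> 1" for j by (simp add: l2_def y_def norm_sgn)
  then have "Q (l2 {0} (\<lambda>d. \<Sum>j\<in>J. u i j * y j d))" by (intro assms) auto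
  also have "(\<Sum>j\<in>J. u i j * y j d) = of_real (\<Sum>j\<in>J. norm (u i j))" for d
    unfolding of_real_sum
  proof (intro sum.cong refl)
    fix j show "u i j * y j d = of_real (norm (u i j))"
      using complex_norm_square[of "u i j"]
      by (cases "u i j = 0") (simp_all add: y_def sgn_div_norm scaleR_conv_of_real field_simps power2_eq_square)
  qed
  then have "l2 {0::nat} (\<lambda>d. \<Sum>j\<in>J. u i j * y j d) = (\<Sum>j\<in>J. norm (u i j))"
    unfolding l2_def by (simp add: sum_nonneg del: of_real_sum)
  finally show ?thesis .
qed

text \<open>The factorisation for \<open>r = 1\<close>, with the row estimate read off from a single
  term of the weighted sum. Where \<open>l i = 0\<close> the quotient is 0 by convention, and the
  vanishing of the row gives the estimate instead.\<close>

lemma hilbert_summing_1_weights: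
  fixes u :: "'i \<Rightarrow> 'j \<Rightarrow> complex"
  assumes fin: "finite I" "finite J" and u: "hilbert_summing 1 K I J u"
  shows "\<exists>l. (\<forall>i. 0 \<le> l i) \<and> (\<Sum>i\<in>I. l i) \<le> K \<and> (\<forall>i\<in>I. (\<Sum>j\<in>J. norm (u i j))\<^sup>2 \<le> K * l i) \<and>
    (\<forall>(D::nat set) y. finite D \<longrightarrow> (\<forall>j\<in>J. l2 D (y j) \<le> 1) \<longrightarrow>
       (\<Sum>i\<in>I. (l2 D (\<lambda>d. \<Sum>j\<in>J. u i j * y j d))\<^sup>2 / l i) \<le> K)"
proof -
  have "(1::real) < 2" by simp
  from maurey_factorisation[OF fin zero_less_one this u]
  obtain l where l0: "\<forall>i. 0 \<le> l i" and l1: "(\<Sum>i\<in>I. l i powr 1) \<le> K"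
    and l2: "\<forall>(D::nat set) y. finite D \<longrightarrow> (\<forall>j\<in>J. l2 D (y j) \<le> 1) \<longrightarrow>
       (\<forall>i\<in>I. l i = 0 \<longrightarrow> l2 D (\<lambda>d. \<Sum>j\<in>J. u i j * y j d) = 0) \<and>
       (\<Sum>i\<in>I. l i powr (1 - 2) * (l2 D (\<lambda>d. \<Sum>j\<in>J. u i j * y j d))\<^sup>2) \<le> K"
    .
  have e: "l i powr (1 - 2) * q = q / l i" for i q using l0[rule_format, of i] by (simp add: powr_minus_divide)
  have 4: "(\<Sum>i\<in>I. (l2 D (\<lambda>d. \<Sum>j\<in>J. u i j * y j d))\<^sup>2 / l i) \<le> K" if "finite D" "\<forall>j\<in>J. l2 D (y j) \<le> 1" for D :: "nat set" and y
    using l2[rule_format, of D y] that unfolding e by blast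
  have 3: "(\<Sum>j\<in>J. norm (u i j))\<^sup>2 \<le> K * l i" if i: "i \<in> I" for i
  proof (rule hilbert_summing_row_bound[where Q = "\<lambda>q. q\<^sup>2 \<le> K * l i"])
    fix D :: "nat set" and y :: "'j \<Rightarrow> nat \<Rightarrow> complex" assume Dy: "finite D" "\<forall>j\<in>J. l2 D (y j) \<le> 1"
    have "(l2 D (\<lambda>d. \<Sum>j\<in>J. u i j * y j d))\<^sup>2 / l i \<le> (\<Sum>i\<in>I. (l2 D (\<lambda>d. \<Sum>j\<in>J. u i j * y j d))\<^sup>2 / l i)"
      using fin i l0 by (intro member_le_sum) auto
    also have "\<dots> \<le> K" using 4[OF Dy] .
    finally show "(l2 D (\<lambda>d. \<Sum>j\<in>J. u i j * y j d))\<^sup>2 \<le> K * l i"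
      using l2[rule_format, OF Dy(1), of y] Dy(2) i l0[rule_format, of i]
      by (cases "l i = 0") (auto simp: field_simps)
  qed
  show ?thesis using l0 l1 3 4 by (intro exI[of _ l]) simp
qed

text \<open>Each squared absolute row sum is at most \<open>K\<close> times its weight, and the
  weights sum to at most \<open>K\<close>.\<close>

lemma rows_square_summable:
  fixes u :: "'i \<Rightarrow> 'j \<Rightarrow> complex"
  assumes fin: "finite I" "finite J" and u: "hilbert_summing 1 K I J u" and K: "0 \<le> K"
  shows "(\<Sum>i\<in>I. (\<Sum>j\<in>J. norm (u i j))\<^sup>2) \<le> K\<^sup>2"
proof -
  obtain l where l: "\<forall>i. 0 \<le> l i" "(\<Sum>i\<in>I. l i) \<le> K" "\<forall>i\<in>I. (\<Sum>j\<in>J. norm (u i j))\<^sup>2 \<le> K * l i"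
    using hilbert_summing_1_weights[OF fin u] by blast
  have "(\<Sum>i\<in>I. (\<Sum>j\<in>J. norm (u i j))\<^sup>2) \<le> (\<Sum>i\<in>I. K * l i)" using l by (intro sum_mono) auto
  also have "\<dots> \<le> K * K" unfolding sum_distrib_left[symmetric] using l K by (intro mult_left_mono) auto
  finally show ?thesis by (simp add: power2_eq_square)
qed

text \<open>Dividing row \<open>i\<close> of every matrix by \<open>sqrt (\<Lambda> i)\<close> leaves matrices to which interpolation between
  \<open>\<ell>\<^sub>\<infinity>\<close> and \<open>\<ell>\<^sub>2\<close> applies; the factors \<open>\<Lambda> i\<^bsup>m/2\<^esup>\<close> account for the exponent \<open>m/2\<close> in \<open>1/r\<close>.\<close>

lemma absolutely_summing_finite:
  fixes u :: "nat \<Rightarrow> nat \<Rightarrow> nat \<Rightarrow> complex" and D :: "nat set"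
  assumes m: "m \<ge> 1" and p: "1 < p" and fin: "finite J" "finite D" and K: "K \<ge> 1"
    and u: "\<And>k. k < m \<Longrightarrow> hilbert_summing 1 K {..<M} J (u k)"
    and \<theta>: "\<theta> = (if p \<le> 2 then 2 - 2 / p else 2 / p)" and r: "1 / r = real m / 2 + \<theta> / 2"
    and t: "\<And>js. js \<in> words J m \<Longrightarrow> (\<Sum>d\<in>D. norm (t js d) powr p) \<le> 1"
  shows "(\<Sum>i<M. (\<Sum>d\<in>D. norm (\<Sum>js\<in>words J m. (\<Prod>k<m. u k i (js ! k)) * t js d) powr p) powr (r / p))
    \<le> (real m * K) powr (real m * r / 2) * (sqrt K ^ m) powr r"
proof -
  have "\<forall>k<m. \<exists>l. (\<forall>i. 0 \<le> l i) \<and> (\<Sum>i<M. l i) \<le> K \<and> (\<forall>i\<in>{..<M}. (\<Sum>j\<in>J. norm (u k i j))\<^sup>2 \<le> K * l i) \<and>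
    (\<forall>(D::nat set) y. finite D \<longrightarrow> (\<forall>j\<in>J. l2 D (y j) \<le> 1) \<longrightarrow>
       (\<Sum>i<M. (l2 D (\<lambda>d. \<Sum>j\<in>J. u k i j * y j d))\<^sup>2 / l i) \<le> K)"
    (is "\<forall>k<m. \<exists>l. ?P k l")
    using hilbert_summing_1_weights[OF finite_lessThan fin(1) u] by (intro allI impI)
  then have "\<forall>k. \<exists>l. k < m \<longrightarrow> ?P k l" by (simp only: ex_simps)
  from choice[OF this] obtain l where "\<forall>k<m. ?P k (l k)" by (elim exE)
  then have l0: "\<And>k i. k < m \<Longrightarrow> 0 \<le> l k i" and l1: "\<And>k. k < m \<Longrightarrow> (\<Sum>i<M. l k i) \<le> K"
    and lrow: "\<And>k i. k < m \<Longrightarrow> i < M \<Longrightarrow> (\<Sum>j\<in>J. norm (u k i j))\<^sup>2 \<le> K * l k i"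
    and lhil: "\<And>k (D::nat set) y. k < m \<Longrightarrow> finite D \<Longrightarrow> \<forall>j\<in>J. l2 D (y j) \<le> 1 \<Longrightarrow>
      (\<Sum>i<M. (l2 D (\<lambda>d. \<Sum>j\<in>J. u k i j * y j d))\<^sup>2 / l k i) \<le> K"
    by blast+
  \<comment> \<open>One weight dominating those of all \<open>m\<close> matrices, so that the
    product of the matrices loses the single factor \<open>sqrt (\<Lambda> i) ^ m\<close>.\<close>
  define \<Lambda> where "\<Lambda> = (\<lambda>i. \<Sum>k<m. l k i)"
  have \<Lambda>0: "0 \<le> \<Lambda> i" for i using l0 by (auto simp: \<Lambda>_def intro: sum_nonneg)
  have l\<Lambda>: "l k i \<le> \<Lambda> i" if "k < m" for k i
    unfolding \<Lambda>_def using l0 that by (intro member_le_sum) auto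
  have sum\<Lambda>: "(\<Sum>i<M. \<Lambda> i) \<le> real m * K"
  proof -
    have "(\<Sum>i<M. \<Lambda> i) = (\<Sum>k<m. \<Sum>i<M. l k i)" unfolding \<Lambda>_def by (rule sum.swap)
    also have "\<dots> \<le> (\<Sum>k<m. K)" using l1 by (intro sum_mono) auto
    finally show ?thesis by simp
  qed
  define z where "z = (\<lambda>k i j. u k i j / of_real (sqrt (\<Lambda> i)))"
  have zrow: "(\<Sum>j\<in>J. norm (z k i j)) \<le> sqrt K" if "k < m" "i < M" for k i
  proof (cases "\<Lambda> i = 0")
    case False
    then have \<Lambda>: "\<Lambda> i > 0" using \<Lambda>0[of i] by simp
    have "(\<Sum>j\<in>J. norm (z k i j)) = (\<Sum>j\<in>J. norm (u k i j)) / sqrt (\<Lambda> i)"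
      using \<Lambda> by (simp add: z_def norm_divide sum_divide_distrib)
    moreover have "(\<Sum>j\<in>J. norm (u k i j)) \<le> sqrt (K * \<Lambda> i)"
      using order_trans[OF lrow[OF that] mult_left_mono[OF l\<Lambda>[OF that(1)]]] K by (intro real_le_rsqrt) auto
    ultimately show ?thesis using \<Lambda> by (simp add: real_sqrt_mult pos_divide_le_eq)
  qed (use K in \<open>simp add: z_def\<close>)
  have zhil: "hilbert_summing 2 K {..<M} J (z k)" if k: "k < m" for k
    unfolding hilbert_summing_def
  proof (intro allI impI)
    fix D :: "nat set" and y :: "nat \<Rightarrow> nat \<Rightarrow> complex" assume Dy: "finite D" "\<forall>j\<in>J. l2 D (y j) \<le> 1"
    have "(\<Sum>i<M. l2 D (\<lambda>d. \<Sum>j\<in>J. z k i j * y j d) powr 2) \<le> (\<Sum>i<M. (l2 D (\<lambda>d. \<Sum>j\<in>J. u k i j * y j d))\<^sup>2 / l k i)"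
    proof (rule sum_mono)
      fix i assume i: "i \<in> {..<M}"
      define U where "U = l2 D (\<lambda>d. \<Sum>j\<in>J. u k i j * y j d)"
      have "l2 D (\<lambda>d. \<Sum>j\<in>J. z k i j * y j d) = U / sqrt (\<Lambda> i)"
        using l2_cmult[of D "of_real (1 / sqrt (\<Lambda> i))" "\<lambda>d. \<Sum>j\<in>J. u k i j * y j d"] \<Lambda>0[of i]
        by (simp add: U_def z_def sum_divide_distrib norm_divide mult_ac)
      then have e: "l2 D (\<lambda>d. \<Sum>j\<in>J. z k i j * y j d) powr 2 = U\<^sup>2 / \<Lambda> i"
        using \<Lambda>0[of i] by (simp add: power_divide U_def)
      show "l2 D (\<lambda>d. \<Sum>j\<in>J. z k i j * y j d) powr 2 \<le> (l2 D (\<lambda>d. \<Sum>j\<in>J. u k i j * y j d))\<^sup>2 / l k i"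
      proof (cases "l k i = 0")
        \<comment> \<open>The right-hand side is 0 by the convention for division, so the row itself
          has to vanish; \<open>lrow\<close> provides this.\<close>
        case True
        then have "(\<Sum>j\<in>J. norm (u k i j)) = 0" using lrow[OF k, of i] i by simp
        then have "\<forall>j\<in>J. u k i j = 0" using fin by (simp add: sum_nonneg_eq_0_iff)
        then show ?thesis by (simp add: z_def l2_def)
      next
        case False
        then have "0 < l k i" using l0[OF k, of i] by simp
        then show ?thesis unfolding e U_def[symmetric] using l\<Lambda>[OF k, of i]
          by (intro divide_left_mono) auto
      qed
    qed
    then show "(\<Sum>i<M. l2 D (\<lambda>d. \<Sum>j\<in>J. z k i j * y j d) powr 2) \<le> K" using lhil[OF k Dy] by linarith
  qed
  define I where "I = words {..<M} m"
  define c where "c = (\<lambda>is js. \<Prod>k<m. z k (is ! k) (js ! k))"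
  define C where "C = sqrt K ^ m"
  \<comment> \<open>The reciprocal exponent between \<open>b0 = 0\<close>, the bounded row sums from
    \<open>zrow\<close>, and \<open>b1 = 1/2\<close>, the square summability from
    \<open>zhil\<close>.\<close>
  define bt where "bt = \<theta> / 2"
  have C1: "C > 0" using K by (simp add: C_def)
  have \<theta>01: "0 < \<theta>" "\<theta> \<le> 1" using p by (auto simp: \<theta> field_simps)
  have fI: "finite I" by (simp add: I_def finite_words)
  have "hilbert_summing 2 (K ^ m) I (words J m) c"
    unfolding I_def c_def using fin zhil K by (intro hilbert_summing_words) auto
  moreover have "C powr 2 = K ^ m"
  proof -
    have "C powr 2 = (sqrt K ^ m)\<^sup>2" using C1 by (simp add: C_def)
    also have "\<dots> = ((sqrt K)\<^sup>2) ^ m" unfolding power_mult[symmetric] by (simp only: mult.commute)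
    finally show ?thesis using K by simp
  qed
  ultimately have hil: "hilbert_summing (1 / (1/2)) (C powr (1 / (1/2))) I (words J m) c" by simp
  have row: "lball 0 I (\<lambda>is. of_real ((\<Sum>js\<in>words J m. norm (c is js)) / C))"
  proof -
    have "(\<Sum>js\<in>words J m. norm (c is js)) \<le> C" if "is \<in> I" for "is"
    proof -
      have "(\<Sum>js\<in>words J m. norm (c is js)) = (\<Prod>k<m. \<Sum>j\<in>J. norm (z k (is ! k) j))"
        unfolding c_def by (rule sum_norm_prod_words)
      also have "\<dots> \<le> (\<Prod>k<m. sqrt K)"
        using words_nth[of "is" "{..<M}" m] that by (intro prod_mono) (auto simp: I_def intro!: zrow sum_nonneg)
      finally show ?thesis by (simp add: C_def)
    qed
    then show ?thesis using C1 unfolding lball_def norm_of_real by (auto simp: abs_of_nonneg sum_nonneg)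
  qed
  define N where "N = (\<lambda>is. (\<Sum>d\<in>D. norm (\<Sum>js\<in>words J m. c is js * t js d) powr p))"
  have "(\<Sum>is\<in>I. N is powr (1 / (p * bt))) \<le> C powr (1 / bt)"
    unfolding N_def using C1 \<theta>01 p t fin
    by (intro interpolated_summing[OF fI _ fin(2) _ row hil _ _ _ _ p \<theta>]) (auto simp: finite_words bt_def)
  \<comment> \<open>Absolute summability concerns only the diagonal multi-indices, where all
    \<open>m\<close> rows carry the same number \<open>i\<close>.\<close>
  moreover have "(\<Sum>i<M. N (replicate m i) powr (1 / (p * bt))) \<le> (\<Sum>is\<in>I. N is powr (1 / (p * bt)))"
  proof -
    have inj: "inj_on (\<lambda>i. replicate m i) {..<M}" using m by (auto simp: inj_on_def)
    have "(\<Sum>i<M. N (replicate m i) powr (1 / (p * bt))) = (\<Sum>is\<in>(\<lambda>i. replicate m i) ` {..<M}. N is powr (1 / (p * bt)))"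
      by (simp add: sum.reindex[OF inj])
    also have "\<dots> \<le> (\<Sum>is\<in>I. N is powr (1 / (p * bt)))"
      using fI by (intro sum_mono2) (auto simp: I_def words_def)
    finally show ?thesis .
  qed
  ultimately have N: "(\<Sum>i<M. N (replicate m i) powr (1 / (p * bt))) \<le> C powr (1 / bt)" by linarith
  have r0: "r > 0"
  proof -
    have "1 / r > 0" using r m \<theta>01 by (simp add: add_pos_nonneg)
    then show ?thesis by simp
  qed
  \<comment> \<open>Hoelder's inequality is applied with \<open>\<alpha> = m r / 2\<close> on the
    weights; the condition on \<open>1/r\<close> says that \<open>r * bt\<close> is left for the
    interpolated part.\<close>
  define \<alpha> where "\<alpha> = real m * r / 2"
  have \<alpha>bt: "1 - \<alpha> = r * bt"
    using r r0 by (simp add: \<alpha>_def bt_def field_simps)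
  have \<alpha>: "0 < \<alpha>" "\<alpha> < 1"
  proof -
    have "0 < r * bt" using r0 \<theta>01 by (simp add: bt_def)
    then show "\<alpha> < 1" using \<alpha>bt by linarith
    show "0 < \<alpha>" using m r0 by (simp add: \<alpha>_def)
  qed
  have e: "(\<Sum>d\<in>D. norm (\<Sum>js\<in>words J m. (\<Prod>k<m. u k i (js ! k)) * t js d) powr p) powr (r / p)
      = \<Lambda> i powr \<alpha> * (N (replicate m i) powr (1 / (p * bt))) powr (1 - \<alpha>)" if i: "i < M" for i
  proof -
    have uz: "u k i j = of_real (sqrt (\<Lambda> i)) * z k i j" if "k < m" "j \<in> J" for k j
    proof (cases "\<Lambda> i = 0")
      case True
      then have "l k i = 0" using l\<Lambda>[OF that(1), of i] l0[OF that(1), of i] by simp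
      then have "(\<Sum>j\<in>J. norm (u k i j)) = 0" using lrow[OF that(1) i] by simp
      then have "u k i j = 0" using fin that by (simp add: sum_nonneg_eq_0_iff)
      then show ?thesis by (simp add: z_def)
    qed (simp add: z_def)
    have "(\<Prod>k<m. u k i (js ! k)) = of_real (sqrt (\<Lambda> i)) ^ m * c (replicate m i) js" if "js \<in> words J m" for js
    proof -
      have "(\<Prod>k<m. u k i (js ! k)) = (\<Prod>k<m. of_real (sqrt (\<Lambda> i)) * z k i (js ! k))"
        using words_nth[OF that] by (intro prod.cong refl) (simp add: uz)
      then show ?thesis by (simp add: prod.distrib c_def)
    qed
    then have "(\<Sum>js\<in>words J m. (\<Prod>k<m. u k i (js ! k)) * t js d)
       = of_real (sqrt (\<Lambda> i)) ^ m * (\<Sum>js\<in>words J m. c (replicate m i) js * t js d)" for d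
      by (simp add: sum_distrib_left mult_ac)
    then have "norm (\<Sum>js\<in>words J m. (\<Prod>k<m. u k i (js ! k)) * t js d) powr p
       = (sqrt (\<Lambda> i) ^ m) powr p * norm (\<Sum>js\<in>words J m. c (replicate m i) js * t js d) powr p" for d
      using \<Lambda>0[of i] by (simp add: norm_mult norm_power powr_mult)
    then have "(\<Sum>d\<in>D. norm (\<Sum>js\<in>words J m. (\<Prod>k<m. u k i (js ! k)) * t js d) powr p) powr (r / p)
       = ((sqrt (\<Lambda> i) ^ m) powr p * N (replicate m i)) powr (r / p)"
      by (simp add: N_def sum_distrib_left)
    also have "\<dots> = (sqrt (\<Lambda> i) ^ m) powr r * N (replicate m i) powr (r / p)"
      using p by (simp add: powr_mult powr_powr N_def sum_nonneg)
    also have "(sqrt (\<Lambda> i) ^ m) powr r = \<Lambda> i powr \<alpha>"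
    proof (cases "\<Lambda> i = 0")
      case False
      then have "sqrt (\<Lambda> i) ^ m = \<Lambda> i powr (real m / 2)"
        using \<Lambda>0[of i] by (simp add: powr_half_sqrt[symmetric] powr_realpow[symmetric] powr_powr)
      then show ?thesis by (simp add: powr_powr \<alpha>_def)
    qed (use m in \<open>simp add: zero_power\<close>)
    also have "N (replicate m i) powr (r / p) = (N (replicate m i) powr (1 / (p * bt))) powr (1 - \<alpha>)"
      using \<theta>01 by (simp add: powr_powr \<alpha>bt bt_def)
    finally show ?thesis .
  qed
  have "(\<Sum>i<M. (\<Sum>d\<in>D. norm (\<Sum>js\<in>words J m. (\<Prod>k<m. u k i (js ! k)) * t js d) powr p) powr (r / p))
    = (\<Sum>i<M. \<Lambda> i powr \<alpha> * (N (replicate m i) powr (1 / (p * bt))) powr (1 - \<alpha>))"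
    using e by (intro sum.cong) auto
  also have "\<dots> \<le> (\<Sum>i<M. \<Lambda> i) powr \<alpha> * (\<Sum>i<M. N (replicate m i) powr (1 / (p * bt))) powr (1 - \<alpha>)"
    using \<alpha> \<Lambda>0 by (intro hoelder_powr_sum) auto
  also have "\<dots> \<le> (real m * K) powr \<alpha> * (C powr (1 / bt)) powr (1 - \<alpha>)"
    using sum\<Lambda> N \<alpha> \<Lambda>0 by (intro mult_mono powr_mono2) (auto intro: sum_nonneg)
  also have "(C powr (1 / bt)) powr (1 - \<alpha>) = C powr r"
    using \<theta>01 by (simp add: powr_powr \<alpha>bt bt_def)
  finally show ?thesis by (simp add: \<alpha>_def C_def)
qed

subsection \<open>The spaces \<open>\<ell>\<^sub>p\<close>\<close>

lemma lp_space_simps [simp]: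
  "vcarrier (lp_space p) = lp_carrier p" "vadd (lp_space p) = (\<lambda>x y i. x i + y i)"
  "vscale (lp_space p) = (\<lambda>c x i. c * x i)" "vnorm (lp_space p) = lp_norm p"
  by (simp_all add: lp_space_def)

lemma vdist_lp: "vdist (lp_space p) u v = lp_norm p (\<lambda>i. u i - v i)"
  by (simp add: vdist_def)

lemma ereal_ge_1_cases:
  assumes "1 \<le> (p::ereal)"
  obtains "p = \<infinity>" | q where "p = ereal q" "1 \<le> q"
  using assms by (cases p) auto

lemma lp_carrier_ereal: "x \<in> lp_carrier (ereal q) \<longleftrightarrow> summable (\<lambda>i. norm (x i) powr q)"
  by (simp add: lp_carrier_def)

lemma lp_carrier_1: "x \<in> lp_carrier 1 \<longleftrightarrow> summable (\<lambda>i. norm (x i))"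
  by (simp add: lp_carrier_def)

lemma lp_carrier_infty: "x \<in> lp_carrier \<infinity> \<longleftrightarrow> bounded (range x)"
  by (simp add: lp_carrier_def)

lemma lp_norm_ereal: "lp_norm (ereal q) x = (\<Sum>i. norm (x i) powr q) powr (1 / q)"
  by (simp add: lp_norm_def)

lemma lp_norm_1: "x \<in> lp_carrier 1 \<Longrightarrow> lp_norm 1 x = (\<Sum>i. norm (x i))"
  by (simp add: lp_norm_def lp_carrier_1 suminf_nonneg)

lemma lp_norm_infty: "lp_norm \<infinity> x = (SUP i. norm (x i))"
  by (simp add: lp_norm_def)

lemma lp_norm_infty_le: "(\<And>i. norm (x i) \<le> c) \<Longrightarrow> lp_norm \<infinity> x \<le> c"
  unfolding lp_norm_infty by (rule cSUP_least) auto

lemma lp_carrier_infty_bounded: "(\<And>i. norm (x i) \<le> c) \<Longrightarrow> x \<in> lp_carrier \<infinity>"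
  unfolding lp_carrier_infty by (rule boundedI[of _ c]) auto

lemma norm_le_lp_norm:
  assumes p: "1 \<le> p" and x: "x \<in> lp_carrier p"
  shows "norm (x d) \<le> lp_norm p x"
  using p
proof (cases rule: ereal_ge_1_cases)
  case 1
  then have "bdd_above (range (\<lambda>i. norm (x i)))"
    using x by (simp add: lp_carrier_infty bounded_norm_comp bounded_imp_bdd_above)
  then show ?thesis unfolding 1 lp_norm_infty by (rule cSUP_upper[OF UNIV_I])
next
  case (2 q)
  then have s: "summable (\<lambda>i. norm (x i) powr q)" using x by (simp add: lp_carrier_ereal)
  have "norm (x d) powr q \<le> (\<Sum>i. norm (x i) powr q)"
    using sum_le_suminf[OF s, of "{d}"] by simp
  then have "(norm (x d) powr q) powr (1/q) \<le> (\<Sum>i. norm (x i) powr q) powr (1/q)"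
    using 2 by (intro powr_mono2) auto
  then show ?thesis using 2 by (simp add: powr_powr lp_norm_ereal)
qed

lemma lp_norm_nonneg: "1 \<le> p \<Longrightarrow> x \<in> lp_carrier p \<Longrightarrow> 0 \<le> lp_norm p x"
  using norm_le_lp_norm norm_ge_zero order_trans by blast

lemma lp_carrier_add:
  assumes p: "1 \<le> p" and "u \<in> lp_carrier p" "v \<in> lp_carrier p"
  shows "(\<lambda>i. u i + v i) \<in> lp_carrier p"
  using p
proof (cases rule: ereal_ge_1_cases)
  case 1
  then show ?thesis using assms bounded_plus_comp[of u UNIV v] by (simp add: lp_carrier_infty)
next
  case (2 q)
  have s: "summable (\<lambda>i. 2 powr q * (norm (u i) powr q + norm (v i) powr q))"
    using assms 2 by (intro summable_mult summable_add) (auto simp: lp_carrier_ereal)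
  have "norm (u i + v i) powr q \<le> 2 powr q * (norm (u i) powr q + norm (v i) powr q)" for i
  proof -
    have "norm (u i + v i) \<le> 2 * max (norm (u i)) (norm (v i))"
      using norm_triangle_ineq[of "u i" "v i"] by linarith
    then have "norm (u i + v i) powr q \<le> (2 * max (norm (u i)) (norm (v i))) powr q"
      using 2 by (intro powr_mono2) auto
    also have "\<dots> = 2 powr q * max (norm (u i)) (norm (v i)) powr q" by (rule powr_mult)
    also have "\<dots> \<le> 2 powr q * (norm (u i) powr q + norm (v i) powr q)"
      by (intro mult_left_mono) (auto simp: max_def)
    finally show ?thesis .
  qed
  then have "(\<lambda>i. u i + v i) \<in> lp_carrier (ereal q)"
    unfolding lp_carrier_ereal by (intro summable_comparison_test'[OF s, of 0]) simp
  then show ?thesis using 2 by simp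
qed

lemma lp_carrier_scale:
  assumes p: "1 \<le> p" and "u \<in> lp_carrier p"
  shows "(\<lambda>i. c * u i) \<in> lp_carrier p"
  using p
proof (cases rule: ereal_ge_1_cases)
  case 1
  then obtain b where "\<And>i. norm (u i) \<le> b" using assms by (auto simp: lp_carrier_infty bounded_iff)
  then show ?thesis using 1 by (auto intro!: lp_carrier_infty_bounded[of _ "norm c * b"] simp: norm_mult mult_left_mono)
next
  case (2 q)
  then show ?thesis using assms by (simp add: lp_carrier_ereal norm_mult powr_mult summable_mult)
qed

lemma lp_carrier_zero: "1 \<le> p \<Longrightarrow> (\<lambda>_. 0) \<in> lp_carrier p"
  by (erule ereal_ge_1_cases) (auto simp: lp_carrier_ereal lp_carrier_infty)

lemma lp_carrier_diff:
  "1 \<le> p \<Longrightarrow> u \<in> lp_carrier p \<Longrightarrow> v \<in> lp_carrier p \<Longrightarrow> (\<lambda>i. u i - v i) \<in> lp_carrier p"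
  using lp_carrier_add[of p u "\<lambda>i. - 1 * v i"] lp_carrier_scale[of p v "- 1"] by simp

lemma lp_carrier_sum:
  "finite R \<Longrightarrow> 1 \<le> p \<Longrightarrow> (\<And>r. r \<in> R \<Longrightarrow> f r \<in> lp_carrier p) \<Longrightarrow> (\<lambda>i. \<Sum>r\<in>R. c r * f r i) \<in> lp_carrier p"
proof (induction R rule: finite_induct)
  case (insert r R)
  then show ?case
    using lp_carrier_add[of p "\<lambda>i. c r * f r i" "\<lambda>i. \<Sum>r\<in>R. c r * f r i"] by (simp add: lp_carrier_scale)
qed (simp add: lp_carrier_zero)

lemma lp_norm_scale_le:
  assumes p: "1 \<le> p" and x: "x \<in> lp_carrier p"
  shows "lp_norm p (\<lambda>i. c * x i) \<le> norm c * lp_norm p x"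
  using p
proof (cases rule: ereal_ge_1_cases)
  case 1
  then show ?thesis
    using norm_le_lp_norm[OF p x] by (auto intro!: lp_norm_infty_le simp: norm_mult mult_left_mono)
next
  case (2 q)
  then have "summable (\<lambda>i. norm (x i) powr q)" using x by (simp add: lp_carrier_ereal)
  then show ?thesis
    using 2 by (simp add: lp_norm_ereal norm_mult powr_mult suminf_mult powr_powr)
qed

lemma lp_norm_scale:
  assumes p: "1 \<le> p" and x: "x \<in> lp_carrier p"
  shows "lp_norm p (\<lambda>i. c * x i) = norm c * lp_norm p x"
proof (cases "c = 0")
  case True
  have "lp_norm p (\<lambda>i. 0 * x i) \<le> 0" using lp_norm_scale_le[OF assms, of 0] by simp
  moreover have "0 \<le> lp_norm p (\<lambda>i. 0 * x i)" by (intro lp_norm_nonneg lp_carrier_scale assms)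
  ultimately show ?thesis using True by simp
next
  case False
  have "lp_norm p (\<lambda>i. inverse c * (c * x i)) \<le> norm (inverse c) * lp_norm p (\<lambda>i. c * x i)"
    by (intro lp_norm_scale_le lp_carrier_scale assms)
  moreover have "(\<lambda>i. inverse c * (c * x i)) = x" using False by (simp add: mult.assoc[symmetric])
  ultimately have "norm c * lp_norm p x \<le> norm c * (norm (inverse c) * lp_norm p (\<lambda>i. c * x i))"
    by (intro mult_left_mono) auto
  also have "\<dots> = norm (c * inverse c) * lp_norm p (\<lambda>i. c * x i)" by (simp only: norm_mult mult.assoc)
  finally have "norm c * lp_norm p x \<le> lp_norm p (\<lambda>i. c * x i)" using False by simp
  then show ?thesis using lp_norm_scale_le[OF assms, of c] by simp
qed

lemma lp_norm_zero: "1 \<le> p \<Longrightarrow> lp_norm p (\<lambda>_. 0 :: 'k::real_normed_field) = 0"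
  using lp_norm_scale[of p "\<lambda>_. 0 :: 'k" 0] lp_carrier_zero[of p] by simp

lemma sum_powr_le_lp_norm:
  assumes q: "1 \<le> q" and x: "x \<in> lp_carrier (ereal q)" and D: "finite D"
  shows "(\<Sum>d\<in>D. norm (x d) powr q) \<le> lp_norm (ereal q) x powr q"
proof -
  have s: "summable (\<lambda>i. norm (x i) powr q)" using x by (simp add: lp_carrier_ereal)
  have "(\<Sum>d\<in>D. norm (x d) powr q) \<le> (\<Sum>i. norm (x i) powr q)"
    using D by (intro sum_le_suminf s) auto
  also have "\<dots> = lp_norm (ereal q) x powr q"
    using q by (simp add: lp_norm_ereal powr_powr suminf_nonneg[OF s])
  finally show ?thesis .
qed

text \<open>Coordinatewise convergence is enough: the limit in \<open>J\<close> is taken for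
  finitely many coordinates, where everything is continuous, and afterwards the number
  \<open>D\<close> of coordinates grows.\<close>

lemma lp_norm_powr_fatou:
  fixes y :: "nat \<Rightarrow> 'i \<Rightarrow> nat \<Rightarrow> 'k::real_normed_field"
  assumes F: "finite F" and q: "1 \<le> q" and r: "0 < r"
    and lim: "\<And>i d. i \<in> F \<Longrightarrow> (\<lambda>J. y J i d) \<longlonglongrightarrow> z i d"
    and z: "\<And>i. i \<in> F \<Longrightarrow> z i \<in> lp_carrier (ereal q)"
    and le: "\<And>J D. (\<Sum>i\<in>F. (\<Sum>d<D. norm (y J i d) powr q) powr (r / q)) \<le> C"
  shows "(\<Sum>i\<in>F. lp_norm (ereal q) (z i) powr r) \<le> C"
proof -
  have D: "(\<Sum>i\<in>F. (\<Sum>d<D. norm (z i d) powr q) powr (r / q)) \<le> C" for D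
  proof (rule LIMSEQ_le_const2)
    show "(\<lambda>J. \<Sum>i\<in>F. (\<Sum>d<D. norm (y J i d) powr q) powr (r / q)) \<longlonglongrightarrow> (\<Sum>i\<in>F. (\<Sum>d<D. norm (z i d) powr q) powr (r / q))"
      using q r by (intro tendsto_sum tendsto_powr' tendsto_norm lim tendsto_const) (auto intro!: always_eventually sum_nonneg)
  qed (use le in blast)
  have "(\<lambda>D. \<Sum>i\<in>F. (\<Sum>d<D. norm (z i d) powr q) powr (r / q)) \<longlonglongrightarrow> (\<Sum>i\<in>F. (\<Sum>d. norm (z i d) powr q) powr (r / q))"
    using q r z
    by (intro tendsto_sum tendsto_powr' tendsto_const summable_LIMSEQ) (auto simp: lp_carrier_ereal intro!: always_eventually sum_nonneg)
  then have "(\<Sum>i\<in>F. (\<Sum>d. norm (z i d) powr q) powr (r / q)) \<le> C"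
    by (rule LIMSEQ_le_const2) (use D in blast)
  moreover have "(\<Sum>d. norm (z i d) powr q) powr (r / q) = lp_norm (ereal q) (z i) powr r" for i
    by (simp add: lp_norm_ereal powr_powr)
  ultimately show ?thesis by simp
qed

subsection \<open>Multilinear maps on \<open>\<ell>\<^sub>p\<close>\<close>

definition lp_multilinear :: "nat \<Rightarrow> ereal \<Rightarrow> ereal \<Rightarrow> ((nat \<Rightarrow> nat \<Rightarrow> 'k::real_normed_field) \<Rightarrow> nat \<Rightarrow> 'k) \<Rightarrow> bool" where
  "lp_multilinear N s p S \<longleftrightarrow> 1 \<le> s \<and> 1 \<le> p \<and> continuous_multilinear_map N (\<lambda>_. lp_space s) (lp_space p) S"

lemma tuplesI: "(\<And>l. l < N \<Longrightarrow> f l \<in> lp_carrier s) \<Longrightarrow> (\<lambda>l\<in>{..<N}. f l) \<in> tuples N (\<lambda>_. lp_space s)"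
  by (auto simp: tuples_def)

lemma lp_multilinear_carrier:
  "lp_multilinear N s p S \<Longrightarrow> (\<And>l. l < N \<Longrightarrow> f l \<in> lp_carrier s) \<Longrightarrow> S (\<lambda>l\<in>{..<N}. f l) \<in> lp_carrier p"
  using tuplesI[of N f s] by (auto simp: lp_multilinear_def continuous_multilinear_map_def multilinear_map_def)

lemma lp_multilinear_slot_add:
  "lp_multilinear N s p S \<Longrightarrow> x \<in> tuples N (\<lambda>_. lp_space s) \<Longrightarrow> j < N \<Longrightarrow> u \<in> lp_carrier s \<Longrightarrow> v \<in> lp_carrier s \<Longrightarrow>
    S (x(j := \<lambda>i. u i + v i)) = (\<lambda>d. S (x(j := u)) d + S (x(j := v)) d)"
  by (simp add: lp_multilinear_def continuous_multilinear_map_def multilinear_map_def)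

lemma lp_multilinear_slot_scale:
  "lp_multilinear N s p S \<Longrightarrow> x \<in> tuples N (\<lambda>_. lp_space s) \<Longrightarrow> j < N \<Longrightarrow> u \<in> lp_carrier s \<Longrightarrow>
    S (x(j := \<lambda>i. c * u i)) = (\<lambda>d. c * S (x(j := u)) d)"
  by (simp add: lp_multilinear_def continuous_multilinear_map_def multilinear_map_def)

lemma lp_multilinear_slot_sum:
  assumes S: "lp_multilinear N s p S" and x: "x \<in> tuples N (\<lambda>_. lp_space s)" and j: "j < N"
    and R: "finite R" and f: "\<And>r. r \<in> R \<Longrightarrow> f r \<in> lp_carrier s"
  shows "S (x(j := \<lambda>i. \<Sum>r\<in>R. c r * f r i)) = (\<lambda>d. \<Sum>r\<in>R. c r * S (x(j := f r)) d)"
  using R f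
proof (induction R rule: finite_induct)
  case empty
  have "x j \<in> lp_carrier s" using x j by (auto simp: tuples_def)
  from lp_multilinear_slot_scale[OF S x j this, of 0] show ?case by (simp add: fun_upd_def)
next
  case (insert r R)
  have s: "1 \<le> s" using S by (simp add: lp_multilinear_def)
  have c1: "(\<lambda>i. c r * f r i) \<in> lp_carrier s" using insert s by (intro lp_carrier_scale) auto
  have c2: "(\<lambda>i. \<Sum>r\<in>R. c r * f r i) \<in> lp_carrier s" using insert s by (intro lp_carrier_sum) auto
  have "S (x(j := (\<lambda>i. c r * f r i + (\<Sum>r\<in>R. c r * f r i))))
    = (\<lambda>d. S (x(j := (\<lambda>i. c r * f r i))) d + S (x(j := (\<lambda>i. \<Sum>r\<in>R. c r * f r i))) d)"
    by (rule lp_multilinear_slot_add[OF S x j c1 c2])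
  moreover have "S (x(j := (\<lambda>i. c r * f r i))) = (\<lambda>d. c r * S (x(j := f r)) d)"
    using insert.prems by (intro lp_multilinear_slot_scale[OF S x j]) auto
  ultimately show ?case using insert by (simp add: fun_upd_def)
qed

text \<open>The slots are expanded one at a time from the left. The slots \<open>g\<close> not yet
  reached are arbitrary in the induction, so that slot \<open>q\<close> can hold its whole sum
  before it is split.\<close>

lemma lp_multilinear_expand:
  assumes S: "lp_multilinear N s p S" and R: "finite R"
    and f: "\<And>l r. l < N \<Longrightarrow> r \<in> R \<Longrightarrow> f l r \<in> lp_carrier s"
  shows "S (\<lambda>l\<in>{..<N}. \<lambda>i. \<Sum>r\<in>R. c l r * f l r i)
    = (\<lambda>d. \<Sum>rs\<in>words R N. (\<Prod>l<N. c l (rs ! l)) * S (\<lambda>l\<in>{..<N}. f l (rs ! l)) d)"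
proof -
  define F where "F = (\<lambda>l i. \<Sum>r\<in>R. c l r * f l r i)"
  have s: "1 \<le> s" using S by (simp add: lp_multilinear_def)
  have Fc: "F l \<in> lp_carrier s" if "l < N" for l
    unfolding F_def using f that R s by (intro lp_carrier_sum) auto
  have "S (\<lambda>l\<in>{..<N}. if l < q then F l else g l)
    = (\<lambda>d. \<Sum>rs\<in>words R q. (\<Prod>l<q. c l (rs ! l)) * S (\<lambda>l\<in>{..<N}. if l < q then f l (rs ! l) else g l) d)"
    if "q \<le> N" "\<And>l. l < N \<Longrightarrow> g l \<in> lp_carrier s" for q g
    using that
  proof (induction q arbitrary: g)
    case (Suc q)
    define g' where "g' = g(q := F q)"
    have g': "g' l \<in> lp_carrier s" if "l < N" for l using Suc.prems that Fc by (auto simp: g'_def)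
    have "(\<lambda>l\<in>{..<N}. if l < Suc q then F l else g l) = (\<lambda>l\<in>{..<N}. if l < q then F l else g' l)"
      by (auto simp: g'_def less_Suc_eq)
    moreover have "S (\<lambda>l\<in>{..<N}. if l < q then F l else g' l)
      = (\<lambda>d. \<Sum>rs\<in>words R q. (\<Prod>l<q. c l (rs ! l)) * S (\<lambda>l\<in>{..<N}. if l < q then f l (rs ! l) else g' l) d)"
      using Suc.prems by (intro Suc.IH g') auto
    ultimately have "S (\<lambda>l\<in>{..<N}. if l < Suc q then F l else g l)
      = (\<lambda>d. \<Sum>rs\<in>words R q. (\<Prod>l<q. c l (rs ! l)) * S (\<lambda>l\<in>{..<N}. if l < q then f l (rs ! l) else g' l) d)"
      by (simp only:)
    also have "\<dots> = (\<lambda>d. \<Sum>rs\<in>words R q. \<Sum>r\<in>R. (\<Prod>l<Suc q. c l ((rs @ [r]) ! l)) * S (\<lambda>l\<in>{..<N}. if l < Suc q then f l ((rs @ [r]) ! l) else g l) d)"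
    proof (intro ext sum.cong refl)
      fix d rs assume rs: "rs \<in> words R q"
      then have len: "length rs = q" by (simp add: words_def)
      define x where "x = (\<lambda>l\<in>{..<N}. if l < q then f l (rs ! l) else g l)"
      have x: "x \<in> tuples N (\<lambda>_. lp_space s)"
        unfolding x_def using f words_nth[OF rs] Suc.prems by (intro tuplesI) auto
      have q: "q < N" using Suc.prems by simp
      have "(\<lambda>l\<in>{..<N}. if l < q then f l (rs ! l) else g' l) = x(q := \<lambda>i. \<Sum>r\<in>R. c q r * f q r i)"
        using q by (auto simp: x_def g'_def F_def)
      then have "S (\<lambda>l\<in>{..<N}. if l < q then f l (rs ! l) else g' l) d = (\<Sum>r\<in>R. c q r * S (x(q := f q r)) d)"
        using lp_multilinear_slot_sum[OF S x q R, of "f q" "c q"] f[OF q] by simp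
      moreover have "x(q := f q r) = (\<lambda>l\<in>{..<N}. if l < Suc q then f l ((rs @ [r]) ! l) else g l)" for r
        using q len by (auto simp: x_def nth_append less_Suc_eq)
      moreover have "(\<Prod>l<Suc q. c l ((rs @ [r]) ! l)) = (\<Prod>l<q. c l (rs ! l)) * c q r" for r
        using len by (simp add: nth_append)
      ultimately show "(\<Prod>l<q. c l (rs ! l)) * S (\<lambda>l\<in>{..<N}. if l < q then f l (rs ! l) else g' l) d
        = (\<Sum>r\<in>R. (\<Prod>l<Suc q. c l ((rs @ [r]) ! l)) * S (\<lambda>l\<in>{..<N}. if l < Suc q then f l ((rs @ [r]) ! l) else g l) d)"
        by (simp add: sum_distrib_left mult_ac)
    qed
    finally show ?case by (simp only: sum_words_snoc)
  qed simp
  from this[of N "F"] Fc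
  have "S (\<lambda>l\<in>{..<N}. if l < N then F l else F l)
    = (\<lambda>d. \<Sum>rs\<in>words R N. (\<Prod>l<N. c l (rs ! l)) * S (\<lambda>l\<in>{..<N}. if l < N then f l (rs ! l) else F l) d)" by simp
  moreover have "(\<lambda>l\<in>{..<N}. if l < N then f l (rs ! l) else F l) = (\<lambda>l\<in>{..<N}. f l (rs ! l))" for rs
    by auto
  ultimately show ?thesis by (simp add: F_def)
qed

text \<open>Homogeneity in all slots at once, as the expansion over a one-element index set.\<close>

lemma lp_multilinear_scale:
  assumes S: "lp_multilinear N s p S" and x: "\<And>l. l < N \<Longrightarrow> x l \<in> lp_carrier s"
  shows "S (\<lambda>l\<in>{..<N}. \<lambda>i. c l * x l i) = (\<lambda>d. (\<Prod>l<N. c l) * S (\<lambda>l\<in>{..<N}. x l) d)"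
proof -
  have "words {()} N = {replicate N ()}" by (auto simp: words_def intro: replicate_eqI)
  then show ?thesis using lp_multilinear_expand[OF S, of "{()}" "\<lambda>l _. x l" "\<lambda>l _. c l"] x by simp
qed

text \<open>Continuity at the zero tuple yields \<open>\<delta>\<close>; scaling each argument to
  norm \<open>\<delta>/2\<close> gives the constant \<open>(2/\<delta>)^N\<close>. An argument of
  norm 0 cannot be scaled, but it is the zero vector and the value vanishes.\<close>

lemma lp_multilinear_bounded:
  assumes S: "lp_multilinear N s p S" and N: "N \<ge> 1"
  shows "\<exists>M>0. \<forall>x. (\<forall>l<N. x l \<in> lp_carrier s) \<longrightarrow>
    lp_norm p (S (\<lambda>l\<in>{..<N}. x l)) \<le> M * (\<Prod>l<N. lp_norm s (x l))"
proof -
  have s: "1 \<le> s" and p: "1 \<le> p" using S by (auto simp: lp_multilinear_def)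
  have cont: "\<forall>x\<in>tuples N (\<lambda>_. lp_space s). \<forall>\<epsilon>>0. \<exists>\<delta>>0. \<forall>y\<in>tuples N (\<lambda>_. lp_space s).
      (\<forall>j<N. vdist (lp_space s) (y j) (x j) < \<delta>) \<longrightarrow> vdist (lp_space p) (S y) (S x) < \<epsilon>"
    using S by (simp add: lp_multilinear_def continuous_multilinear_map_def)
  define z where "z = (\<lambda>l\<in>{..<N}. (\<lambda>_. 0) :: nat \<Rightarrow> 'a)"
  have z: "z \<in> tuples N (\<lambda>_. lp_space s)" unfolding z_def by (intro tuplesI lp_carrier_zero s)
  have S0: "S z = (\<lambda>_. 0)"
    using lp_multilinear_scale[OF S, of "\<lambda>_ _. 0" "\<lambda>_. 0"] N lp_carrier_zero[OF s] by (simp add: z_def zero_power)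
  obtain \<delta> where \<delta>: "\<delta> > 0" and D: "\<And>y. y \<in> tuples N (\<lambda>_. lp_space s) \<Longrightarrow>
      (\<forall>j<N. vdist (lp_space s) (y j) (z j) < \<delta>) \<Longrightarrow> vdist (lp_space p) (S y) (S z) < 1"
    using cont[rule_format, OF z zero_less_one] by blast
  show ?thesis
  proof (intro exI[of _ "(2 / \<delta>) ^ N"] conjI allI impI)
    show "0 < (2 / \<delta>) ^ N" using \<delta> by simp
    fix x :: "nat \<Rightarrow> nat \<Rightarrow> 'a" assume "\<forall>l<N. x l \<in> lp_carrier s"
    then have x: "\<And>l. l < N \<Longrightarrow> x l \<in> lp_carrier s" by blast
    show "lp_norm p (S (\<lambda>l\<in>{..<N}. x l)) \<le> (2 / \<delta>) ^ N * (\<Prod>l<N. lp_norm s (x l))"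
    proof (cases "\<exists>l<N. lp_norm s (x l) = 0")
      case True
      then obtain l where l: "l < N" "lp_norm s (x l) = 0" by blast
      then have xl: "x l = (\<lambda>_. 0)" using norm_le_lp_norm[OF s x[OF l(1)]] by auto
      have eq: "(\<lambda>k\<in>{..<N}. \<lambda>i. (if k = l then 0 else 1) * x k i) = (\<lambda>k\<in>{..<N}. x k)"
        using xl by (auto intro!: restrict_ext)
      have P0: "(\<Prod>k<N. if k = l then 0 else 1 :: 'a) = 0" using l by (intro prod_zero) auto
      have "S (\<lambda>k\<in>{..<N}. x k) = (\<lambda>_. 0)"
        using lp_multilinear_scale[where x = x and c = "\<lambda>k. if k = l then 0 else 1", OF S x] unfolding eq P0 mult_zero_left .
      moreover have "(\<Prod>l<N. lp_norm s (x l)) = 0" using l by (intro prod_zero) auto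
      ultimately show ?thesis by (simp only: lp_norm_zero[OF p] mult_zero_right order_refl)
    next
      case False
      define W where "W = (\<lambda>l. lp_norm s (x l))"
      have W: "W l > 0" if "l < N" for l using lp_norm_nonneg[OF s x[OF that]] False that by (auto simp: W_def less_le)
      define c :: "nat \<Rightarrow> 'a" where "c = (\<lambda>l. of_real (\<delta> / 2 / W l))"
      define y where "y = (\<lambda>l\<in>{..<N}. \<lambda>i. c l * x l i)"
      have y: "y \<in> tuples N (\<lambda>_. lp_space s)" unfolding y_def using x by (intro tuplesI lp_carrier_scale s)
      have "vdist (lp_space s) (y j) (z j) < \<delta>" if "j < N" for j
      proof -
        have "vdist (lp_space s) (y j) (z j) = norm (c j) * W j"
          using that x by (simp add: vdist_lp y_def z_def lp_norm_scale[OF s] W_def)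
        also have "\<dots> = \<delta> / 2" using W[OF that] \<delta> by (simp add: c_def norm_divide)
        finally show ?thesis using \<delta> by simp
      qed
      then have "vdist (lp_space p) (S y) (S z) < 1" using D[OF y] by blast
      then have "lp_norm p (\<lambda>d. (\<Prod>l<N. c l) * S (\<lambda>l\<in>{..<N}. x l) d) < 1"
        using lp_multilinear_scale[OF S, of x c] x by (simp add: vdist_lp S0 y_def)
      then have "norm (\<Prod>l<N. c l) * lp_norm p (S (\<lambda>l\<in>{..<N}. x l)) < 1"
        using lp_norm_scale[OF p lp_multilinear_carrier[OF S], of x] x by simp
      moreover have "norm (\<Prod>l<N. c l) = (\<delta> / 2) ^ N / (\<Prod>l<N. W l)"
      proof -
        have "norm (\<Prod>l<N. c l) = (\<Prod>l<N. \<delta> / 2 / W l)"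
          unfolding prod_norm[symmetric] using W \<delta> by (intro prod.cong) (auto simp: c_def norm_divide abs_of_pos)
        then show ?thesis by (simp add: prod_dividef prod.distrib power_divide)
      qed
      moreover have "(\<Prod>l<N. W l) > 0" using W by (intro prod_pos) auto
      ultimately have "lp_norm p (S (\<lambda>l\<in>{..<N}. x l)) \<le> (2 / \<delta>) ^ N * (\<Prod>l<N. W l)"
        using \<delta> by (simp add: field_simps power_divide)
      then show ?thesis by (simp add: W_def)
    qed
  qed
qed

lemma lp_multilinear_tendsto:
  assumes S: "lp_multilinear N s p S" and x: "\<And>l. l < N \<Longrightarrow> x l \<in> lp_carrier s"
    and y: "\<And>\<nu> l. l < N \<Longrightarrow> y \<nu> l \<in> lp_carrier s"
    and lim: "\<And>l. l < N \<Longrightarrow> (\<lambda>\<nu>. lp_norm s (\<lambda>i. y \<nu> l i - x l i)) \<longlonglongrightarrow> 0"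
  shows "(\<lambda>\<nu>. lp_norm p (\<lambda>d. S (\<lambda>l\<in>{..<N}. y \<nu> l) d - S (\<lambda>l\<in>{..<N}. x l) d)) \<longlonglongrightarrow> 0"
proof (rule LIMSEQ_I)
  fix \<epsilon> :: real assume \<epsilon>: "\<epsilon> > 0"
  have s: "1 \<le> s" and p: "1 \<le> p" using S by (auto simp: lp_multilinear_def)
  have cont: "\<forall>x\<in>tuples N (\<lambda>_. lp_space s). \<forall>\<epsilon>>0. \<exists>\<delta>>0. \<forall>y\<in>tuples N (\<lambda>_. lp_space s).
      (\<forall>j<N. vdist (lp_space s) (y j) (x j) < \<delta>) \<longrightarrow> vdist (lp_space p) (S y) (S x) < \<epsilon>"
    using S by (simp add: lp_multilinear_def continuous_multilinear_map_def)
  obtain \<delta> where \<delta>: "\<delta> > 0" and D: "\<And>y. y \<in> tuples N (\<lambda>_. lp_space s) \<Longrightarrow>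
      (\<forall>j<N. vdist (lp_space s) (y j) ((\<lambda>l\<in>{..<N}. x l) j) < \<delta>) \<Longrightarrow> vdist (lp_space p) (S y) (S (\<lambda>l\<in>{..<N}. x l)) < \<epsilon>"
    using cont[rule_format, OF tuplesI[where f = x, OF x] \<epsilon>] by blast
  have "\<forall>\<^sub>F \<nu> in sequentially. \<forall>l\<in>{..<N}. lp_norm s (\<lambda>i. y \<nu> l i - x l i) < \<delta>"
    by (intro eventually_ball_finite ballI) (use order_tendstoD(2)[OF lim \<delta>] in auto)
  then obtain \<nu>0 where \<nu>0: "\<And>\<nu> l. \<nu> \<ge> \<nu>0 \<Longrightarrow> l < N \<Longrightarrow> lp_norm s (\<lambda>i. y \<nu> l i - x l i) < \<delta>"
    by (auto simp: eventually_sequentially)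
  show "\<exists>no. \<forall>\<nu>\<ge>no. norm (lp_norm p (\<lambda>d. S (\<lambda>l\<in>{..<N}. y \<nu> l) d - S (\<lambda>l\<in>{..<N}. x l) d) - 0) < \<epsilon>"
  proof (intro exI[of _ \<nu>0] allI impI)
    fix \<nu> assume "\<nu> \<ge> \<nu>0"
    then have "vdist (lp_space p) (S (\<lambda>l\<in>{..<N}. y \<nu> l)) (S (\<lambda>l\<in>{..<N}. x l)) < \<epsilon>"
      using \<nu>0 y by (intro D tuplesI) (auto simp: vdist_lp)
    moreover have "0 \<le> lp_norm p (\<lambda>d. S (\<lambda>l\<in>{..<N}. y \<nu> l) d - S (\<lambda>l\<in>{..<N}. x l) d)"
      using x y by (intro lp_norm_nonneg lp_carrier_diff p lp_multilinear_carrier[OF S])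
    ultimately show "norm (lp_norm p (\<lambda>d. S (\<lambda>l\<in>{..<N}. y \<nu> l) d - S (\<lambda>l\<in>{..<N}. x l) d) - 0) < \<epsilon>"
      by (simp add: vdist_lp)
  qed
qed

lemma lp_norm_tendsto_pointwise:
  assumes p: "1 \<le> p" and y: "\<And>\<nu>. y \<nu> \<in> lp_carrier p" and x: "x \<in> lp_carrier p"
    and lim: "(\<lambda>\<nu>. lp_norm p (\<lambda>d. y \<nu> d - x d)) \<longlonglongrightarrow> 0"
  shows "(\<lambda>\<nu>. y \<nu> d) \<longlonglongrightarrow> x d"
proof -
  have "norm (y \<nu> d - x d) \<le> lp_norm p (\<lambda>d. y \<nu> d - x d)" for \<nu>
    using norm_le_lp_norm[OF p lp_carrier_diff[OF p y x], of \<nu> d] .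
  then have "(\<lambda>\<nu>. y \<nu> d - x d) \<longlonglongrightarrow> 0"
    by (intro Lim_null_comparison[OF _ lim]) auto
  then show ?thesis by (simp add: LIM_zero_iff)
qed

text \<open>The truncations are written as combinations of unit vectors, the form in which a
  multilinear map can be expanded; the error is the tail of the series of moduli.\<close>

lemma l1_truncation:
  fixes a :: "nat \<Rightarrow> 'k::real_normed_field"
  assumes a: "a \<in> lp_carrier 1"
  defines "P \<equiv> \<lambda>J i. \<Sum>j<J. a j * (if i = j then 1 else 0)"
  shows "P J \<in> lp_carrier 1" "(\<lambda>J. lp_norm 1 (\<lambda>i. P J i - a i)) \<longlonglongrightarrow> 0"
proof -
  have P: "P J i = (if i < J then a i else 0)" for J i
    by (simp add: P_def if_distrib[where f = "\<lambda>x. _ * x"] cong: if_cong)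
  have c: "P J \<in> lp_carrier 1" for J
    unfolding lp_carrier_1 by (rule summable_finite[of "{..<J}"]) (auto simp: P)
  then show "P J \<in> lp_carrier 1" .
  have s: "summable (\<lambda>i. norm (a i))" using a by (simp add: lp_carrier_1)
  have "lp_norm 1 (\<lambda>i. P J i - a i) = (\<Sum>i. norm (a i)) - (\<Sum>i<J. norm (a i))" for J
  proof -
    have "lp_norm 1 (\<lambda>i. P J i - a i) = (\<Sum>i. norm (P J i - a i))"
      using lp_carrier_diff[OF _ c a] by (intro lp_norm_1) simp
    also have "\<dots> = (\<Sum>i. norm (a i) - (if i < J then norm (a i) else 0))"
      by (intro suminf_cong) (simp add: P)
    also have "\<dots> = (\<Sum>i. norm (a i)) - (\<Sum>i. if i < J then norm (a i) else 0)"
      by (intro suminf_diff[symmetric] s summable_finite[of "{..<J}"]) auto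
    also have "(\<Sum>i. if i < J then norm (a i) else 0) = (\<Sum>i<J. norm (a i))"
      by (subst suminf_finite[of "{..<J}"]) auto
    finally show ?thesis .
  qed
  moreover have "(\<lambda>J. (\<Sum>i. norm (a i)) - (\<Sum>i<J. norm (a i))) \<longlonglongrightarrow> (\<Sum>i. norm (a i)) - (\<Sum>i. norm (a i))"
    by (intro tendsto_diff tendsto_const summable_LIMSEQ s)
  ultimately show "(\<lambda>J. lp_norm 1 (\<lambda>i. P J i - a i)) \<longlonglongrightarrow> 0" by simp
qed

text \<open>The finite inequalities are complex; \<open>\<iota>\<close> is \<open>of_real\<close> for real scalars and the identity for
  complex ones.\<close>

locale scalar_embedding =
  fixes \<iota> :: "'k::real_normed_field \<Rightarrow> complex"
  assumes \<iota>_add: "\<iota> (x + y) = \<iota> x + \<iota> y" and \<iota>_mult: "\<iota> (x * y) = \<iota> x * \<iota> y"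
    and norm_\<iota> [simp]: "norm (\<iota> x) = norm x" and \<iota>_of_real: "\<iota> (of_real t) = of_real t"
begin

lemma \<iota>_0: "\<iota> 0 = 0" and \<iota>_1: "\<iota> 1 = 1"
  using \<iota>_of_real[of 0] \<iota>_of_real[of 1] by simp_all

lemma \<iota>_sum: "\<iota> (\<Sum>i\<in>I. f i) = (\<Sum>i\<in>I. \<iota> (f i))"
  by (induction I rule: infinite_finite_induct) (simp_all add: \<iota>_0 \<iota>_add)

lemma \<iota>_prod: "\<iota> (\<Prod>i\<in>I. f i) = (\<Prod>i\<in>I. \<iota> (f i))"
  by (induction I rule: infinite_finite_induct) (simp_all add: \<iota>_1 \<iota>_mult)

lemma \<iota>_diff: "\<iota> (x - y) = \<iota> x - \<iota> y"
  using \<iota>_add[of "x - y" y] by simp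

text \<open>By \<open>le\<close> the combinations \<open>g l\<close> of the given vectors lie in the
  unit ball of the sup norm. Expanding \<open>A\<close> at these arguments turns its norm bound into
  boundedness of the coefficient tensor.\<close>

lemma tensor_bounded_multilinear:
  fixes A :: "(nat \<Rightarrow> nat \<Rightarrow> 'k) \<Rightarrow> nat \<Rightarrow> 'k" and N :: nat
  assumes A: "lp_multilinear n \<infinity> 1 A" and M: "M > 0"
    and bd: "\<And>x. (\<And>l. l < n \<Longrightarrow> x l \<in> lp_carrier \<infinity>) \<Longrightarrow> lp_norm 1 (A (\<lambda>l\<in>{..<n}. x l)) \<le> M * (\<Prod>l<n. lp_norm \<infinity> (x l))"
    and f: "\<And>l i. l < n \<Longrightarrow> i < N \<Longrightarrow> f l i \<in> lp_carrier \<infinity>"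
    and le: "\<And>\<epsilon> l c. l < n \<Longrightarrow> (\<forall>i<N. \<bar>\<epsilon> i\<bar> \<le> 1) \<Longrightarrow> norm (\<Sum>i<N. of_real (\<epsilon> i) * f l i c) \<le> 1"
  shows "tensor_bounded n {..<N} {..<J::nat} (\<lambda>xs j. \<iota> (A (\<lambda>l\<in>{..<n}. f l (xs ! l)) j) / of_real M)"
  unfolding tensor_bounded_def
proof (intro allI impI)
  fix \<epsilon> :: "nat \<Rightarrow> nat \<Rightarrow> real" assume \<epsilon>: "\<forall>k<n. \<forall>x\<in>{..<N}. \<bar>\<epsilon> k x\<bar> \<le> 1"
  define g where "g = (\<lambda>l c. \<Sum>i<N. of_real (\<epsilon> l i) * f l i c)"
  have g1: "norm (g l c) \<le> 1" if "l < n" for l c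
    unfolding g_def using \<epsilon> that by (intro le) auto
  have gc: "g l \<in> lp_carrier \<infinity>" if "l < n" for l
    using g1[OF that] by (rule lp_carrier_infty_bounded)
  have Ag: "A (\<lambda>l\<in>{..<n}. g l) = (\<lambda>j. \<Sum>xs\<in>words {..<N} n. (\<Prod>l<n. of_real (\<epsilon> l (xs ! l))) * A (\<lambda>l\<in>{..<n}. f l (xs ! l)) j)"
    unfolding g_def by (rule lp_multilinear_expand[OF A]) (use f in auto)
  have Agc: "A (\<lambda>l\<in>{..<n}. g l) \<in> lp_carrier 1" using gc by (intro lp_multilinear_carrier[OF A])
  have "norm (\<Sum>xs\<in>words {..<N} n. of_real (\<Prod>k<n. \<epsilon> k (xs ! k)) * (\<iota> (A (\<lambda>l\<in>{..<n}. f l (xs ! l)) j) / of_real M))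
     = norm (A (\<lambda>l\<in>{..<n}. g l) j) / M" for j
  proof -
    have "(\<Sum>xs\<in>words {..<N} n. of_real (\<Prod>k<n. \<epsilon> k (xs ! k)) * (\<iota> (A (\<lambda>l\<in>{..<n}. f l (xs ! l)) j) / of_real M))
      = \<iota> (A (\<lambda>l\<in>{..<n}. g l) j) / of_real M"
      unfolding Ag by (simp add: \<iota>_sum \<iota>_mult \<iota>_prod \<iota>_of_real sum_divide_distrib)
    then show ?thesis using M by (simp add: norm_divide)
  qed
  then have "(\<Sum>j<J. norm (\<Sum>xs\<in>words {..<N} n. of_real (\<Prod>k<n. \<epsilon> k (xs ! k)) * (\<iota> (A (\<lambda>l\<in>{..<n}. f l (xs ! l)) j) / of_real M)))
     = (\<Sum>j<J. norm (A (\<lambda>l\<in>{..<n}. g l) j)) / M"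
    by (simp add: sum_divide_distrib)
  also have "\<dots> \<le> 1"
  proof -
    have "(\<Sum>j<J. norm (A (\<lambda>l\<in>{..<n}. g l) j)) \<le> lp_norm 1 (A (\<lambda>l\<in>{..<n}. g l))"
      using sum_powr_le_lp_norm[of 1 "A (\<lambda>l\<in>{..<n}. g l)" "{..<J}"] Agc lp_norm_nonneg[OF _ Agc]
      by (simp flip: one_ereal_def)
    also have "\<dots> \<le> M * (\<Prod>l<n. lp_norm \<infinity> (g l))" using gc by (intro bd)
    also have "\<dots> \<le> M * (\<Prod>l<n. 1)"
      using M g1 gc by (intro mult_left_mono prod_mono) (auto intro!: lp_norm_infty_le lp_norm_nonneg)
    finally show ?thesis using M by simp
  qed
  finally show "(\<Sum>j<J. norm (\<Sum>xs\<in>words {..<N} n. of_real (\<Prod>k<n. \<epsilon> k (xs ! k)) * (\<iota> (A (\<lambda>l\<in>{..<n}. f l (xs ! l)) j) / of_real M))) \<le> 1" .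
qed

abbreviation unit_vec :: "nat \<Rightarrow> nat \<Rightarrow> 'k" where
  "unit_vec j \<equiv> \<lambda>i. if i = j then 1 else 0"

lemma unit_vec_carrier: "unit_vec j \<in> lp_carrier 1" and unit_vec_norm: "lp_norm 1 (unit_vec j) = 1"
proof -
  have e: "(\<lambda>i. norm (unit_vec j i)) = (\<lambda>i. if i = j then 1 else 0)" by auto
  show c: "unit_vec j \<in> lp_carrier 1" unfolding lp_carrier_1 e by simp
  show "lp_norm 1 (unit_vec j) = 1" unfolding lp_norm_1[OF c] e
    using sums_single[of j "\<lambda>_. 1::real"] by (simp add: sums_iff)
qed

text \<open>Reduces estimates for \<open>T\<close> at arbitrary l1 arguments to its values at unit
  vectors, for bounds uniform in the truncation \<open>J\<close> of the arguments and the truncation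
  \<open>D\<close> of the values.\<close>

lemma truncation_limit:
  fixes T :: "(nat \<Rightarrow> nat \<Rightarrow> 'k) \<Rightarrow> nat \<Rightarrow> 'k"
  assumes T: "lp_multilinear m 1 (ereal p) T" and F: "finite F" and p: "1 \<le> p" and r: "0 < r"
    and \<alpha>: "\<And>e k. e \<in> F \<Longrightarrow> k < m \<Longrightarrow> \<alpha> e k \<in> lp_carrier 1"
    and le: "\<And>J D. (\<Sum>e\<in>F. (\<Sum>d<D. norm (\<Sum>js\<in>words {..<J} m. (\<Prod>k<m. \<alpha> e k (js ! k)) *
        T (\<lambda>k\<in>{..<m}. unit_vec (js ! k)) d) powr p) powr (r / p)) \<le> C"
  shows "(\<Sum>e\<in>F. lp_norm (ereal p) (T (\<lambda>k\<in>{..<m}. \<alpha> e k)) powr r) \<le> C"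
proof -
  define P where "P = (\<lambda>J e k i. \<Sum>j<J. \<alpha> e k j * (if i = j then 1 else 0 :: 'k))"
  have Pc: "P J e k \<in> lp_carrier 1" if "e \<in> F" "k < m" for J e k
    unfolding P_def using l1_truncation(1)[OF \<alpha>[OF that]] .
  have PT: "T (\<lambda>k\<in>{..<m}. P J e k) = (\<lambda>d. \<Sum>js\<in>words {..<J} m. (\<Prod>k<m. \<alpha> e k (js ! k)) * T (\<lambda>k\<in>{..<m}. unit_vec (js ! k)) d)" for J e
    unfolding P_def by (rule lp_multilinear_expand[OF T]) (auto intro: unit_vec_carrier)
  show ?thesis
  proof (rule lp_norm_powr_fatou[OF F p r, where y = "\<lambda>J e. T (\<lambda>k\<in>{..<m}. P J e k)"])
    fix e d assume e: "e \<in> F"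
    have "(\<lambda>J. lp_norm (ereal p) (\<lambda>d. T (\<lambda>k\<in>{..<m}. P J e k) d - T (\<lambda>k\<in>{..<m}. \<alpha> e k) d)) \<longlonglongrightarrow> 0"
    proof (rule lp_multilinear_tendsto[OF T])
      show "(\<lambda>J. lp_norm 1 (\<lambda>i. P J e l i - \<alpha> e l i)) \<longlonglongrightarrow> 0" if "l < m" for l
        unfolding P_def using l1_truncation(2)[OF \<alpha>[OF e that]] .
      show "\<alpha> e l \<in> lp_carrier 1" "P J e l \<in> lp_carrier 1" if "l < m" for J l
        using \<alpha>[OF e that] Pc[OF e that] .
    qed
    then show "(\<lambda>J. T (\<lambda>k\<in>{..<m}. P J e k) d) \<longlonglongrightarrow> T (\<lambda>k\<in>{..<m}. \<alpha> e k) d"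
    proof (rule lp_norm_tendsto_pointwise[rotated 3])
      show "1 \<le> ereal p" using p by simp
      show "T (\<lambda>k\<in>{..<m}. \<alpha> e k) \<in> lp_carrier (ereal p)" "T (\<lambda>k\<in>{..<m}. P J e k) \<in> lp_carrier (ereal p)" for J
        using \<alpha>[OF e] Pc[OF e] by (intro lp_multilinear_carrier[OF T]; blast)+
    qed
  next
    show "T (\<lambda>k\<in>{..<m}. \<alpha> e k) \<in> lp_carrier (ereal p)" if "e \<in> F" for e
      using \<alpha>[OF that] by (intro lp_multilinear_carrier[OF T])
    show "(\<Sum>e\<in>F. (\<Sum>d<D. norm (T (\<lambda>k\<in>{..<m}. P J e k) d) powr p) powr (r / p)) \<le> C" for J D
      unfolding PT by (rule le)
  qed
qed

section \<open>Normalised multiple summability for operators\<close>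

lemma uniform_bound:
  fixes A :: "nat \<Rightarrow> (nat \<Rightarrow> nat \<Rightarrow> 'k) \<Rightarrow> nat \<Rightarrow> 'k"
  assumes A: "\<And>k. k < m \<Longrightarrow> lp_multilinear n \<infinity> 1 (A k)" and n: "n \<ge> 1"
  shows "\<exists>M>0. \<forall>k<m. \<forall>x. (\<forall>l<n. x l \<in> lp_carrier \<infinity>) \<longrightarrow>
    lp_norm 1 (A k (\<lambda>l\<in>{..<n}. x l)) \<le> M * (\<Prod>l<n. lp_norm \<infinity> (x l))"
proof -
  have "\<forall>k\<in>{..<m}. \<exists>M>0. \<forall>x. (\<forall>l<n. x l \<in> lp_carrier \<infinity>) \<longrightarrow> lp_norm 1 (A k (\<lambda>l\<in>{..<n}. x l)) \<le> M * (\<Prod>l<n. lp_norm \<infinity> (x l))"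
    using lp_multilinear_bounded[OF A n] by blast
  from bchoice[OF this] obtain M where M: "\<forall>k\<in>{..<m}. M k > 0 \<and> (\<forall>x. (\<forall>l<n. x l \<in> lp_carrier \<infinity>) \<longrightarrow>
      lp_norm 1 (A k (\<lambda>l\<in>{..<n}. x l)) \<le> M k * (\<Prod>l<n. lp_norm \<infinity> (x l)))" by blast
  show ?thesis
  proof (intro exI[of _ "1 + (\<Sum>k<m. M k)"] conjI allI impI)
    show "0 < 1 + (\<Sum>k<m. M k)" using M by (intro add_pos_nonneg sum_nonneg) (auto intro: less_imp_le)
    fix k and x :: "nat \<Rightarrow> nat \<Rightarrow> 'k" assume k: "k < m" and x: "\<forall>l<n. x l \<in> lp_carrier \<infinity>"
    have "M k \<le> (\<Sum>k<m. M k)" using M k by (intro member_le_sum) (auto intro: less_imp_le)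
    moreover have "0 \<le> (\<Prod>l<n. lp_norm \<infinity> (x l))" using x by (intro prod_nonneg) (auto intro: lp_norm_nonneg)
    ultimately have "M k * (\<Prod>l<n. lp_norm \<infinity> (x l)) \<le> (1 + (\<Sum>k<m. M k)) * (\<Prod>l<n. lp_norm \<infinity> (x l))"
      by (intro mult_right_mono) auto
    moreover have "lp_norm 1 (A k (\<lambda>l\<in>{..<n}. x l)) \<le> M k * (\<Prod>l<n. lp_norm \<infinity> (x l))" using M k x by blast
    ultimately show "lp_norm 1 (A k (\<lambda>l\<in>{..<n}. x l)) \<le> (1 + (\<Sum>k<m. M k)) * (\<Prod>l<n. lp_norm \<infinity> (x l))"
      by linarith
  qed
qed

lemma norm_rescaled_sum:
  assumes "MA > 0" "MT > 0"
  shows "norm (\<Sum>js\<in>W. (\<Prod>k<m. \<iota> (a k (js ! k)) / of_real MA) * (\<iota> (t js) / of_real MT))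
    = norm (\<Sum>js\<in>W. (\<Prod>k<m. a k (js ! k)) * t js) / (MA ^ m * MT)"
proof -
  have "(\<Sum>js\<in>W. (\<Prod>k<m. \<iota> (a k (js ! k)) / of_real MA) * (\<iota> (t js) / of_real MT))
    = \<iota> (\<Sum>js\<in>W. (\<Prod>k<m. a k (js ! k)) * t js) / (of_real MA ^ m * of_real MT)"
    by (simp add: \<iota>_sum \<iota>_mult \<iota>_prod prod_dividef sum_divide_distrib)
  then show ?thesis using assms by (simp add: norm_divide norm_mult norm_power)
qed

lemma rescaled_powr:
  assumes p: "0 < (p::real)" and c: "0 < c" and D: "finite D"
  shows "(\<Sum>d\<in>D. (norm (y d) / c) powr p) powr (r / p) = (\<Sum>d\<in>D. norm (y d) powr p) powr (r / p) / c powr r"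
  using assms by (simp add: powr_divide sum_divide_distrib[symmetric] powr_powr sum_nonneg)

lemma unit_vec_image:
  fixes T :: "(nat \<Rightarrow> nat \<Rightarrow> 'k) \<Rightarrow> nat \<Rightarrow> 'k"
  assumes T: "lp_multilinear m 1 (ereal p) T" and p: "1 \<le> p" and MT: "MT > 0"
    and bd: "\<And>x. (\<And>l. l < m \<Longrightarrow> x l \<in> lp_carrier 1) \<Longrightarrow> lp_norm (ereal p) (T (\<lambda>l\<in>{..<m}. x l)) \<le> MT * (\<Prod>l<m. lp_norm 1 (x l))"
    and D: "finite D"
  shows "(\<Sum>d\<in>D. norm (\<iota> (T (\<lambda>k\<in>{..<m}. unit_vec (js ! k)) d) / of_real MT) powr p) \<le> 1"
proof -
  define y where "y = T (\<lambda>k\<in>{..<m}. unit_vec (js ! k))"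
  have y: "y \<in> lp_carrier (ereal p)" unfolding y_def by (intro lp_multilinear_carrier[OF T] unit_vec_carrier)
  have "lp_norm (ereal p) y \<le> MT"
    unfolding y_def using bd[of "\<lambda>k. unit_vec (js ! k)"] unit_vec_carrier by (simp add: unit_vec_norm)
  then have "lp_norm (ereal p) y powr p \<le> MT powr p"
    using p lp_norm_nonneg[OF _ y] by (intro powr_mono2) auto
  then have "(\<Sum>d\<in>D. norm (y d) powr p) \<le> MT powr p"
    using sum_powr_le_lp_norm[OF p y D] by linarith
  then have "(\<Sum>d\<in>D. norm (y d) powr p) / MT powr p \<le> 1" using MT by simp
  then show ?thesis using MT
    by (simp add: y_def norm_divide powr_divide sum_divide_distrib)
qed

text \<open>The hypothesis on \<open>x\<close> is the weak 1-norm bound as seen by the coordinate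
  functionals. Division by \<open>MA\<close> and \<open>MT\<close> normalises the coefficients; the
  finite bound is independent of \<open>N\<close>, \<open>J\<close> and \<open>D\<close>, and the
  scaling returns as \<open>c powr r\<close>.\<close>

lemma multiple_summing_core:
  fixes T :: "(nat \<Rightarrow> nat \<Rightarrow> 'k) \<Rightarrow> nat \<Rightarrow> 'k" and A :: "nat \<Rightarrow> (nat \<Rightarrow> nat \<Rightarrow> 'k) \<Rightarrow> nat \<Rightarrow> 'k"
  assumes m: "m \<ge> 1" and n: "n \<ge> 1" and p: "1 < p"
    and T: "lp_multilinear m 1 (ereal p) T" and A: "\<And>k. k < m \<Longrightarrow> lp_multilinear n \<infinity> 1 (A k)"
    and \<theta>: "\<theta> = (if p \<le> 2 then 2 - 2 / p else 2 / p)" and r: "1 / r = 1/2 + \<theta> / (2 * real n)"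
  shows "\<exists>C\<ge>0. \<forall>(N::nat) x. (\<forall>k<m. \<forall>l<n. (\<forall>i<N. x k l i \<in> lp_carrier \<infinity>) \<and> (\<forall>c. (\<Sum>i<N. norm (x k l i c)) \<le> 1)) \<longrightarrow>
     (\<Sum>is\<in>words (words {..<N} n) m. lp_norm (ereal p) (T (\<lambda>k\<in>{..<m}. A k (\<lambda>l\<in>{..<n}. x k l (is ! k ! l)))) powr r) \<le> C"
proof -
  obtain MA where MA0: "MA > 0" and MA1: "\<forall>k<m. \<forall>x. (\<forall>l<n. x l \<in> lp_carrier \<infinity>) \<longrightarrow>
    lp_norm 1 (A k (\<lambda>l\<in>{..<n}. x l)) \<le> MA * (\<Prod>l<n. lp_norm \<infinity> (x l))"
    using uniform_bound[of m n A, OF A n] by blast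
  obtain MT where MT0: "MT > 0" and MT1: "\<forall>x. (\<forall>l<m. x l \<in> lp_carrier 1) \<longrightarrow>
    lp_norm (ereal p) (T (\<lambda>l\<in>{..<m}. x l)) \<le> MT * (\<Prod>l<m. lp_norm 1 (x l))"
    using lp_multilinear_bounded[OF T m] by blast
  note MA = MA0 MA1[rule_format] and MT = MT0 MT1[rule_format]
  define c where "c = MA ^ m * MT"
  have c: "c > 0" using MA(1) MT(1) by (simp add: c_def)
  have \<theta>0: "0 < \<theta>" using p by (auto simp: \<theta> field_simps)
  have r0: "r > 0"
  proof -
    have "1 / r > 0" using r \<theta>0 by (simp add: add_pos_nonneg)
    then show ?thesis by simp
  qed
  define C where "C = c powr r * (2 ^ (n * m) + blei_const n ^ m) powr r"
  have "(\<Sum>is\<in>words (words {..<N} n) m. lp_norm (ereal p) (T (\<lambda>k\<in>{..<m}. A k (\<lambda>l\<in>{..<n}. x k l (is ! k ! l)))) powr r) \<le> C"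
    if x: "\<forall>k<m. \<forall>l<n. (\<forall>i<N. x k l i \<in> lp_carrier \<infinity>) \<and> (\<forall>c. (\<Sum>i<N. norm (x k l i c)) \<le> 1)" for N :: nat and x
  proof (rule truncation_limit[OF T])
    fix e k assume e: "e \<in> words (words {..<N} n) m" and k: "k < m"
    show "A k (\<lambda>l\<in>{..<n}. x k l (e ! k ! l)) \<in> lp_carrier 1"
      using x k words_nth[OF words_nth[OF e k]] by (intro lp_multilinear_carrier[OF A]) auto
  next
    fix J D :: nat
    define a where "a = (\<lambda>k xs j. \<iota> (A k (\<lambda>l\<in>{..<n}. x k l (xs ! l)) j) / of_real MA)"
    define t where "t = (\<lambda>js d. \<iota> (T (\<lambda>k\<in>{..<m}. unit_vec (js ! k)) d) / of_real MT)"
    have "(\<Sum>is\<in>words (words {..<N} n) m.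
      (\<Sum>d<D. norm (\<Sum>js\<in>words {..<J} m. (\<Prod>k<m. a k (is ! k) (js ! k)) * t js d) powr p) powr (r / p))
      \<le> (2 ^ (n * m) + blei_const n ^ m) powr r"
    proof (rule multiple_summing_finite[OF n p _ _ _ \<theta> r])
      show "tensor_bounded n {..<N} {..<J} (a k)" if k: "k < m" for k
        unfolding a_def
      proof (rule tensor_bounded_multilinear[OF A[OF k] MA(1) MA(2)[OF k]])
        fix \<epsilon> :: "nat \<Rightarrow> real" and l c assume l: "l < n" and \<epsilon>: "\<forall>i<N. \<bar>\<epsilon> i\<bar> \<le> 1"
        have "norm (\<Sum>i<N. of_real (\<epsilon> i) * x k l i c) \<le> (\<Sum>i<N. norm (x k l i c))"
          using \<epsilon> by (intro sum_norm_le) (simp add: norm_mult mult_left_le_one_le)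
        also have "\<dots> \<le> 1" using x k l by blast
        finally show "norm (\<Sum>i<N. of_real (\<epsilon> i) * x k l i c) \<le> 1" .
      qed (use x k in auto)
      show "(\<Sum>d<D. norm (t js d) powr p) \<le> 1" for js
        unfolding t_def using p by (intro unit_vec_image[OF T _ MT]) auto
    qed auto
    moreover define y where "y = (\<lambda>is d. \<Sum>js\<in>words {..<J} m. (\<Prod>k<m. A k (\<lambda>l\<in>{..<n}. x k l (is ! k ! l)) (js ! k)) *
        T (\<lambda>k\<in>{..<m}. unit_vec (js ! k)) d)"
    moreover have "norm (\<Sum>js\<in>words {..<J} m. (\<Prod>k<m. a k (is ! k) (js ! k)) * t js d) = norm (y is d) / c" for "is" d
      unfolding a_def t_def y_def c_def
      by (rule norm_rescaled_sum[where a = "\<lambda>k. A k (\<lambda>l\<in>{..<n}. x k l (is ! k ! l))", OF MA(1) MT(1)])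
    moreover have "(\<Sum>d<D. (norm (y is d) / c) powr p) powr (r / p) = (\<Sum>d<D. norm (y is d) powr p) powr (r / p) / c powr r" for "is"
      using p c by (intro rescaled_powr) auto
    ultimately have "(\<Sum>is\<in>words (words {..<N} n) m. (\<Sum>d<D. norm (y is d) powr p) powr (r / p)) / c powr r \<le> (2 ^ (n * m) + blei_const n ^ m) powr r"
      by (simp add: sum_divide_distrib)
    then have "(\<Sum>is\<in>words (words {..<N} n) m. (\<Sum>d<D. norm (y is d) powr p) powr (r / p)) \<le> C"
      using c by (simp add: C_def pos_divide_le_eq mult.commute)
    then show "(\<Sum>is\<in>words (words {..<N} n) m. (\<Sum>d<D. norm (\<Sum>js\<in>words {..<J} m. (\<Prod>k<m. A k (\<lambda>l\<in>{..<n}. x k l (is ! k ! l)) (js ! k)) *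
        T (\<lambda>k\<in>{..<m}. unit_vec (js ! k)) d) powr p) powr (r / p)) \<le> C"
      by (simp only: y_def)
  qed (use p r0 in \<open>auto intro: finite_words\<close>)
  moreover have "C \<ge> 0" by (simp add: C_def)
  ultimately show ?thesis by blast
qed

lemma l1_square_summable:
  fixes z :: "'i \<Rightarrow> nat \<Rightarrow> 'k"
  assumes F: "finite F" and z: "\<And>i. i \<in> F \<Longrightarrow> z i \<in> lp_carrier 1" and c: "c > 0"
    and le: "\<And>J. (\<Sum>i\<in>F. (\<Sum>j<J. norm (\<iota> (z i j) / of_real c))\<^sup>2) \<le> C"
  shows "(\<Sum>i\<in>F. (lp_norm 1 (z i))\<^sup>2) \<le> c\<^sup>2 * C"
proof -
  have "(\<Sum>i\<in>F. lp_norm (ereal 1) (z i) powr 2) \<le> c\<^sup>2 * C"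
  proof (rule lp_norm_powr_fatou[OF F, where y = "\<lambda>_. z"])
    fix D :: nat
    have "(\<Sum>i\<in>F. (\<Sum>j<D. norm (\<iota> (z i j) / of_real c))\<^sup>2) = (\<Sum>i\<in>F. (\<Sum>j<D. norm (z i j))\<^sup>2) / c\<^sup>2"
      using c by (simp add: norm_divide sum_divide_distrib[symmetric] power_divide)
    then have "(\<Sum>i\<in>F. (\<Sum>j<D. norm (z i j))\<^sup>2) / c\<^sup>2 \<le> C"
      using le[of D] by (simp only:)
    then have "(\<Sum>i\<in>F. (\<Sum>j<D. norm (z i j))\<^sup>2) \<le> c\<^sup>2 * C"
      using c by (simp add: pos_divide_le_eq mult.commute)
    then show "(\<Sum>i\<in>F. (\<Sum>d<D. norm (z i d) powr 1) powr (2 / 1)) \<le> c\<^sup>2 * C"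
      by (simp add: sum_nonneg)
  qed (use z in \<open>auto simp flip: one_ereal_def\<close>)
  moreover have "lp_norm (ereal 1) (z i) powr 2 = (lp_norm 1 (z i))\<^sup>2" if "i \<in> F" for i
    using lp_norm_nonneg[OF _ z[OF that]] by (simp flip: one_ereal_def)
  ultimately show ?thesis by simp
qed

text \<open>After the norm bound for \<open>T\<close> each summand is a product over the blocks
  \<open>k\<close>, so the sum over all multi-indices factors into square sums, each controlled by
  cotype uniformly in the truncation \<open>J\<close>.\<close>

lemma multiple_summing_core_endpoint:
  fixes T :: "(nat \<Rightarrow> nat \<Rightarrow> 'k) \<Rightarrow> nat \<Rightarrow> 'k" and A :: "nat \<Rightarrow> (nat \<Rightarrow> nat \<Rightarrow> 'k) \<Rightarrow> nat \<Rightarrow> 'k"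
  assumes m: "m \<ge> 1" and n: "n \<ge> 1"
    and T: "lp_multilinear m 1 p T" and A: "\<And>k. k < m \<Longrightarrow> lp_multilinear n \<infinity> 1 (A k)"
  shows "\<exists>C\<ge>0. \<forall>(N::nat) x. (\<forall>k<m. \<forall>l<n. (\<forall>i<N. x k l i \<in> lp_carrier \<infinity>) \<and> (\<forall>c. (\<Sum>i<N. norm (x k l i c)) \<le> 1)) \<longrightarrow>
     (\<Sum>is\<in>words (words {..<N} n) m. lp_norm p (T (\<lambda>k\<in>{..<m}. A k (\<lambda>l\<in>{..<n}. x k l (is ! k ! l)))) powr 2) \<le> C"
proof -
  have p: "1 \<le> p" using T by (simp add: lp_multilinear_def)
  obtain MA where MA0: "MA > 0" and MA1: "\<forall>k<m. \<forall>x. (\<forall>l<n. x l \<in> lp_carrier \<infinity>) \<longrightarrow>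
    lp_norm 1 (A k (\<lambda>l\<in>{..<n}. x l)) \<le> MA * (\<Prod>l<n. lp_norm \<infinity> (x l))"
    using uniform_bound[of m n A, OF A n] by blast
  obtain MT where MT0: "MT > 0" and MT1: "\<forall>x. (\<forall>l<m. x l \<in> lp_carrier 1) \<longrightarrow>
    lp_norm p (T (\<lambda>l\<in>{..<m}. x l)) \<le> MT * (\<Prod>l<m. lp_norm 1 (x l))"
    using lp_multilinear_bounded[OF T m] by blast
  note MA = MA0 MA1[rule_format] and MT = MT0 MT1[rule_format]
  define C where "C = MT\<^sup>2 * (MA\<^sup>2 * 4 ^ n) ^ m"
  have "(\<Sum>is\<in>words (words {..<N} n) m. lp_norm p (T (\<lambda>k\<in>{..<m}. A k (\<lambda>l\<in>{..<n}. x k l (is ! k ! l)))) powr 2) \<le> C"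
    if x: "\<forall>k<m. \<forall>l<n. (\<forall>i<N. x k l i \<in> lp_carrier \<infinity>) \<and> (\<forall>c. (\<Sum>i<N. norm (x k l i c)) \<le> 1)" for N :: nat and x
  proof -
    define \<alpha> where "\<alpha> = (\<lambda>k xs. A k (\<lambda>l\<in>{..<n}. x k l (xs ! l)))"
    have \<alpha>c: "\<alpha> k xs \<in> lp_carrier 1" if "k < m" "xs \<in> words {..<N} n" for k xs
      unfolding \<alpha>_def using x that words_nth[OF that(2)] by (intro lp_multilinear_carrier[OF A]) auto
    have sq: "(\<Sum>xs\<in>words {..<N} n. (lp_norm 1 (\<alpha> k xs))\<^sup>2) \<le> MA\<^sup>2 * 4 ^ n" if k: "k < m" for k
    proof (rule l1_square_summable[OF _ \<alpha>c MA(1)])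
      fix J :: nat
      have "tensor_bounded n {..<N} {..<J} (\<lambda>xs j. \<iota> (\<alpha> k xs j) / of_real MA)"
        unfolding \<alpha>_def
      proof (rule tensor_bounded_multilinear[OF A[OF k] MA(1) MA(2)[OF k]])
        fix \<epsilon> :: "nat \<Rightarrow> real" and l c assume l: "l < n" and \<epsilon>: "\<forall>i<N. \<bar>\<epsilon> i\<bar> \<le> 1"
        have "norm (\<Sum>i<N. of_real (\<epsilon> i) * x k l i c) \<le> (\<Sum>i<N. norm (x k l i c))"
          using \<epsilon> by (intro sum_norm_le) (simp add: norm_mult mult_left_le_one_le)
        also have "\<dots> \<le> 1" using x k l by blast
        finally show "norm (\<Sum>i<N. of_real (\<epsilon> i) * x k l i c) \<le> 1" .
      qed (use x k in auto)
      then show "(\<Sum>xs\<in>words {..<N} n. (\<Sum>j<J. norm (\<iota> (\<alpha> k xs j) / of_real MA))\<^sup>2) \<le> 4 ^ n"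
        by (intro tensor_cotype) auto
    qed (use k in \<open>auto intro: finite_words\<close>)
    have "(\<Sum>is\<in>words (words {..<N} n) m. lp_norm p (T (\<lambda>k\<in>{..<m}. \<alpha> k (is ! k))) powr 2)
      \<le> (\<Sum>is\<in>words (words {..<N} n) m. MT\<^sup>2 * (\<Prod>k<m. (lp_norm 1 (\<alpha> k (is ! k)))\<^sup>2))"
    proof (rule sum_mono)
      fix "is" assume "is": "is \<in> words (words {..<N} n) m"
      have c: "\<alpha> k (is ! k) \<in> lp_carrier 1" if "k < m" for k using \<alpha>c[OF that words_nth[OF "is" that]] .
      have "lp_norm p (T (\<lambda>k\<in>{..<m}. \<alpha> k (is ! k))) \<le> MT * (\<Prod>k<m. lp_norm 1 (\<alpha> k (is ! k)))"
        using c by (intro MT(2))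
      moreover have nn: "0 \<le> lp_norm p (T (\<lambda>k\<in>{..<m}. \<alpha> k (is ! k)))"
        using c by (intro lp_norm_nonneg p lp_multilinear_carrier[OF T])
      ultimately have "(lp_norm p (T (\<lambda>k\<in>{..<m}. \<alpha> k (is ! k))))\<^sup>2 \<le> (MT * (\<Prod>k<m. lp_norm 1 (\<alpha> k (is ! k))))\<^sup>2"
        by (intro power_mono)
      then show "lp_norm p (T (\<lambda>k\<in>{..<m}. \<alpha> k (is ! k))) powr 2 \<le> MT\<^sup>2 * (\<Prod>k<m. (lp_norm 1 (\<alpha> k (is ! k)))\<^sup>2)"
        using nn by (simp add: power_mult_distrib prod_power_distrib)
    qed
    also have "\<dots> = MT\<^sup>2 * (\<Prod>k<m. \<Sum>xs\<in>words {..<N} n. (lp_norm 1 (\<alpha> k xs))\<^sup>2)"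
      unfolding sum_distrib_left[symmetric] sum_prod_words[where f = "\<lambda>k xs. (lp_norm 1 (\<alpha> k xs))\<^sup>2"] ..
    also have "\<dots> \<le> MT\<^sup>2 * (\<Prod>k<m. MA\<^sup>2 * 4 ^ n)"
      using sq by (intro mult_left_mono prod_mono) (auto intro: sum_nonneg)
    finally show ?thesis by (simp add: C_def \<alpha>_def)
  qed
  moreover have "C \<ge> 0" by (simp add: C_def)
  ultimately show ?thesis by blast
qed

section \<open>Finitely valued approximation and normalised absolute summability\<close>

text \<open>Rounding real and imaginary parts to a grid of mesh \<open>\<delta>/2\<close> leaves
  finitely many patterns of values. \<open>\<rho>\<close> sends each coordinate to a chosen one with
  the same pattern, simultaneously for all \<open>f e\<close>, which moves each part of a value by
  at most \<open>\<delta>/2\<close>.\<close>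

lemma simple_approximation:
  fixes f :: "'e \<Rightarrow> nat \<Rightarrow> 'k"
  assumes E: "finite E" and f: "\<And>e. e \<in> E \<Longrightarrow> f e \<in> lp_carrier \<infinity>" and \<delta>: "\<delta> > 0"
  shows "\<exists>(\<rho> :: nat \<Rightarrow> nat) (R :: nat). (\<forall>c. \<rho> c < R) \<and> (\<forall>e\<in>E. \<forall>c. norm (f e (\<rho> c) - f e c) \<le> \<delta>)"
proof -
  define u where "u = (\<lambda>e c. \<lfloor>Re (\<iota> (f e c)) * (2 / \<delta>)\<rfloor>)"
  define v where "v = (\<lambda>e c. \<lfloor>Im (\<iota> (f e c)) * (2 / \<delta>)\<rfloor>)"
  define g where "g = (\<lambda>c. \<lambda>e\<in>E. (u e c, v e c))"
  have fl: "\<lfloor>y * (2 / \<delta>)\<rfloor> \<in> {- \<lceil>b * (2 / \<delta>)\<rceil> - 1..\<lceil>b * (2 / \<delta>)\<rceil>}" if "\<bar>y\<bar> \<le> b" for y b :: real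
  proof -
    have "\<bar>y * (2 / \<delta>)\<bar> = \<bar>y\<bar> * (2 / \<delta>)" using \<delta> by (simp add: abs_mult)
    also have "\<dots> \<le> b * (2 / \<delta>)" using that \<delta> by (intro mult_right_mono) auto
    finally have "- (b * (2 / \<delta>)) \<le> y * (2 / \<delta>)" "y * (2 / \<delta>) \<le> b * (2 / \<delta>)" by linarith+
    then show ?thesis unfolding atLeastAtMost_iff by linarith
  qed
  have "\<exists>B::int. \<forall>c. u e c \<in> {- B - 1..B} \<and> v e c \<in> {- B - 1..B}" if e: "e \<in> E" for e
  proof -
    obtain b where b: "\<And>c. norm (f e c) \<le> b" using f[OF e] by (auto simp: lp_carrier_infty bounded_iff)
    have "\<bar>Re (\<iota> (f e c))\<bar> \<le> b" "\<bar>Im (\<iota> (f e c))\<bar> \<le> b" for c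
      using b[of c] abs_Re_le_cmod[of "\<iota> (f e c)"] abs_Im_le_cmod[of "\<iota> (f e c)"] by auto
    then show ?thesis unfolding u_def v_def
      by (intro exI[of _ "\<lceil>b * (2 / \<delta>)\<rceil>"] allI conjI fl)
  qed
  then obtain B where B: "\<And>e c. e \<in> E \<Longrightarrow> u e c \<in> {- B e - 1..B e} \<and> v e c \<in> {- B e - 1..B e}" by metis
  have "range g \<subseteq> (\<Pi>\<^sub>E e\<in>E. {- B e - 1..B e} \<times> {- B e - 1..B e})"
    using B by (auto simp: g_def)
  then have fg: "finite (range g)" by (rule finite_subset) (auto intro!: finite_PiE E)
  define h where "h = (\<lambda>y. SOME c. g c = y)"
  define \<rho> where "\<rho> = (\<lambda>c. h (g c))"
  have g\<rho>: "g (\<rho> c) = g c" for c unfolding \<rho>_def h_def by (rule someI[of _ c]) simp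
  have "finite (range \<rho>)" using finite_imageI[OF fg, of h] by (simp add: \<rho>_def image_image)
  then obtain R where R: "\<And>c. \<rho> c < R" using finite_nat_set_iff_bounded[of "range \<rho>"] by auto
  have "norm (f e (\<rho> c) - f e c) \<le> \<delta>" if e: "e \<in> E" for e c
  proof -
    have uv: "u e (\<rho> c) = u e c" "v e (\<rho> c) = v e c"
      using fun_cong[OF g\<rho>[of c], of e] e by (auto simp: g_def)
    have fd: "\<bar>x - y\<bar> \<le> \<delta> / 2" if "\<lfloor>x * (2 / \<delta>)\<rfloor> = \<lfloor>y * (2 / \<delta>)\<rfloor>" for x y :: real
    proof -
      have "\<bar>x * (2 / \<delta>) - y * (2 / \<delta>)\<bar> \<le> 1" using that by linarith
      moreover have "\<bar>x * (2 / \<delta>) - y * (2 / \<delta>)\<bar> = \<bar>x - y\<bar> * (2 / \<delta>)"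
        using \<delta> unfolding left_diff_distrib[symmetric] abs_mult by simp
      ultimately have "\<bar>x - y\<bar> * (2 / \<delta>) \<le> 1" by simp
      then show ?thesis using \<delta> by (simp add: field_simps)
    qed
    have "norm (f e (\<rho> c) - f e c) = norm (\<iota> (f e (\<rho> c)) - \<iota> (f e c))" by (simp flip: \<iota>_diff)
    also have "\<dots> \<le> \<bar>Re (\<iota> (f e (\<rho> c))) - Re (\<iota> (f e c))\<bar> + \<bar>Im (\<iota> (f e (\<rho> c))) - Im (\<iota> (f e c))\<bar>"
      using cmod_le[of "\<iota> (f e (\<rho> c)) - \<iota> (f e c)"] by simp
    also have "\<dots> \<le> \<delta> / 2 + \<delta> / 2" using uv unfolding u_def v_def by (intro add_mono fd)
    finally show ?thesis by simp
  qed
  then show ?thesis using R by blast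
qed

end

context scalar_embedding
begin

text \<open>Arguments composed with \<open>\<rho>\<close> are finite combinations of disjoint
  indicators. Signed combinations of these stay in the unit ball, so \<open>A\<close> has a bounded
  coefficient tensor on them, while the coefficients, as vectors in \<open>i\<close>, lie in the
  Hilbert space unit ball by the weak 2-norm hypothesis. The constant is independent of
  \<open>R\<close>.\<close>

lemma simple_hilbert_summing:
  fixes A :: "(nat \<Rightarrow> nat \<Rightarrow> 'k) \<Rightarrow> nat \<Rightarrow> 'k" and x :: "nat \<Rightarrow> nat \<Rightarrow> nat \<Rightarrow> 'k"
  assumes n: "n \<ge> 2" and A: "lp_multilinear n \<infinity> 1 A" and MA: "MA > 0"
    and bd: "\<And>x. (\<And>l. l < n \<Longrightarrow> x l \<in> lp_carrier \<infinity>) \<Longrightarrow> lp_norm 1 (A (\<lambda>l\<in>{..<n}. x l)) \<le> MA * (\<Prod>l<n. lp_norm \<infinity> (x l))"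
    and \<rho>: "\<And>c. \<rho> c < R" and x: "\<And>l c. l < n \<Longrightarrow> (\<Sum>i<M. (norm (x l i c))\<^sup>2) \<le> 1"
  shows "hilbert_summing 1 (512 * (512 * 32 ^ (n - 2))) {..<M} {..<J::nat}
    (\<lambda>i j. \<iota> (A (\<lambda>l\<in>{..<n}. \<lambda>c. x l i (\<rho> c)) j) / of_real MA)"
proof -
  define ind :: "nat \<Rightarrow> nat \<Rightarrow> 'k" where "ind = (\<lambda>r c. if \<rho> c = r then 1 else 0)"
  have ind: "ind r \<in> lp_carrier \<infinity>" for r by (rule lp_carrier_infty_bounded[of _ 1]) (simp add: ind_def)
  have sum_ind: "(\<Sum>r<R. f r * ind r c) = f (\<rho> c)" for f :: "nat \<Rightarrow> 'k" and c
    using \<rho>[of c] by (simp add: ind_def if_distrib[where f = "\<lambda>x. _ * x"] cong: if_cong)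
  define a where "a = (\<lambda>rs j. \<iota> (A (\<lambda>l\<in>{..<n}. ind (rs ! l)) j) / of_real MA)"
  have "tensor_bounded n {..<R} {..<J} a"
    unfolding a_def
  proof (rule tensor_bounded_multilinear[OF A MA bd])
    fix \<epsilon> :: "nat \<Rightarrow> real" and l c assume "\<forall>i<R. \<bar>\<epsilon> i\<bar> \<le> 1"
    then show "norm (\<Sum>i<R. of_real (\<epsilon> i) * ind i c) \<le> 1" using \<rho> by (simp add: sum_ind)
  qed (use ind in auto)
  then have "hilbert_summing 1 (512 * (512 * 32 ^ (n - 2))) {..<M} {..<J}
     (\<lambda>i j. \<Sum>rs\<in>words {..<R} n. (\<Prod>l<n. \<iota> (x l i (rs ! l))) * a rs j)"
    using x by (intro grothendieck_rows_summing n) (auto simp: l2_le_1_iff)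
  moreover have "\<iota> (A (\<lambda>l\<in>{..<n}. \<lambda>c. x l i (\<rho> c)) j) / of_real MA = (\<Sum>rs\<in>words {..<R} n. (\<Prod>l<n. \<iota> (x l i (rs ! l))) * a rs j)" for i j
  proof -
    have "A (\<lambda>l\<in>{..<n}. \<lambda>c. \<Sum>r<R. x l i r * ind r c)
      = (\<lambda>j. \<Sum>rs\<in>words {..<R} n. (\<Prod>l<n. x l i (rs ! l)) * A (\<lambda>l\<in>{..<n}. ind (rs ! l)) j)"
      by (rule lp_multilinear_expand[OF A]) (use ind in auto)
    then show ?thesis unfolding sum_ind by (simp add: a_def \<iota>_sum \<iota>_mult \<iota>_prod sum_divide_distrib)
  qed
  ultimately show ?thesis by simp
qed

lemma lp_norm_powr_limit:
  fixes y :: "nat \<Rightarrow> 'i \<Rightarrow> nat \<Rightarrow> 'k"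
  assumes F: "finite F" and q: "1 \<le> q" and r: "0 < r"
    and y: "\<And>\<nu> i. i \<in> F \<Longrightarrow> y \<nu> i \<in> lp_carrier (ereal q)" and z: "\<And>i. i \<in> F \<Longrightarrow> z i \<in> lp_carrier (ereal q)"
    and lim: "\<And>i. i \<in> F \<Longrightarrow> (\<lambda>\<nu>. lp_norm (ereal q) (\<lambda>d. y \<nu> i d - z i d)) \<longlonglongrightarrow> 0"
    and le: "\<And>\<nu>. (\<Sum>i\<in>F. lp_norm (ereal q) (y \<nu> i) powr r) \<le> C"
  shows "(\<Sum>i\<in>F. lp_norm (ereal q) (z i) powr r) \<le> C"
proof (rule lp_norm_powr_fatou[OF F q r, where y = y])
  show "(\<lambda>\<nu>. y \<nu> i d) \<longlonglongrightarrow> z i d" if "i \<in> F" for i d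
    by (rule lp_norm_tendsto_pointwise[OF _ _ _ lim[OF that]]) (use q y[OF that] z[OF that] in auto)
  show "(\<Sum>i\<in>F. (\<Sum>d<D. norm (y \<nu> i d) powr q) powr (r / q)) \<le> C" for \<nu> D
  proof (rule order_trans[OF sum_mono le[of \<nu>]])
    fix i assume i: "i \<in> F"
    have "(\<Sum>d<D. norm (y \<nu> i d) powr q) powr (r / q) \<le> (lp_norm (ereal q) (y \<nu> i) powr q) powr (r / q)"
      using q r by (intro powr_mono2 sum_powr_le_lp_norm y[OF i]) (auto intro: sum_nonneg)
    then show "(\<Sum>d<D. norm (y \<nu> i d) powr q) powr (r / q) \<le> lp_norm (ereal q) (y \<nu> i) powr r"
      using q by (simp add: powr_powr)
  qed
qed (use z in auto)

lemma simple_sequence: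
  fixes f :: "'e \<Rightarrow> nat \<Rightarrow> 'k"
  assumes E: "finite E" and f: "\<And>e. e \<in> E \<Longrightarrow> f e \<in> lp_carrier \<infinity>"
  shows "\<exists>\<rho> R. (\<forall>\<nu> c. \<rho> \<nu> c < (R \<nu> :: nat)) \<and> (\<forall>e\<in>E. (\<lambda>\<nu>. lp_norm \<infinity> (\<lambda>c. f e (\<rho> \<nu> c) - f e c)) \<longlonglongrightarrow> 0)"
proof -
  have "\<exists>\<rho>R. (\<forall>c. fst \<rho>R c < (snd \<rho>R :: nat)) \<and> (\<forall>e\<in>E. \<forall>c. norm (f e (fst \<rho>R c) - f e c) \<le> 1 / real (Suc \<nu>))" for \<nu>
  proof -
    have "\<exists>(\<rho> :: nat \<Rightarrow> nat) (R :: nat). (\<forall>c. \<rho> c < R) \<and> (\<forall>e\<in>E. \<forall>c. norm (f e (\<rho> c) - f e c) \<le> 1 / real (Suc \<nu>))"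
      by (rule simple_approximation[OF E]) (simp_all add: f)
    then obtain \<rho> :: "nat \<Rightarrow> nat" and R :: nat
      where "\<forall>c. \<rho> c < R" "\<forall>e\<in>E. \<forall>c. norm (f e (\<rho> c) - f e c) \<le> 1 / real (Suc \<nu>)" by (elim exE conjE)
    then show ?thesis by (intro exI[of _ "(\<rho>, R)"] conjI) simp_all
  qed
  then have "\<forall>\<nu>. \<exists>\<rho>R. (\<forall>c. fst \<rho>R c < (snd \<rho>R :: nat)) \<and> (\<forall>e\<in>E. \<forall>c. norm (f e (fst \<rho>R c) - f e c) \<le> 1 / real (Suc \<nu>))"
    by (rule allI)
  from choice[OF this] obtain g where g': "\<forall>\<nu>. (\<forall>c. fst (g \<nu>) c < (snd (g \<nu>) :: nat)) \<and>
    (\<forall>e\<in>E. \<forall>c. norm (f e (fst (g \<nu>) c) - f e c) \<le> 1 / real (Suc \<nu>))" by (elim exE)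
  have g: "fst (g \<nu>) c < snd (g \<nu>)" "e \<in> E \<Longrightarrow> norm (f e (fst (g \<nu>) c) - f e c) \<le> 1 / real (Suc \<nu>)" for \<nu> c e
    using g'[rule_format, of \<nu>] by blast+
  have "(\<lambda>\<nu>. lp_norm \<infinity> (\<lambda>c. f e (fst (g \<nu>) c) - f e c)) \<longlonglongrightarrow> 0" if e: "e \<in> E" for e
  proof (rule Lim_null_comparison)
    show "(\<lambda>\<nu>. 1 / real (Suc \<nu>)) \<longlonglongrightarrow> 0" using LIMSEQ_inverse_real_of_nat by (simp add: inverse_eq_divide)
    have "norm (lp_norm \<infinity> (\<lambda>c. f e (fst (g \<nu>) c) - f e c)) \<le> 1 / real (Suc \<nu>)" for \<nu>
    proof -
      have "0 \<le> lp_norm \<infinity> (\<lambda>c. f e (fst (g \<nu>) c) - f e c)"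
        by (rule lp_norm_nonneg) (auto intro: lp_carrier_infty_bounded[OF g(2)[OF e]])
      then show ?thesis using lp_norm_infty_le[of "\<lambda>c. f e (fst (g \<nu>) c) - f e c", OF g(2)[OF e]] by simp
    qed
    then show "\<forall>\<^sub>F \<nu> in sequentially. norm (lp_norm \<infinity> (\<lambda>c. f e (fst (g \<nu>) c) - f e c)) \<le> 1 / real (Suc \<nu>)"
      by simp
  qed
  then show ?thesis using g(1)
    by (intro exI[of _ "\<lambda>\<nu>. fst (g \<nu>)"] exI[of _ "\<lambda>\<nu>. snd (g \<nu>)"] conjI allI ballI)
qed

text \<open>The arguments are composed with maps of \<open>\<nat>\<close> onto finite sets of representatives, which keeps
  their values, hence the weak-norm hypothesis.\<close>

lemma simple_limit:
  fixes A :: "nat \<Rightarrow> (nat \<Rightarrow> nat \<Rightarrow> 'k) \<Rightarrow> nat \<Rightarrow> 'k" and x :: "nat \<Rightarrow> nat \<Rightarrow> nat \<Rightarrow> nat \<Rightarrow> 'k" and M :: nat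
  assumes A: "\<And>k. k < m \<Longrightarrow> lp_multilinear n \<infinity> 1 (A k)"
    and x: "\<And>k l i. k < m \<Longrightarrow> l < n \<Longrightarrow> i < M \<Longrightarrow> x k l i \<in> lp_carrier \<infinity>"
  shows "\<exists>\<rho> R. (\<forall>\<nu> c. \<rho> \<nu> c < (R \<nu> :: nat)) \<and> (\<forall>k<m. \<forall>i<M.
    (\<forall>\<nu>. A k (\<lambda>l\<in>{..<n}. \<lambda>c. x k l i (\<rho> \<nu> c)) \<in> lp_carrier 1) \<and> A k (\<lambda>l\<in>{..<n}. x k l i) \<in> lp_carrier 1 \<and>
    (\<lambda>\<nu>. lp_norm 1 (\<lambda>j. A k (\<lambda>l\<in>{..<n}. \<lambda>c. x k l i (\<rho> \<nu> c)) j - A k (\<lambda>l\<in>{..<n}. x k l i) j)) \<longlonglongrightarrow> 0)"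
proof -
  define E where "E = {..<m} \<times> {..<n} \<times> {..<M}"
  define f where "f = (\<lambda>e. x (fst e) (fst (snd e)) (snd (snd e)))"
  have "finite E" by (simp add: E_def)
  moreover have fc: "f e \<in> lp_carrier \<infinity>" if "e \<in> E" for e using that x by (auto simp: E_def f_def)
  ultimately obtain \<rho> R where \<rho>: "\<forall>\<nu> c. \<rho> \<nu> c < (R \<nu> :: nat)"
    and lim: "\<forall>e\<in>E. (\<lambda>\<nu>. lp_norm \<infinity> (\<lambda>c. f e (\<rho> \<nu> c) - f e c)) \<longlonglongrightarrow> 0"
    using simple_sequence[of E f] by blast
  have c: "(\<lambda>c. x k l i (\<rho> \<nu> c)) \<in> lp_carrier \<infinity>" if kli: "k < m" "l < n" "i < M" for k l i \<nu>
  proof -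
    obtain b where "\<And>c. norm (x k l i c) \<le> b" using x[OF kli] by (auto simp: lp_carrier_infty bounded_iff)
    then show ?thesis by (intro lp_carrier_infty_bounded[of _ b])
  qed
  have l: "(\<lambda>\<nu>. lp_norm \<infinity> (\<lambda>c. x k l i (\<rho> \<nu> c) - x k l i c)) \<longlonglongrightarrow> 0" if "k < m" "l < n" "i < M" for k l i
    using lim[rule_format, of "(k, l, i)"] that by (simp add: E_def f_def)
  show ?thesis
  proof (intro exI[of _ \<rho>] exI[of _ R] conjI allI impI)
    fix k i assume k: "k < m" and i: "i < M"
    show "A k (\<lambda>l\<in>{..<n}. \<lambda>c. x k l i (\<rho> \<nu> c)) \<in> lp_carrier 1" for \<nu>
      by (rule lp_multilinear_carrier[OF A[OF k]]) (rule c[OF k _ i])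
    show "A k (\<lambda>l\<in>{..<n}. x k l i) \<in> lp_carrier 1"
      by (rule lp_multilinear_carrier[OF A[OF k]]) (rule x[OF k _ i])
    show "(\<lambda>\<nu>. lp_norm 1 (\<lambda>j. A k (\<lambda>l\<in>{..<n}. \<lambda>c. x k l i (\<rho> \<nu> c)) j - A k (\<lambda>l\<in>{..<n}. x k l i) j)) \<longlonglongrightarrow> 0"
      by (rule lp_multilinear_tendsto[OF A[OF k]]) (auto intro: x[OF k _ i] c[OF k _ i] l[OF k _ i])
  qed (use \<rho> in blast)
qed

text \<open>Two limits are taken: for a fixed approximation \<open>\<nu>\<close> the l1 arguments of
  \<open>T\<close> are truncated at \<open>J\<close>, and then \<open>\<nu>\<close> tends to
  infinity. Both are possible because \<open>K\<close> depends on \<open>n\<close> alone, not on the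
  number \<open>R \<nu>\<close> of representatives or on \<open>J\<close>.\<close>

lemma absolutely_summing_core:
  fixes T :: "(nat \<Rightarrow> nat \<Rightarrow> 'k) \<Rightarrow> nat \<Rightarrow> 'k" and A :: "nat \<Rightarrow> (nat \<Rightarrow> nat \<Rightarrow> 'k) \<Rightarrow> nat \<Rightarrow> 'k"
  assumes m: "m \<ge> 1" and n: "n \<ge> 2" and p: "1 < p"
    and T: "lp_multilinear m 1 (ereal p) T" and A: "\<And>k. k < m \<Longrightarrow> lp_multilinear n \<infinity> 1 (A k)"
    and \<theta>: "\<theta> = (if p \<le> 2 then 2 - 2 / p else 2 / p)" and r: "1 / r = real m / 2 + \<theta> / 2"
  shows "\<exists>C\<ge>0. \<forall>(M::nat) x. (\<forall>k<m. \<forall>l<n. (\<forall>i<M. x k l i \<in> lp_carrier \<infinity>) \<and> (\<forall>c. (\<Sum>i<M. (norm (x k l i c))\<^sup>2) \<le> 1)) \<longrightarrow>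
     (\<Sum>i<M. lp_norm (ereal p) (T (\<lambda>k\<in>{..<m}. A k (\<lambda>l\<in>{..<n}. x k l i))) powr r) \<le> C"
proof -
  have n1: "n \<ge> 1" using n by simp
  obtain MA where MA0: "MA > 0" and MA1: "\<forall>k<m. \<forall>x. (\<forall>l<n. x l \<in> lp_carrier \<infinity>) \<longrightarrow>
    lp_norm 1 (A k (\<lambda>l\<in>{..<n}. x l)) \<le> MA * (\<Prod>l<n. lp_norm \<infinity> (x l))"
    using uniform_bound[of m n A, OF A n1] by blast
  obtain MT where MT0: "MT > 0" and MT1: "\<forall>x. (\<forall>l<m. x l \<in> lp_carrier 1) \<longrightarrow>
    lp_norm (ereal p) (T (\<lambda>l\<in>{..<m}. x l)) \<le> MT * (\<Prod>l<m. lp_norm 1 (x l))"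
    using lp_multilinear_bounded[OF T m] by blast
  note MA = MA0 MA1[rule_format] and MT = MT0 MT1[rule_format]
  define c where "c = MA ^ m * MT"
  have c: "c > 0" using MA(1) MT(1) by (simp add: c_def)
  define K :: real where "K = 512 * (512 * 32 ^ (n - 2))"
  have K: "K \<ge> 1"
  proof -
    have "(1::real) \<le> 32 ^ (n - 2)" by simp
    then show ?thesis unfolding K_def by linarith
  qed
  have \<theta>0: "0 < \<theta>" using p by (auto simp: \<theta> field_simps)
  have r0: "r > 0"
  proof -
    have "1 / r > 0" using r m \<theta>0 by (simp add: add_pos_nonneg)
    then show ?thesis by simp
  qed
  define C0 where "C0 = (real m * K) powr (real m * r / 2) * (sqrt K ^ m) powr r"
  define C where "C = c powr r * C0"
  have "(\<Sum>i<M. lp_norm (ereal p) (T (\<lambda>k\<in>{..<m}. A k (\<lambda>l\<in>{..<n}. x k l i))) powr r) \<le> C"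
    if x: "\<forall>k<m. \<forall>l<n. (\<forall>i<M. x k l i \<in> lp_carrier \<infinity>) \<and> (\<forall>c. (\<Sum>i<M. (norm (x k l i c))\<^sup>2) \<le> 1)" for M :: nat and x
  proof -
    have "\<And>k l i. k < m \<Longrightarrow> l < n \<Longrightarrow> i < M \<Longrightarrow> x k l i \<in> lp_carrier \<infinity>" using x by blast
    from simple_limit[of m n A M x, OF A this] obtain \<rho> R where \<rho>: "\<forall>\<nu> c. \<rho> \<nu> c < (R \<nu> :: nat)" and
      lim: "\<forall>k<m. \<forall>i<M. (\<forall>\<nu>. A k (\<lambda>l\<in>{..<n}. \<lambda>c. x k l i (\<rho> \<nu> c)) \<in> lp_carrier 1) \<and> A k (\<lambda>l\<in>{..<n}. x k l i) \<in> lp_carrier 1 \<and>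
    (\<lambda>\<nu>. lp_norm 1 (\<lambda>j. A k (\<lambda>l\<in>{..<n}. \<lambda>c. x k l i (\<rho> \<nu> c)) j - A k (\<lambda>l\<in>{..<n}. x k l i) j)) \<longlonglongrightarrow> 0"
      by blast
    define \<alpha> where "\<alpha> = (\<lambda>\<nu> i k. A k (\<lambda>l\<in>{..<n}. \<lambda>c. x k l i (\<rho> \<nu> c)))"
    define \<alpha>' where "\<alpha>' = (\<lambda>i k. A k (\<lambda>l\<in>{..<n}. x k l i))"
    have \<alpha>: "\<alpha> \<nu> i k \<in> lp_carrier 1" "\<alpha>' i k \<in> lp_carrier 1" "(\<lambda>\<nu>. lp_norm 1 (\<lambda>j. \<alpha> \<nu> i k j - \<alpha>' i k j)) \<longlonglongrightarrow> 0"
      if "k < m" "i < M" for \<nu> i k using lim that by (auto simp: \<alpha>_def \<alpha>'_def)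
    have "(\<Sum>i<M. lp_norm (ereal p) (T (\<lambda>k\<in>{..<m}. \<alpha> \<nu> i k)) powr r) \<le> C" for \<nu>
    proof (rule truncation_limit[OF T])
      fix J D :: nat
      define u where "u = (\<lambda>k i j. \<iota> (\<alpha> \<nu> i k j) / of_real MA)"
      define t where "t = (\<lambda>js d. \<iota> (T (\<lambda>k\<in>{..<m}. unit_vec (js ! k)) d) / of_real MT)"
      have "(\<Sum>i<M. (\<Sum>d<D. norm (\<Sum>js\<in>words {..<J} m. (\<Prod>k<m. u k i (js ! k)) * t js d) powr p) powr (r / p)) \<le> C0"
        unfolding C0_def
      proof (rule absolutely_summing_finite[OF m p _ _ K _ \<theta> r])
        show "hilbert_summing 1 K {..<M} {..<J} (u k)" if k: "k < m" for k
          unfolding u_def \<alpha>_def K_def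
          by (rule simple_hilbert_summing[OF n A[OF k] MA(1) MA(2)[OF k]]) (use x k \<rho> in auto)
        show "(\<Sum>d<D. norm (t js d) powr p) \<le> 1" for js
          unfolding t_def using p by (intro unit_vec_image[OF T _ MT]) auto
      qed auto
      moreover define y where "y = (\<lambda>i d. \<Sum>js\<in>words {..<J} m. (\<Prod>k<m. \<alpha> \<nu> i k (js ! k)) * T (\<lambda>k\<in>{..<m}. unit_vec (js ! k)) d)"
      moreover have "norm (\<Sum>js\<in>words {..<J} m. (\<Prod>k<m. u k i (js ! k)) * t js d) = norm (y i d) / c" for i d
        unfolding u_def t_def y_def c_def
        by (rule norm_rescaled_sum[where a = "\<lambda>k. \<alpha> \<nu> i k", OF MA(1) MT(1)])
      moreover have "(\<Sum>d<D. (norm (y i d) / c) powr p) powr (r / p) = (\<Sum>d<D. norm (y i d) powr p) powr (r / p) / c powr r" for i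
        using p c by (intro rescaled_powr) auto
      ultimately have "(\<Sum>i<M. (\<Sum>d<D. norm (y i d) powr p) powr (r / p)) / c powr r \<le> C0"
        by (simp add: sum_divide_distrib)
      then have "(\<Sum>i<M. (\<Sum>d<D. norm (y i d) powr p) powr (r / p)) \<le> C"
        using c by (simp add: C_def pos_divide_le_eq mult.commute)
      then show "(\<Sum>i<M. (\<Sum>d<D. norm (\<Sum>js\<in>words {..<J} m. (\<Prod>k<m. \<alpha> \<nu> i k (js ! k)) * T (\<lambda>k\<in>{..<m}. unit_vec (js ! k)) d) powr p) powr (r / p)) \<le> C"
        by (simp only: y_def)
    qed (use p r0 \<alpha> in auto)
    then have "(\<Sum>i<M. lp_norm (ereal p) (T (\<lambda>k\<in>{..<m}. \<alpha>' i k)) powr r) \<le> C"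
    proof (rule lp_norm_powr_limit[rotated 6])
      fix i assume "i \<in> {..<M}"
      then have i: "i < M" by simp
      show "(\<lambda>\<nu>. lp_norm (ereal p) (\<lambda>d. T (\<lambda>k\<in>{..<m}. \<alpha> \<nu> i k) d - T (\<lambda>k\<in>{..<m}. \<alpha>' i k) d)) \<longlonglongrightarrow> 0"
        by (rule lp_multilinear_tendsto[OF T]) (rule \<alpha>[OF _ i], assumption)+
      show "T (\<lambda>k\<in>{..<m}. \<alpha> \<nu> i k) \<in> lp_carrier (ereal p)" for \<nu>
        by (rule lp_multilinear_carrier[OF T]) (rule \<alpha>[OF _ i])
      show "T (\<lambda>k\<in>{..<m}. \<alpha>' i k) \<in> lp_carrier (ereal p)"
        by (rule lp_multilinear_carrier[OF T]) (rule \<alpha>[OF _ i])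
    qed (use p r0 in auto)
    then show ?thesis by (simp add: \<alpha>'_def)
  qed
  moreover have "C \<ge> 0" by (simp add: C_def C0_def)
  ultimately show ?thesis by blast
qed

text \<open>A product of \<open>m\<close> square summable sequences is \<open>2/m\<close>-summable.
  This is seen by bounding each factor by \<open>sqrt Q\<close>, where \<open>Q\<close> is the sum
  of the \<open>m\<close> squares: the power \<open>2/m\<close> of the product is then at most
  \<open>Q\<close>.\<close>

lemma absolutely_summing_core_endpoint:
  fixes T :: "(nat \<Rightarrow> nat \<Rightarrow> 'k) \<Rightarrow> nat \<Rightarrow> 'k" and A :: "nat \<Rightarrow> (nat \<Rightarrow> nat \<Rightarrow> 'k) \<Rightarrow> nat \<Rightarrow> 'k"
  assumes m: "m \<ge> 1" and n: "n \<ge> 2"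
    and T: "lp_multilinear m 1 p T" and A: "\<And>k. k < m \<Longrightarrow> lp_multilinear n \<infinity> 1 (A k)"
  shows "\<exists>C\<ge>0. \<forall>(M::nat) x. (\<forall>k<m. \<forall>l<n. (\<forall>i<M. x k l i \<in> lp_carrier \<infinity>) \<and> (\<forall>c. (\<Sum>i<M. (norm (x k l i c))\<^sup>2) \<le> 1)) \<longrightarrow>
     (\<Sum>i<M. lp_norm p (T (\<lambda>k\<in>{..<m}. A k (\<lambda>l\<in>{..<n}. x k l i))) powr (2 / real m)) \<le> C"
proof -
  have p: "1 \<le> p" using T by (simp add: lp_multilinear_def)
  have n1: "n \<ge> 1" using n by simp
  obtain MA where MA0: "MA > 0" and MA1: "\<forall>k<m. \<forall>x. (\<forall>l<n. x l \<in> lp_carrier \<infinity>) \<longrightarrow>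
    lp_norm 1 (A k (\<lambda>l\<in>{..<n}. x l)) \<le> MA * (\<Prod>l<n. lp_norm \<infinity> (x l))"
    using uniform_bound[of m n A, OF A n1] by blast
  obtain MT where MT0: "MT > 0" and MT1: "\<forall>x. (\<forall>l<m. x l \<in> lp_carrier 1) \<longrightarrow>
    lp_norm p (T (\<lambda>l\<in>{..<m}. x l)) \<le> MT * (\<Prod>l<m. lp_norm 1 (x l))"
    using lp_multilinear_bounded[OF T m] by blast
  note MA = MA0 MA1[rule_format] and MT = MT0 MT1[rule_format]
  define K :: real where "K = 512 * (512 * 32 ^ (n - 2))"
  have K: "K \<ge> 0" by (simp add: K_def)
  define C where "C = MT powr (2 / real m) * (real m * (MA\<^sup>2 * K\<^sup>2))"
  have "(\<Sum>i<M. lp_norm p (T (\<lambda>k\<in>{..<m}. A k (\<lambda>l\<in>{..<n}. x k l i))) powr (2 / real m)) \<le> C"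
    if x: "\<forall>k<m. \<forall>l<n. (\<forall>i<M. x k l i \<in> lp_carrier \<infinity>) \<and> (\<forall>c. (\<Sum>i<M. (norm (x k l i c))\<^sup>2) \<le> 1)" for M :: nat and x
  proof -
    have "\<And>k l i. k < m \<Longrightarrow> l < n \<Longrightarrow> i < M \<Longrightarrow> x k l i \<in> lp_carrier \<infinity>" using x by blast
    from simple_limit[of m n A M x, OF A this] obtain \<rho> R where \<rho>: "\<forall>\<nu> c. \<rho> \<nu> c < (R \<nu> :: nat)" and
      lim: "\<forall>k<m. \<forall>i<M. (\<forall>\<nu>. A k (\<lambda>l\<in>{..<n}. \<lambda>c. x k l i (\<rho> \<nu> c)) \<in> lp_carrier 1) \<and> A k (\<lambda>l\<in>{..<n}. x k l i) \<in> lp_carrier 1 \<and>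
    (\<lambda>\<nu>. lp_norm 1 (\<lambda>j. A k (\<lambda>l\<in>{..<n}. \<lambda>c. x k l i (\<rho> \<nu> c)) j - A k (\<lambda>l\<in>{..<n}. x k l i) j)) \<longlonglongrightarrow> 0"
      by blast
    define \<alpha> where "\<alpha> = (\<lambda>\<nu> i k. A k (\<lambda>l\<in>{..<n}. \<lambda>c. x k l i (\<rho> \<nu> c)))"
    define \<alpha>' where "\<alpha>' = (\<lambda>i k. A k (\<lambda>l\<in>{..<n}. x k l i))"
    have \<alpha>: "\<alpha> \<nu> i k \<in> lp_carrier 1" "\<alpha>' i k \<in> lp_carrier 1" "(\<lambda>\<nu>. lp_norm 1 (\<lambda>j. \<alpha> \<nu> i k j - \<alpha>' i k j)) \<longlonglongrightarrow> 0"
      if "k < m" "i < M" for \<nu> i k using lim that by (auto simp: \<alpha>_def \<alpha>'_def)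
    have nn: "0 \<le> lp_norm 1 (\<alpha>' i k)" "0 \<le> lp_norm 1 (\<alpha> \<nu> i k)" if "k < m" "i < M" for \<nu> i k
      using \<alpha>[OF that] by (auto intro: lp_norm_nonneg)
    have sq: "(\<Sum>i<M. (lp_norm 1 (\<alpha>' i k))\<^sup>2) \<le> MA\<^sup>2 * K\<^sup>2" if k: "k < m" for k
    proof -
      have "(\<Sum>i<M. (lp_norm 1 (\<alpha> \<nu> i k))\<^sup>2) \<le> MA\<^sup>2 * K\<^sup>2" for \<nu>
      proof (rule l1_square_summable[OF _ _ MA(1)])
        fix J :: nat
        have "hilbert_summing 1 K {..<M} {..<J} (\<lambda>i j. \<iota> (\<alpha> \<nu> i k j) / of_real MA)"
          unfolding \<alpha>_def K_def
          by (rule simple_hilbert_summing[OF n A[OF k] MA(1) MA(2)[OF k]]) (use x k \<rho> in auto)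
        then show "(\<Sum>i<M. (\<Sum>j<J. norm (\<iota> (\<alpha> \<nu> i k j) / of_real MA))\<^sup>2) \<le> K\<^sup>2"
          using K by (intro rows_square_summable) auto
      qed (use \<alpha> k in auto)
      then have le: "(\<Sum>i<M. lp_norm (ereal 1) (\<alpha> \<nu> i k) powr 2) \<le> MA\<^sup>2 * K\<^sup>2" for \<nu>
        using nn k by (simp flip: one_ereal_def)
      have "(\<Sum>i<M. lp_norm (ereal 1) (\<alpha>' i k) powr 2) \<le> MA\<^sup>2 * K\<^sup>2"
        by (rule lp_norm_powr_limit[where y = "\<lambda>\<nu> i. \<alpha> \<nu> i k", OF _ _ _ _ _ _ le]) (use \<alpha> k in \<open>auto simp flip: one_ereal_def\<close>)
      then show ?thesis using nn k by (simp flip: one_ereal_def)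
    qed
    have "(\<Sum>i<M. lp_norm p (T (\<lambda>k\<in>{..<m}. \<alpha>' i k)) powr (2 / real m))
      \<le> (\<Sum>i<M. MT powr (2 / real m) * (\<Sum>k<m. (lp_norm 1 (\<alpha>' i k))\<^sup>2))"
    proof (rule sum_mono)
      fix i assume "i \<in> {..<M}"
      then have i: "i < M" by simp
      define Q where "Q = (\<Sum>k<m. (lp_norm 1 (\<alpha>' i k))\<^sup>2)"
      have Q0: "Q \<ge> 0" by (simp add: Q_def sum_nonneg)
      have "lp_norm 1 (\<alpha>' i k) \<le> sqrt Q" if "k < m" for k
      proof -
        have "(lp_norm 1 (\<alpha>' i k))\<^sup>2 \<le> Q" unfolding Q_def using that by (intro member_le_sum[of k "{..<m}" "\<lambda>k. (lp_norm 1 (\<alpha>' i k))\<^sup>2"]) auto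
        then show ?thesis by (rule real_le_rsqrt)
      qed
      then have "(\<Prod>k<m. lp_norm 1 (\<alpha>' i k)) \<le> (\<Prod>k<m. sqrt Q)" using nn i by (intro prod_mono) auto
      then have "MT * (\<Prod>k<m. lp_norm 1 (\<alpha>' i k)) \<le> MT * sqrt Q ^ m" using MT0 by (intro mult_left_mono) auto
      moreover have "lp_norm p (T (\<lambda>k\<in>{..<m}. \<alpha>' i k)) \<le> MT * (\<Prod>k<m. lp_norm 1 (\<alpha>' i k))"
        using \<alpha>(2) i by (intro MT(2))
      moreover have "0 \<le> lp_norm p (T (\<lambda>k\<in>{..<m}. \<alpha>' i k))"
        using \<alpha>(2) i by (intro lp_norm_nonneg p lp_multilinear_carrier[OF T])
      ultimately have "lp_norm p (T (\<lambda>k\<in>{..<m}. \<alpha>' i k)) powr (2 / real m) \<le> (MT * sqrt Q ^ m) powr (2 / real m)"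
        using m by (intro powr_mono2) auto
      also have "\<dots> = MT powr (2 / real m) * (sqrt Q ^ m) powr (2 / real m)" by (rule powr_mult)
      also have "(sqrt Q ^ m) powr (2 / real m) = Q"
      proof (cases "Q = 0")
        case False
        then have "sqrt Q ^ m = Q powr (real m / 2)"
          using Q0 by (simp add: powr_half_sqrt[symmetric] powr_realpow[symmetric] powr_powr)
        then show ?thesis using m Q0 by (simp add: powr_powr)
      qed (use m in \<open>simp add: zero_power\<close>)
      finally show "lp_norm p (T (\<lambda>k\<in>{..<m}. \<alpha>' i k)) powr (2 / real m) \<le> MT powr (2 / real m) * (\<Sum>k<m. (lp_norm 1 (\<alpha>' i k))\<^sup>2)"
        by (simp only: Q_def)
    qed
    also have "\<dots> = MT powr (2 / real m) * (\<Sum>k<m. \<Sum>i<M. (lp_norm 1 (\<alpha>' i k))\<^sup>2)"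
      unfolding sum_distrib_left[symmetric] by (subst sum.swap) simp
    also have "\<dots> \<le> MT powr (2 / real m) * (\<Sum>k<m. MA\<^sup>2 * K\<^sup>2)"
      using sq by (intro mult_left_mono sum_mono) auto
    finally show ?thesis by (simp add: C_def \<alpha>'_def)
  qed
  moreover have "C \<ge> 0" by (simp add: C_def)
  ultimately show ?thesis by blast
qed

end

subsection \<open>Weak norms\<close>

text \<open>Evaluation at a coordinate belongs to the dual unit ball, so the weak norm dominates the
  corresponding sum at every coordinate.\<close>

lemma weak_norm_bound:
  fixes x :: "nat \<Rightarrow> nat \<Rightarrow> 'k::real_normed_field"
  assumes s: "s > 0" and W: "W \<ge> 0" and le: "weak_norm s (lp_space \<infinity>) x \<le> ennreal W"
  shows "(\<Sum>i<N. norm (x i c) powr s) \<le> W powr s"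
proof -
  have "(\<lambda>u :: nat \<Rightarrow> 'k. u c) \<in> dual_unit_ball (lp_space \<infinity>)"
    using norm_le_lp_norm[of \<infinity>] by (auto simp: dual_unit_ball_def)
  then have "epowr (\<Sum>i. ennreal (norm (x i c) powr s)) (1 / s) \<le> weak_norm s (lp_space \<infinity>) x"
    unfolding weak_norm_def by (rule SUP_upper)
  then have e: "epowr (\<Sum>i. ennreal (norm (x i c) powr s)) (1 / s) \<le> ennreal W"
    using le by (rule order_trans)
  define t where "t = (\<Sum>i. ennreal (norm (x i c) powr s))"
  have fin: "t \<noteq> \<infinity>" using e by (auto simp: epowr_def t_def top_unique)
  then have "ennreal (enn2real t powr (1 / s)) \<le> ennreal W" using e by (simp add: epowr_def t_def)
  then have "enn2real t powr (1 / s) \<le> W" using W by simp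
  then have "(enn2real t powr (1 / s)) powr s \<le> W powr s" using s by (intro powr_mono2) auto
  then have tW: "enn2real t \<le> W powr s" using s by (simp add: powr_powr)
  have "ennreal (\<Sum>i<N. norm (x i c) powr s) = (\<Sum>i<N. ennreal (norm (x i c) powr s))" by simp
  also have "\<dots> \<le> t" unfolding t_def by (rule sum_le_suminf) auto
  also have "t = ennreal (enn2real t)" using fin by (simp add: less_top)
  finally show ?thesis using tW by (simp add: sum_nonneg)
qed

text \<open>\<open>Lsum\<close> is the sum over all indices and \<open>F\<close> an exhaustion by finite sets of indices; \<open>sel e q\<close> is the
  position in the \<open>q\<close>-th sequence selected by the index \<open>e\<close>. This covers both kinds of summability.\<close>

lemma summing_from_normalised:
  fixes S :: "(nat \<Rightarrow> nat \<Rightarrow> 'k::real_normed_field) \<Rightarrow> nat \<Rightarrow> 'k" and sel :: "'e \<Rightarrow> nat \<Rightarrow> nat"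
    and Lsum :: "('e \<Rightarrow> ennreal) \<Rightarrow> ennreal"
  assumes L: "\<And>f B. (\<And>N. (\<Sum>e\<in>F N. f e) \<le> B) \<Longrightarrow> Lsum f \<le> B"
    and p: "1 \<le> p" and r: "r > 0" and s: "s > 0"
    and Sc: "\<And>x. (\<And>q. q < Q \<Longrightarrow> x q \<in> lp_carrier \<infinity>) \<Longrightarrow> S (\<lambda>q\<in>{..<Q}. x q) \<in> lp_carrier p"
    and hom: "\<And>c x. (\<And>q. q < Q \<Longrightarrow> x q \<in> lp_carrier \<infinity>) \<Longrightarrow>
       S (\<lambda>q\<in>{..<Q}. \<lambda>i. c q * x q i) = (\<lambda>d. (\<Prod>q<Q. c q) * S (\<lambda>q\<in>{..<Q}. x q) d)"
    and C: "C \<ge> 0" and core: "\<And>x N. (\<And>q i. q < Q \<Longrightarrow> x q i \<in> lp_carrier \<infinity>) \<Longrightarrow>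
       (\<And>q c N. q < Q \<Longrightarrow> (\<Sum>i<N. norm (x q i c) powr s) \<le> 1) \<Longrightarrow>
       (\<Sum>e\<in>F N. lp_norm p (S (\<lambda>q\<in>{..<Q}. x q (sel e q))) powr r) \<le> C"
  shows "\<exists>C>0. \<forall>x. (\<forall>q<Q. \<forall>i. x q i \<in> vcarrier (lp_space \<infinity>)) \<longrightarrow>
     epowr (Lsum (\<lambda>e. ennreal (vnorm (lp_space p) (S (\<lambda>q\<in>{..<Q}. x q (sel e q))) powr r))) (1 / r)
     \<le> ennreal C * (\<Prod>q<Q. weak_norm s (lp_space \<infinity>) (x q))"
proof (intro exI[of _ "C powr (1 / r) + 1"] conjI allI impI)
  \<comment> \<open>The summand 1 keeps the constant positive when \<open>C = 0\<close>.\<close>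
  show "0 < C powr (1 / r) + 1" by (simp add: add_nonneg_pos)
  fix x :: "nat \<Rightarrow> nat \<Rightarrow> nat \<Rightarrow> 'k" assume "\<forall>q<Q. \<forall>i. x q i \<in> vcarrier (lp_space \<infinity>)"
  then have x: "x q i \<in> lp_carrier \<infinity>" if "q < Q" for q i using that by simp
  define w where "w = (\<lambda>q. weak_norm s (lp_space \<infinity>) (x q))"
  define G where "G = (\<lambda>e. lp_norm p (S (\<lambda>q\<in>{..<Q}. x q (sel e q))))"
  have "epowr (Lsum (\<lambda>e. ennreal (G e powr r))) (1 / r) \<le> ennreal (C powr (1 / r) + 1) * (\<Prod>q<Q. w q)"
  proof -
    \<comment> \<open>If some weak norm is 0, its sequence vanishes and so does the left side. If
      none is 0 and one is infinite, the product is infinite. Otherwise each sequence can be divided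
      by its weak norm.\<close>
    consider (zero) "\<exists>q<Q. w q = 0" | (top) "\<forall>q<Q. w q \<noteq> 0" "\<exists>q<Q. w q = \<infinity>" | (fin) "\<forall>q<Q. w q \<noteq> 0 \<and> w q \<noteq> \<infinity>"
      by blast
    then show ?thesis
    proof cases
      case zero
      then obtain q where q: "q < Q" "w q = 0" by blast
      have x0: "x q i c = 0" for i c
      proof -
        have "(\<Sum>i<Suc i. norm (x q i c) powr s) \<le> 0 powr s"
          using q(2) by (intro weak_norm_bound s) (simp_all add: w_def)
        moreover have "norm (x q i c) powr s \<le> (\<Sum>i<Suc i. norm (x q i c) powr s)"
          by (intro member_le_sum) auto
        ultimately have "norm (x q i c) powr s \<le> 0 powr s" by linarith
        then show ?thesis by simp
      qed
      have "G e = 0" for e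
      proof -
        have eq: "(\<lambda>k\<in>{..<Q}. \<lambda>i. (if k = q then 0 else 1) * x k (sel e k) i) = (\<lambda>k\<in>{..<Q}. x k (sel e k))"
          using x0 by (auto intro!: restrict_ext)
        have P0: "(\<Prod>k<Q. if k = q then 0 else 1 :: 'k) = 0" using q by (intro prod_zero) auto
        have "S (\<lambda>k\<in>{..<Q}. x k (sel e k)) = (\<lambda>_. 0)"
          using hom[where x = "\<lambda>k. x k (sel e k)" and c = "\<lambda>k. if k = q then 0 else 1", OF x] unfolding eq P0 mult_zero_left .
        then show ?thesis unfolding G_def by (simp only: lp_norm_zero[OF p])
      qed
      then have "Lsum (\<lambda>e. ennreal (G e powr r)) \<le> 0" by (intro L) simp
      then show ?thesis by (simp add: epowr_def)
    next
      case top
      then obtain q where q: "q < Q" "w q = \<infinity>" by blast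
      have "(\<Prod>q<Q. w q) = w q * (\<Prod>q\<in>{..<Q} - {q}. w q)" using q by (intro prod.remove) auto
      also have "\<dots> = \<infinity>" using q top by (simp add: ennreal_top_mult prod_zero_iff)
      finally have "(\<Prod>q<Q. w q) = \<infinity>" .
      moreover have "C powr (1 / r) + 1 > 0" by (simp add: add_nonneg_pos)
      ultimately show ?thesis by (simp add: ennreal_mult_top)
    next
      case fin
      define W where "W = (\<lambda>q. enn2real (w q))"
      have wW: "w q = ennreal (W q)" if "q < Q" for q using fin that by (simp add: W_def less_top)
      have W: "W q > 0" if "q < Q" for q
      proof -
        have "W q \<noteq> 0" using fin that wW[OF that] by auto
        moreover have "0 \<le> W q" by (simp add: W_def)
        ultimately show ?thesis by linarith
      qed
      define PW where "PW = (\<Prod>q<Q. W q)"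
      have PW: "PW > 0" unfolding PW_def using W by (intro prod_pos) auto
      define x' where "x' = (\<lambda>q i c. of_real (1 / W q) * x q i c)"
      have x'c: "x' q i \<in> lp_carrier \<infinity>" if "q < Q" for q i
        unfolding x'_def using x[OF that] by (intro lp_carrier_scale) auto
      have x'1: "(\<Sum>i<N. norm (x' q i c) powr s) \<le> 1" if q: "q < Q" for q c N
      proof -
        have "(\<Sum>i<N. norm (x' q i c) powr s) = (\<Sum>i<N. norm (x q i c) powr s) / W q powr s"
          using W[OF q] by (simp add: x'_def norm_divide norm_mult powr_divide sum_divide_distrib)
        moreover have "(\<Sum>i<N. norm (x q i c) powr s) \<le> W q powr s"
          using W[OF q] wW[OF q] by (intro weak_norm_bound s) (auto simp: w_def)
        ultimately show ?thesis using W[OF q] by simp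
      qed
      have G: "G e = PW * lp_norm p (S (\<lambda>q\<in>{..<Q}. x' q (sel e q)))" for e
      proof -
        have "(\<lambda>q\<in>{..<Q}. x q (sel e q)) = (\<lambda>q\<in>{..<Q}. \<lambda>i. of_real (W q) * x' q (sel e q) i)"
          using W by (intro restrict_ext) (force simp: x'_def)
        then have "S (\<lambda>q\<in>{..<Q}. x q (sel e q)) = (\<lambda>d. (\<Prod>q<Q. of_real (W q)) * S (\<lambda>q\<in>{..<Q}. x' q (sel e q)) d)"
          using hom[where x = "\<lambda>q. x' q (sel e q)" and c = "\<lambda>q. of_real (W q)", OF x'c] by (simp only:)
        moreover have "norm (\<Prod>q<Q. of_real (W q) :: 'k) = PW"
          unfolding prod_norm[symmetric] PW_def using W by (intro prod.cong) (auto simp: abs_of_pos)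
        ultimately show ?thesis
          unfolding G_def using lp_norm_scale[OF p Sc[where x = "\<lambda>q. x' q (sel e q)", OF x'c]] by (simp only:)
      qed
      have "Lsum (\<lambda>e. ennreal (G e powr r)) \<le> ennreal (PW powr r * C)"
      proof (rule L)
        fix N
        have "(\<Sum>e\<in>F N. G e powr r) = PW powr r * (\<Sum>e\<in>F N. lp_norm p (S (\<lambda>q\<in>{..<Q}. x' q (sel e q))) powr r)"
          unfolding G sum_distrib_left by (intro sum.cong refl powr_mult)
        also have "\<dots> \<le> PW powr r * C" by (intro mult_left_mono core x'c x'1) auto
        finally show "(\<Sum>e\<in>F N. ennreal (G e powr r)) \<le> ennreal (PW powr r * C)"
          by (simp add: ennreal_leI)
      qed
      then have "epowr (Lsum (\<lambda>e. ennreal (G e powr r))) (1 / r) \<le> ennreal ((PW powr r * C) powr (1 / r))"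
      proof -
        assume le: "Lsum (\<lambda>e. ennreal (G e powr r)) \<le> ennreal (PW powr r * C)"
        have "enn2real (Lsum (\<lambda>e. ennreal (G e powr r))) \<le> PW powr r * C"
          using enn2real_mono[OF le] C by simp
        then show ?thesis using le r by (auto simp: epowr_def top_unique intro!: ennreal_leI powr_mono2)
      qed
      also have "(PW powr r * C) powr (1 / r) = PW * C powr (1 / r)"
        using r PW by (simp add: powr_mult powr_powr)
      also have "ennreal (PW * C powr (1 / r)) \<le> ennreal ((C powr (1 / r) + 1) * PW)"
        using PW by (intro ennreal_leI) (simp add: algebra_simps)
      also have "\<dots> = ennreal (C powr (1 / r) + 1) * (\<Prod>q<Q. w q)"
      proof -
        have "(\<Prod>q<Q. w q) = (\<Prod>q<Q. ennreal (W q))" using wW by (intro prod.cong) auto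
        also have "\<dots> = ennreal PW" unfolding PW_def using W by (intro prod_ennreal) (auto intro: less_imp_le)
        finally show ?thesis using PW by (simp add: ennreal_mult)
      qed
      finally show ?thesis .
    qed
  qed
  then show "epowr (Lsum (\<lambda>e. ennreal (vnorm (lp_space p) (S (\<lambda>q\<in>{..<Q}. x q (sel e q))) powr r))) (1 / r)
     \<le> ennreal (C powr (1 / r) + 1) * (\<Prod>q<Q. weak_norm s (lp_space \<infinity>) (x q))"
    by (simp add: G_def w_def)
qed

section \<open>Positions in the argument tuple of the composition\<close>

lemma block_index: "k < m \<Longrightarrow> l < n \<Longrightarrow> k * n + l < m * (n::nat)"
  by (metis add.commute add_less_cancel_left less_le_trans mult.commute mult_Suc mult_le_mono2 Suc_leI)

lemma prod_blocks:
  fixes c :: "nat \<Rightarrow> 'a::comm_monoid_mult"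
  shows "(\<Prod>k<m. \<Prod>l<n. c (k * n + l)) = (\<Prod>q<m * n. c q)"
proof -
  have "(\<Prod>l<n. c (k * n + l)) = prod c {k * n..<k * n + n}" for k
    using prod.shift_bounds_nat_ivl[of c 0 "k * n" n] by (simp add: add.commute atLeast0LessThan)
  then show ?thesis using prod.nat_group[of c n m] by simp
qed

lemma multi_comp_blocks:
  "multi_comp m n T A (\<lambda>q\<in>{..<m * n}. y q) = T (\<lambda>k\<in>{..<m}. A k (\<lambda>l\<in>{..<n}. y (k * n + l)))"
proof -
  have "(\<lambda>k\<in>{..<m}. A k (\<lambda>l\<in>{..<n}. (\<lambda>q\<in>{..<m * n}. y q) (k * n + l))) = (\<lambda>k\<in>{..<m}. A k (\<lambda>l\<in>{..<n}. y (k * n + l)))"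
  proof (rule restrict_ext)
    fix k assume k: "k \<in> {..<m}"
    have "(\<lambda>l\<in>{..<n}. (\<lambda>q\<in>{..<m * n}. y q) (k * n + l)) = (\<lambda>l\<in>{..<n}. y (k * n + l))"
      by (rule restrict_ext) (use k block_index in auto)
    then show "A k (\<lambda>l\<in>{..<n}. (\<lambda>q\<in>{..<m * n}. y q) (k * n + l)) = A k (\<lambda>l\<in>{..<n}. y (k * n + l))" by simp
  qed
  then show ?thesis by (simp only: multi_comp_def)
qed

lemma multi_comp_carrier:
  assumes T: "lp_multilinear m 1 p T" and A: "\<And>k. k < m \<Longrightarrow> lp_multilinear n \<infinity> 1 (A k)"
    and x: "\<And>q. q < m * n \<Longrightarrow> x q \<in> lp_carrier \<infinity>"
  shows "multi_comp m n T A (\<lambda>q\<in>{..<m * n}. x q) \<in> lp_carrier p"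
  unfolding multi_comp_blocks
  by (intro lp_multilinear_carrier[OF T] lp_multilinear_carrier[OF A] x block_index)

lemma multi_comp_scale:
  assumes T: "lp_multilinear m 1 p T" and A: "\<And>k. k < m \<Longrightarrow> lp_multilinear n \<infinity> 1 (A k)"
    and x: "\<And>q. q < m * n \<Longrightarrow> x q \<in> lp_carrier \<infinity>"
  shows "multi_comp m n T A (\<lambda>q\<in>{..<m * n}. \<lambda>i. c q * x q i)
    = (\<lambda>d. (\<Prod>q<m * n. c q) * multi_comp m n T A (\<lambda>q\<in>{..<m * n}. x q) d)"
proof -
  have "(\<lambda>k\<in>{..<m}. A k (\<lambda>l\<in>{..<n}. \<lambda>i. c (k * n + l) * x (k * n + l) i))
    = (\<lambda>k\<in>{..<m}. \<lambda>i. (\<Prod>l<n. c (k * n + l)) * A k (\<lambda>l\<in>{..<n}. x (k * n + l)) i)"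
  proof (rule restrict_ext)
    fix k assume "k \<in> {..<m}"
    then have k: "k < m" by simp
    show "A k (\<lambda>l\<in>{..<n}. \<lambda>i. c (k * n + l) * x (k * n + l) i)
      = (\<lambda>i. (\<Prod>l<n. c (k * n + l)) * A k (\<lambda>l\<in>{..<n}. x (k * n + l)) i)"
      by (rule lp_multilinear_scale[OF A[OF k]]) (intro x block_index k)
  qed
  moreover have "T (\<lambda>k\<in>{..<m}. \<lambda>i. (\<Prod>l<n. c (k * n + l)) * A k (\<lambda>l\<in>{..<n}. x (k * n + l)) i)
    = (\<lambda>d. (\<Prod>k<m. \<Prod>l<n. c (k * n + l)) * T (\<lambda>k\<in>{..<m}. A k (\<lambda>l\<in>{..<n}. x (k * n + l))) d)"
    by (rule lp_multilinear_scale[OF T]) (intro lp_multilinear_carrier[OF A] x block_index)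
  ultimately show ?thesis unfolding multi_comp_blocks prod_blocks by (simp only:)
qed

text \<open>Cutting a flat multi-index into \<open>m\<close> blocks of length \<open>n\<close> is
  injective, since position \<open>q\<close> is recovered from \<open>q div n\<close> and
  \<open>q mod n\<close>; the summands are nonnegative.\<close>

lemma sum_PiE_le_sum_words:
  fixes g :: "nat list list \<Rightarrow> real"
  assumes g: "\<And>is. 0 \<le> g is"
  shows "(\<Sum>e\<in>{..<m * n} \<rightarrow>\<^sub>E {..<N}. g (map (\<lambda>k. map (\<lambda>l. e (k * n + l)) [0..<n]) [0..<m]))
    \<le> (\<Sum>is\<in>words (words {..<N} n) m. g is)"
proof -
  define \<phi> where "\<phi> = (\<lambda>e :: nat \<Rightarrow> nat. map (\<lambda>k. map (\<lambda>l. e (k * n + l)) [0..<n]) [0..<m])"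
  define P where "P = ({..<m * n} \<rightarrow>\<^sub>E {..<N})"
  have "inj_on \<phi> P"
  proof (rule inj_onI)
    fix e e' assume e: "e \<in> P" "e' \<in> P" "\<phi> e = \<phi> e'"
    show "e = e'"
    proof (rule PiE_ext[of _ "{..<m * n}" "\<lambda>_. {..<N}"])
      fix q assume "q \<in> {..<m * n}"
      then have q: "q < m * n" by simp
      then have n: "n > 0" by (cases n) auto
      have "q div n < m" "q mod n < n" using q n by (simp_all add: less_mult_imp_div_less)
      then have "\<phi> e ! (q div n) ! (q mod n) = e q" "\<phi> e' ! (q div n) ! (q mod n) = e' q"
        by (simp_all add: \<phi>_def)
      then show "e q = e' q" using e(3) by simp
    qed (use e in \<open>auto simp: P_def\<close>)
  qed
  then have "(\<Sum>e\<in>P. g (\<phi> e)) = (\<Sum>is\<in>\<phi> ` P. g is)" by (simp add: sum.reindex)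
  also have "\<dots> \<le> (\<Sum>is\<in>words (words {..<N} n) m. g is)"
  proof (rule sum_mono2)
    show "\<phi> ` P \<subseteq> words (words {..<N} n) m"
      using block_index by (fastforce simp: \<phi>_def P_def words_def PiE_def Pi_def)
  qed (use g in \<open>auto intro: finite_words\<close>)
  finally show ?thesis by (simp add: \<phi>_def P_def)
qed

text \<open>Finitely many multi-indices involve finitely many values, so they lie in a common finite
  box.\<close>

lemma infsum_PiE_le:
  fixes f :: "(nat \<Rightarrow> nat) \<Rightarrow> ennreal"
  assumes "\<And>N. (\<Sum>e\<in>{..<Q} \<rightarrow>\<^sub>E {..<N}. f e) \<le> B"
  shows "(\<Sum>\<^sub>\<infinity>e\<in>{..<Q} \<rightarrow>\<^sub>E UNIV. f e) \<le> B"
proof (rule infsum_le_finite_sums)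
  show "f summable_on ({..<Q} \<rightarrow>\<^sub>E UNIV)" by (rule nonneg_summable_on_complete) simp
  fix F assume F: "finite F" "F \<subseteq> {..<Q::nat} \<rightarrow>\<^sub>E (UNIV :: nat set)"
  have "finite ((\<lambda>(e, q). e q) ` (F \<times> {..<Q}))" using F by simp
  then obtain N where N: "\<forall>v\<in>(\<lambda>(e, q). e q) ` (F \<times> {..<Q}). v < N"
    using finite_nat_set_iff_bounded by blast
  have "F \<subseteq> {..<Q} \<rightarrow>\<^sub>E {..<N}"
  proof
    fix e assume e: "e \<in> F"
    then have "e q < N" if "q < Q" for q using N that by force
    then show "e \<in> {..<Q} \<rightarrow>\<^sub>E {..<N}" using F(2) e by (auto simp: PiE_def)
  qed
  then have "sum f F \<le> (\<Sum>e\<in>{..<Q} \<rightarrow>\<^sub>E {..<N}. f e)" by (intro sum_mono2) (auto intro: finite_PiE)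
  then show "sum f F \<le> B" using assms order_trans by blast
qed

section \<open>Summability of the composition\<close>

context scalar_embedding
begin

lemma composition_multiple_summing:
  fixes T :: "(nat \<Rightarrow> nat \<Rightarrow> 'k) \<Rightarrow> nat \<Rightarrow> 'k" and A :: "nat \<Rightarrow> (nat \<Rightarrow> nat \<Rightarrow> 'k) \<Rightarrow> nat \<Rightarrow> 'k"
  assumes r: "r > 0" and T: "lp_multilinear m 1 p T" and A: "\<And>k. k < m \<Longrightarrow> lp_multilinear n \<infinity> 1 (A k)"
    and core: "\<exists>C\<ge>0. \<forall>(N::nat) x. (\<forall>k<m. \<forall>l<n. (\<forall>i<N. x k l i \<in> lp_carrier \<infinity>) \<and> (\<forall>c. (\<Sum>i<N. norm (x k l i c)) \<le> 1)) \<longrightarrow>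
     (\<Sum>is\<in>words (words {..<N} n) m. lp_norm p (T (\<lambda>k\<in>{..<m}. A k (\<lambda>l\<in>{..<n}. x k l (is ! k ! l)))) powr r) \<le> C"
  shows "multiple_summing (m * n) (\<lambda>_. lp_space \<infinity>) (lp_space p) r 1 (multi_comp m n T A)"
proof -
  obtain C where C: "C \<ge> 0" and core': "\<forall>(N::nat) x. (\<forall>k<m. \<forall>l<n. (\<forall>i<N. x k l i \<in> lp_carrier \<infinity>) \<and> (\<forall>c. (\<Sum>i<N. norm (x k l i c)) \<le> 1)) \<longrightarrow>
     (\<Sum>is\<in>words (words {..<N} n) m. lp_norm p (T (\<lambda>k\<in>{..<m}. A k (\<lambda>l\<in>{..<n}. x k l (is ! k ! l)))) powr r) \<le> C"
    using core by blast
  show ?thesis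
    unfolding multiple_summing_def
  proof (rule summing_from_normalised[where F = "\<lambda>N. {..<m * n} \<rightarrow>\<^sub>E {..<N}" and sel = "\<lambda>e. e"
      and Lsum = "\<lambda>f. \<Sum>\<^sub>\<infinity>e\<in>{..<m * n} \<rightarrow>\<^sub>E UNIV. f e" and C = C])
    fix x :: "nat \<Rightarrow> nat \<Rightarrow> nat \<Rightarrow> 'k" and N
    assume x: "\<And>q i. q < m * n \<Longrightarrow> x q i \<in> lp_carrier \<infinity>"
      and x1: "\<And>q c N. q < m * n \<Longrightarrow> (\<Sum>i<N. norm (x q i c) powr 1) \<le> 1"
    define g where "g = (\<lambda>is. lp_norm p (T (\<lambda>k\<in>{..<m}. A k (\<lambda>l\<in>{..<n}. x (k * n + l) (is ! k ! l)))) powr r)"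
    have "lp_norm p (multi_comp m n T A (\<lambda>q\<in>{..<m * n}. x q (e q))) powr r
      = g (map (\<lambda>k. map (\<lambda>l. e (k * n + l)) [0..<n]) [0..<m])" for e
    proof -
      have "(\<lambda>k\<in>{..<m}. A k (\<lambda>l\<in>{..<n}. x (k * n + l) (e (k * n + l))))
        = (\<lambda>k\<in>{..<m}. A k (\<lambda>l\<in>{..<n}. x (k * n + l) (map (\<lambda>k. map (\<lambda>l. e (k * n + l)) [0..<n]) [0..<m] ! k ! l)))"
        by (intro restrict_ext arg_cong[where f = "A _"]) simp
      then show ?thesis unfolding g_def multi_comp_blocks by (simp only:)
    qed
    then have "(\<Sum>e\<in>{..<m * n} \<rightarrow>\<^sub>E {..<N}. lp_norm p (multi_comp m n T A (\<lambda>q\<in>{..<m * n}. x q (e q))) powr r)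
      \<le> (\<Sum>is\<in>words (words {..<N} n) m. g is)"
      using sum_PiE_le_sum_words[of g n m N] by (simp add: g_def)
    also have "\<dots> \<le> C"
      unfolding g_def using x x1 block_index
      by (intro core'[rule_format, of N "\<lambda>k l. x (k * n + l)"]) simp
    finally show "(\<Sum>e\<in>{..<m * n} \<rightarrow>\<^sub>E {..<N}. lp_norm p (multi_comp m n T A (\<lambda>q\<in>{..<m * n}. x q (e q))) powr r) \<le> C" .
  next
    show "1 \<le> p" using T by (simp add: lp_multilinear_def)
  next
    show "multi_comp m n T A (\<lambda>q\<in>{..<m * n}. x q) \<in> lp_carrier p" if "\<And>q. q < m * n \<Longrightarrow> x q \<in> lp_carrier \<infinity>" for x
      by (rule multi_comp_carrier[OF T A that])
    show "multi_comp m n T A (\<lambda>q\<in>{..<m * n}. \<lambda>i. c q * x q i)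
      = (\<lambda>d. (\<Prod>q<m * n. c q) * multi_comp m n T A (\<lambda>q\<in>{..<m * n}. x q) d)" if "\<And>q. q < m * n \<Longrightarrow> x q \<in> lp_carrier \<infinity>" for c x
      by (rule multi_comp_scale[OF T A that])
  qed (use r C infsum_PiE_le in auto)
qed

lemma composition_absolutely_summing:
  fixes T :: "(nat \<Rightarrow> nat \<Rightarrow> 'k) \<Rightarrow> nat \<Rightarrow> 'k" and A :: "nat \<Rightarrow> (nat \<Rightarrow> nat \<Rightarrow> 'k) \<Rightarrow> nat \<Rightarrow> 'k"
  assumes r: "r > 0" and T: "lp_multilinear m 1 p T" and A: "\<And>k. k < m \<Longrightarrow> lp_multilinear n \<infinity> 1 (A k)"
    and core: "\<exists>C\<ge>0. \<forall>(M::nat) x. (\<forall>k<m. \<forall>l<n. (\<forall>i<M. x k l i \<in> lp_carrier \<infinity>) \<and> (\<forall>c. (\<Sum>i<M. (norm (x k l i c))\<^sup>2) \<le> 1)) \<longrightarrow>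
     (\<Sum>i<M. lp_norm p (T (\<lambda>k\<in>{..<m}. A k (\<lambda>l\<in>{..<n}. x k l i))) powr r) \<le> C"
  shows "absolutely_summing (m * n) (\<lambda>_. lp_space \<infinity>) (lp_space p) r 2 (multi_comp m n T A)"
proof -
  obtain C where C: "C \<ge> 0" and core': "\<forall>(M::nat) x. (\<forall>k<m. \<forall>l<n. (\<forall>i<M. x k l i \<in> lp_carrier \<infinity>) \<and> (\<forall>c. (\<Sum>i<M. (norm (x k l i c))\<^sup>2) \<le> 1)) \<longrightarrow>
     (\<Sum>i<M. lp_norm p (T (\<lambda>k\<in>{..<m}. A k (\<lambda>l\<in>{..<n}. x k l i))) powr r) \<le> C"
    using core by blast
  show ?thesis
    unfolding absolutely_summing_def
  proof (rule summing_from_normalised[where F = "\<lambda>N. {..<N}" and sel = "\<lambda>i _. i" and Lsum = suminf and C = C])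
    fix x :: "nat \<Rightarrow> nat \<Rightarrow> nat \<Rightarrow> 'k" and N
    assume x: "\<And>q i. q < m * n \<Longrightarrow> x q i \<in> lp_carrier \<infinity>"
      and x1: "\<And>q c N. q < m * n \<Longrightarrow> (\<Sum>i<N. norm (x q i c) powr 2) \<le> 1"
    show "(\<Sum>i<N. lp_norm p (multi_comp m n T A (\<lambda>q\<in>{..<m * n}. x q i)) powr r) \<le> C"
      unfolding multi_comp_blocks using x x1 block_index
      by (intro core'[rule_format, of N "\<lambda>k l. x (k * n + l)"]) simp
  next
    show "1 \<le> p" using T by (simp add: lp_multilinear_def)
  next
    show "multi_comp m n T A (\<lambda>q\<in>{..<m * n}. x q) \<in> lp_carrier p" if "\<And>q. q < m * n \<Longrightarrow> x q \<in> lp_carrier \<infinity>" for x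
      by (rule multi_comp_carrier[OF T A that])
    show "multi_comp m n T A (\<lambda>q\<in>{..<m * n}. \<lambda>i. c q * x q i)
      = (\<lambda>d. (\<Prod>q<m * n. c q) * multi_comp m n T A (\<lambda>q\<in>{..<m * n}. x q) d)" if "\<And>q. q < m * n \<Longrightarrow> x q \<in> lp_carrier \<infinity>" for c x
      by (rule multi_comp_scale[OF T A that])
  qed (use r C in \<open>auto intro: suminf_le_const\<close>)
qed

lemma composition_summing:
  fixes T :: "(nat \<Rightarrow> nat \<Rightarrow> 'k) \<Rightarrow> nat \<Rightarrow> 'k" and A :: "nat \<Rightarrow> (nat \<Rightarrow> nat \<Rightarrow> 'k) \<Rightarrow> nat \<Rightarrow> 'k"
  assumes m: "m \<ge> 1" and n: "n \<ge> 1" and p: "1 \<le> p"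
    and r1: "r1 = (if p \<le> 2 then 2 * real n / (real n + 2 - real_of_ereal (2 / p))
                   else 2 * real n / (real n + real_of_ereal (2 / p)))"
    and r2: "r2 = (if p \<le> 2 then 2 * real_of_ereal p /
                                 (real m * real_of_ereal p + 2 * real_of_ereal p - 2)
                   else if p < \<infinity> then 2 * real_of_ereal p / (real m * real_of_ereal p + 2)
                   else 2 / real m)"
    and cont: "continuous_multilinear_map m (\<lambda>_. lp_space 1) (lp_space p) T \<and>
        (\<forall>k<m. continuous_multilinear_map n (\<lambda>_. lp_space \<infinity>) (lp_space 1) (A k))"
  shows "multiple_summing (m * n) (\<lambda>_. lp_space \<infinity>) (lp_space p) r1 1 (multi_comp m n T A) \<and>
        (n \<ge> 2 \<longrightarrow>
          absolutely_summing (m * n) (\<lambda>_. lp_space \<infinity>) (lp_space p) r2 2 (multi_comp m n T A))"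
proof -
  have T: "lp_multilinear m 1 p T" using cont p by (simp add: lp_multilinear_def)
  have A: "lp_multilinear n \<infinity> 1 (A k)" if "k < m" for k using cont that by (simp add: lp_multilinear_def)
  consider (ends) "p = \<infinity> \<or> p = 1" | (mid) q where "p = ereal q" "1 < q"
    using p by (cases rule: ereal_ge_1_cases) (force simp: one_ereal_def)+
  then show ?thesis
  proof cases
    case ends
    \<comment> \<open>At both ends \<open>\<theta> = 0\<close>, so the two formulas agree: for
      \<open>p = \<infinity>\<close> because \<open>2/p\<close> is 0, for \<open>p = 1\<close>
      because \<open>2 - 2/p\<close> is 0.\<close>
    then have r: "r1 = 2" "r2 = 2 / real m" using n m by (auto simp: r1 r2)
    have "multiple_summing (m * n) (\<lambda>_. lp_space \<infinity>) (lp_space p) r1 1 (multi_comp m n T A)"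
      unfolding r by (intro composition_multiple_summing[OF _ T A] multiple_summing_core_endpoint[OF m n T A]) auto
    moreover have "absolutely_summing (m * n) (\<lambda>_. lp_space \<infinity>) (lp_space p) r2 2 (multi_comp m n T A)" if "n \<ge> 2"
      unfolding r using m by (intro composition_absolutely_summing[OF _ T A] absolutely_summing_core_endpoint[OF m that T A]) auto
    ultimately show ?thesis by blast
  next
    case mid
    define \<theta> where "\<theta> = (if q \<le> 2 then 2 - 2 / q else 2 / q)"
    have \<theta>0: "\<theta> > 0" using mid by (auto simp: \<theta>_def field_simps)
    have p2: "p \<le> 2 \<longleftrightarrow> q \<le> 2" using mid by simp
    have q2: "real_of_ereal (2 / p) = 2 / q" "real_of_ereal p = q" "p < \<infinity>" using mid by auto
    have e1: "1 / r1 = 1/2 + \<theta> / (2 * real n)"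
      using n mid unfolding r1 p2 q2 \<theta>_def by (simp add: field_simps)
    have e2: "1 / r2 = real m / 2 + \<theta> / 2"
      using m mid q2(3) unfolding r2 p2 q2 \<theta>_def by (simp add: field_simps)
    have "1 / r1 > 0" unfolding e1 using \<theta>0 by (simp add: add_pos_nonneg)
    then have r10: "r1 > 0" by simp
    have "1 / r2 > 0" unfolding e2 using \<theta>0 by (simp add: add_nonneg_pos)
    then have r20: "r2 > 0" by simp
    note Tq = T[unfolded mid(1)]
    have "multiple_summing (m * n) (\<lambda>_. lp_space \<infinity>) (lp_space p) r1 1 (multi_comp m n T A)"
      unfolding mid(1)
      by (intro composition_multiple_summing[OF r10 Tq A] multiple_summing_core[OF m n mid(2) Tq A \<theta>_def e1])
    moreover have "absolutely_summing (m * n) (\<lambda>_. lp_space \<infinity>) (lp_space p) r2 2 (multi_comp m n T A)" if "n \<ge> 2"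
      unfolding mid(1)
      by (intro composition_absolutely_summing[OF r20 Tq A] absolutely_summing_core[OF m that mid(2) Tq A \<theta>_def e2])
    ultimately show ?thesis by blast
  qed
qed

end

theorem theorem2p3:
  fixes m n :: nat and p :: ereal and r1 r2 :: real
  assumes "m \<ge> 1" and "n \<ge> 1" and "1 \<le> p"
    and r1: "r1 = (if p \<le> 2 then 2 * real n / (real n + 2 - real_of_ereal (2 / p))
                   else 2 * real n / (real n + real_of_ereal (2 / p)))"
    and r2: "r2 = (if p \<le> 2 then 2 * real_of_ereal p /
                                 (real m * real_of_ereal p + 2 * real_of_ereal p - 2)
                   else if p < \<infinity> then 2 * real_of_ereal p / (real m * real_of_ereal p + 2)
                   else 2 / real m)"
  shows
    "(\<forall>(T :: (nat \<Rightarrow> nat \<Rightarrow> real) \<Rightarrow> nat \<Rightarrow> real)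
       (A :: nat \<Rightarrow> (nat \<Rightarrow> nat \<Rightarrow> real) \<Rightarrow> nat \<Rightarrow> real).
        continuous_multilinear_map m (\<lambda>_. lp_space 1) (lp_space p) T \<and>
        (\<forall>k<m. continuous_multilinear_map n (\<lambda>_. lp_space \<infinity>) (lp_space 1) (A k)) \<longrightarrow>
        multiple_summing (m * n) (\<lambda>_. lp_space \<infinity>) (lp_space p) r1 1 (multi_comp m n T A) \<and>
        (n \<ge> 2 \<longrightarrow>
          absolutely_summing (m * n) (\<lambda>_. lp_space \<infinity>) (lp_space p) r2 2 (multi_comp m n T A)))
     \<and>
     (\<forall>(T :: (nat \<Rightarrow> nat \<Rightarrow> complex) \<Rightarrow> nat \<Rightarrow> complex)
       (A :: nat \<Rightarrow> (nat \<Rightarrow> nat \<Rightarrow> complex) \<Rightarrow> nat \<Rightarrow> complex).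
        continuous_multilinear_map m (\<lambda>_. lp_space 1) (lp_space p) T \<and>
        (\<forall>k<m. continuous_multilinear_map n (\<lambda>_. lp_space \<infinity>) (lp_space 1) (A k)) \<longrightarrow>
        multiple_summing (m * n) (\<lambda>_. lp_space \<infinity>) (lp_space p) r1 1 (multi_comp m n T A) \<and>
        (n \<ge> 2 \<longrightarrow>
          absolutely_summing (m * n) (\<lambda>_. lp_space \<infinity>) (lp_space p) r2 2 (multi_comp m n T A)))"
proof -
  interpret R: scalar_embedding complex_of_real by unfold_locales auto
  interpret C: scalar_embedding "\<lambda>z::complex. z" by unfold_locales auto
  show ?thesis
    using R.composition_summing[OF assms] C.composition_summing[OF assms] by blast
qed

end
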